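(* Let $R$ be a finite Frobenius local ring with unity (not assumed commutative). Let $C$ and $D$ be two free linear codes in $R^n$ (i.e. right $R$-submodules of $R^n$ that are free as right $R$-modules) with generator matrices $\mathrm{G}_1,\mathrm{G}_2$ and parity check matrices $\mathrm{H}_1,\mathrm{H}_2$ respectively, and suppose $|C||D|=|R^n|$. Then the following are equivalent: (1) the pair $(C,D)$ is LCP; (2) the block matrix $\begin{pmatrix}\mathrm{G}_1\\ \mathrm{G}_2\end{pmatrix}$ is invertible over $R$; (3) the block matrix $\begin{pmatrix}\mathrm{H}_1\\ \mathrm{H}_2\end{pmatrix}$ is invertible over $R$.
   Context: A ring is local if its non-units form an additive abelian group; for a finite local ring $R$, the Jacobson radical $J(R)$ is the set of non-units and $R/J(R)=\mathbb{F}_q$ is a finite field; $\pi:R\to\mathbb{F}_q$ denotes the quotient map, applied entrywise to vectors and matrices. A finite ring $R$ is Frobenius if it is right and left self-injective and $R/J(R)\cong \mathrm{Soc}(R)$ as right $R$-modules. A linear code of length $n$ over $R$ is a right $R$-submodule of $R^n$. A right $R$-module is free if it is isomorphic to $R^t$ for some integer $t\ge 0$. The pair $(C,D)$ is LCP (a linear complementary pair) if $C\oplus D=R^n$, i.e. $C+D=R^n$ and $C\cap D=\{0\}$. For $x,y\in R^n$ put $[x,y]=\sum_{i=1}^n x_iy_i$, and $C^\perp=\{v\in R^n : [v,c]=0\ \forall c\in C\}$, a left $R$-submodule of $R^n$. A generator matrix of $C$ is a matrix $\mathrm{G}$ whose rows form a minimal generating set of the right $R$-module $C$. A parity check matrix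 of $C$ is a matrix $\mathrm{H}$ whose rows form a minimal generating set of the left $R$-module $C^\perp$. A square matrix $\mathrm{A}=(a_{ij})$ over $R$ is called invertible over $R$ if $\pi(\mathrm{A})=(\pi(a_{ij}))$ is invertible over $\mathbb{F}_q$. *)

theory Defs
  imports "Jordan_Normal_Form.Matrix" "HOL-Algebra.QuotRing"
begin

section \<open>One-sided modules\<close>

text \<open>The library locale for modules requires a commutative ring, but its record type and its
  notion of submodule do not. For a right module, the field \<open>smult\<close> is read with swapped
  arguments: \<open>smult M r m\<close> stands for \<open>m \<cdot> r\<close>.\<close>

locale left_module = R?: ring + M?: abelian_group M for M (structure) +
  assumes l_smult_closed:
      "\<lbrakk>a \<in> carrier R; x \<in> carrier M\<rbrakk> \<Longrightarrow> a \<odot>\<^bsub>M\<^esub> x \<in> carrier M"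
    and l_smult_l_distr:
      "\<lbrakk>a \<in> carrier R; b \<in> carrier R; x \<in> carrier M\<rbrakk> \<Longrightarrow>
        (a \<oplus>\<^bsub>R\<^esub> b) \<odot>\<^bsub>M\<^esub> x = a \<odot>\<^bsub>M\<^esub> x \<oplus>\<^bsub>M\<^esub> b \<odot>\<^bsub>M\<^esub> x"
    and l_smult_r_distr:
      "\<lbrakk>a \<in> carrier R; x \<in> carrier M; y \<in> carrier M\<rbrakk> \<Longrightarrow>
        a \<odot>\<^bsub>M\<^esub> (x \<oplus>\<^bsub>M\<^esub> y) = a \<odot>\<^bsub>M\<^esub> x \<oplus>\<^bsub>M\<^esub> a \<odot>\<^bsub>M\<^esub> y"
    and l_smult_assoc:
      "\<lbrakk>a \<in> carrier R; b \<in> carrier R; x \<in> carrier M\<rbrakk> \<Longrightarrow>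
        (a \<otimes>\<^bsub>R\<^esub> b) \<odot>\<^bsub>M\<^esub> x = a \<odot>\<^bsub>M\<^esub> (b \<odot>\<^bsub>M\<^esub> x)"
    and l_smult_one: "x \<in> carrier M \<Longrightarrow> \<one>\<^bsub>R\<^esub> \<odot>\<^bsub>M\<^esub> x = x"

locale right_module = R?: ring + M?: abelian_group M for M (structure) +
  assumes r_smult_closed:
      "\<lbrakk>a \<in> carrier R; x \<in> carrier M\<rbrakk> \<Longrightarrow> a \<odot>\<^bsub>M\<^esub> x \<in> carrier M"
    and r_smult_l_distr:
      "\<lbrakk>a \<in> carrier R; b \<in> carrier R; x \<in> carrier M\<rbrakk> \<Longrightarrow>
        (a \<oplus>\<^bsub>R\<^esub> b) \<odot>\<^bsub>M\<^esub> x = a \<odot>\<^bsub>M\<^esub> x \<oplus>\<^bsub>M\<^esub> b \<odot>\<^bsub>M\<^esub> x"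
    and r_smult_r_distr:
      "\<lbrakk>a \<in> carrier R; x \<in> carrier M; y \<in> carrier M\<rbrakk> \<Longrightarrow>
        a \<odot>\<^bsub>M\<^esub> (x \<oplus>\<^bsub>M\<^esub> y) = a \<odot>\<^bsub>M\<^esub> x \<oplus>\<^bsub>M\<^esub> a \<odot>\<^bsub>M\<^esub> y"
    and r_smult_assoc:
      "\<lbrakk>a \<in> carrier R; b \<in> carrier R; x \<in> carrier M\<rbrakk> \<Longrightarrow>
        (a \<otimes>\<^bsub>R\<^esub> b) \<odot>\<^bsub>M\<^esub> x = b \<odot>\<^bsub>M\<^esub> (a \<odot>\<^bsub>M\<^esub> x)"
    and r_smult_one: "x \<in> carrier M \<Longrightarrow> \<one>\<^bsub>R\<^esub> \<odot>\<^bsub>M\<^esub> x = x"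

definition mod_Hom ::
  "('a, 'r) ring_scheme \<Rightarrow> ('a, 'm, 'x) module_scheme \<Rightarrow> ('a, 'n, 'y) module_scheme \<Rightarrow> ('m \<Rightarrow> 'n) set"
  where "mod_Hom R M N =
    {f \<in> carrier M \<rightarrow> carrier N.
      (\<forall>x\<in>carrier M. \<forall>y\<in>carrier M. f (x \<oplus>\<^bsub>M\<^esub> y) = f x \<oplus>\<^bsub>N\<^esub> f y) \<and>
      (\<forall>r\<in>carrier R. \<forall>x\<in>carrier M. f (r \<odot>\<^bsub>M\<^esub> x) = r \<odot>\<^bsub>N\<^esub> f x)}"

definition mod_iso ::
  "('a, 'r) ring_scheme \<Rightarrow> ('a, 'm, 'x) module_scheme \<Rightarrow> ('a, 'n, 'y) module_scheme \<Rightarrow> bool"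
  where "mod_iso R M N \<longleftrightarrow> (\<exists>f\<in>mod_Hom R M N. bij_betw f (carrier M) (carrier N))"

definition mod_span ::
  "('a, 'r) ring_scheme \<Rightarrow> ('a, 'm, 'x) module_scheme \<Rightarrow> 'm set \<Rightarrow> 'm set"
  where "mod_span R M S = \<Inter>{N. submodule N R M \<and> S \<subseteq> N}"

definition minimal_generating_set ::
  "('a, 'r) ring_scheme \<Rightarrow> ('a, 'm, 'x) module_scheme \<Rightarrow> 'm set \<Rightarrow> 'm set \<Rightarrow> bool"
  where "minimal_generating_set R M C S \<longleftrightarrow>
    S \<subseteq> C \<and> mod_span R M S = C \<and> (\<forall>T. T \<subset> S \<longrightarrow> mod_span R M T \<noteq> C)"

definition maximal_submodule ::
  "'m set \<Rightarrow> ('a, 'r) ring_scheme \<Rightarrow> ('a, 'm, 'x) module_scheme \<Rightarrow> bool"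
  where "maximal_submodule N R M \<longleftrightarrow>
    submodule N R M \<and> N \<noteq> carrier M \<and>
    (\<forall>K. submodule K R M \<longrightarrow> N \<subseteq> K \<longrightarrow> K = N \<or> K = carrier M)"

definition simple_submodule ::
  "'m set \<Rightarrow> ('a, 'r) ring_scheme \<Rightarrow> ('a, 'm, 'x) module_scheme \<Rightarrow> bool"
  where "simple_submodule N R M \<longleftrightarrow>
    submodule N R M \<and> N \<noteq> {\<zero>\<^bsub>M\<^esub>} \<and>
    (\<forall>K. submodule K R M \<longrightarrow> K \<subseteq> N \<longrightarrow> K = {\<zero>\<^bsub>M\<^esub>} \<or> K = N)"

definition socle :: "('a, 'r) ring_scheme \<Rightarrow> ('a, 'm, 'x) module_scheme \<Rightarrow> 'm set"
  where "socle R M = mod_span R M (\<Union>{N. simple_submodule N R M})"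

text \<open>Injectivity of a module \<open>Q\<close> among the modules satisfying \<open>is_mod\<close> (below: all left or all
  right modules over \<open>R\<close>). A definition cannot quantify over types, so the test modules have
  their carriers in \<open>nat \<Rightarrow> 'a\<close>. If \<open>R\<close> is nontrivial, this type contains a copy of every module
  of cardinality at most the continuum. It always contains copies of \<open>R\<close> and of its one-sided
  ideals (as constant functions), so by Baer's criterion this amounts to injectivity with
  respect to all modules.\<close>

definition injective_module ::
  "('a, 'r) ring_scheme \<Rightarrow> (('a, nat \<Rightarrow> 'a) module \<Rightarrow> bool) \<Rightarrow> ('a, 'q, 'x) module_scheme \<Rightarrow> bool"
  where "injective_module R is_mod Q \<longleftrightarrow>
    (\<forall>M N. is_mod M \<longrightarrow> is_mod N \<longrightarrow>
      (\<forall>f\<in>mod_Hom R M N. \<forall>g\<in>mod_Hom R M Q. inj_on f (carrier M) \<longrightarrow>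
        (\<exists>h\<in>mod_Hom R N Q. \<forall>x\<in>carrier M. h (f x) = g x)))"


section \<open>Finite Frobenius local rings\<close>

definition left_regular :: "('a, 'r) ring_scheme \<Rightarrow> ('a, 'a) module"
  where "left_regular R = \<lparr>carrier = carrier R, mult = mult R, one = \<one>\<^bsub>R\<^esub>, zero = \<zero>\<^bsub>R\<^esub>,
    add = add R, smult = (\<lambda>r x. r \<otimes>\<^bsub>R\<^esub> x)\<rparr>"

definition right_regular :: "('a, 'r) ring_scheme \<Rightarrow> ('a, 'a) module"
  where "right_regular R = \<lparr>carrier = carrier R, mult = mult R, one = \<one>\<^bsub>R\<^esub>, zero = \<zero>\<^bsub>R\<^esub>,
    add = add R, smult = (\<lambda>r x. x \<otimes>\<^bsub>R\<^esub> r)\<rparr>"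

definition jacobson_radical :: "('a, 'r) ring_scheme \<Rightarrow> 'a set"
  where "jacobson_radical R =
    carrier R \<inter> \<Inter>{I. maximal_submodule I R (right_regular R)}"

definition residue_ring_mod_J :: "('a, 'r) ring_scheme \<Rightarrow> 'a set ring"
  where "residue_ring_mod_J R = R Quot jacobson_radical R"

definition residue_map :: "('a, 'r) ring_scheme \<Rightarrow> 'a \<Rightarrow> 'a set"
  where "residue_map R a = jacobson_radical R +>\<^bsub>R\<^esub> a"

definition residue_right_module :: "('a, 'r) ring_scheme \<Rightarrow> ('a, 'a set) module"
  where "residue_right_module R =
    (let F = residue_ring_mod_J R in
      \<lparr>carrier = carrier F, mult = mult F, one = \<one>\<^bsub>F\<^esub>, zero = \<zero>\<^bsub>F\<^esub>, add = add F,
        smult = (\<lambda>r X. X \<otimes>\<^bsub>F\<^esub> residue_map R r)\<rparr>)"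

definition local_ring :: "('a, 'r) ring_scheme \<Rightarrow> bool"
  where "local_ring R \<longleftrightarrow> ring R \<and> additive_subgroup (carrier R - Units R) R"

definition finite_frobenius_ring :: "('a, 'r) ring_scheme \<Rightarrow> bool"
  where "finite_frobenius_ring R \<longleftrightarrow>
    ring R \<and> finite (carrier R) \<and>
    injective_module R (right_module R) (right_regular R) \<and>
    injective_module R (left_module R) (left_regular R) \<and>
    mod_iso R (residue_right_module R)
      ((right_regular R)\<lparr>carrier := socle R (right_regular R)\<rparr>)"


section \<open>Linear codes\<close>

definition left_space :: "('a, 'r) ring_scheme \<Rightarrow> nat \<Rightarrow> ('a, 'a vec) module"
  where "left_space R n =
    \<lparr>carrier = {v \<in> carrier_vec n. \<forall>i<n. v $ i \<in> carrier R},
      mult = undefined, one = undefined,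
      zero = vec n (\<lambda>_. \<zero>\<^bsub>R\<^esub>),
      add = (\<lambda>v w. vec n (\<lambda>i. v $ i \<oplus>\<^bsub>R\<^esub> w $ i)),
      smult = (\<lambda>r v. vec n (\<lambda>i. r \<otimes>\<^bsub>R\<^esub> v $ i))\<rparr>"

definition right_space :: "('a, 'r) ring_scheme \<Rightarrow> nat \<Rightarrow> ('a, 'a vec) module"
  where "right_space R n =
    \<lparr>carrier = {v \<in> carrier_vec n. \<forall>i<n. v $ i \<in> carrier R},
      mult = undefined, one = undefined,
      zero = vec n (\<lambda>_. \<zero>\<^bsub>R\<^esub>),
      add = (\<lambda>v w. vec n (\<lambda>i. v $ i \<oplus>\<^bsub>R\<^esub> w $ i)),
      smult = (\<lambda>r v. vec n (\<lambda>i. v $ i \<otimes>\<^bsub>R\<^esub> r))\<rparr>"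

definition linear_code :: "('a, 'r) ring_scheme \<Rightarrow> nat \<Rightarrow> 'a vec set \<Rightarrow> bool"
  where "linear_code R n C \<longleftrightarrow> submodule C R (right_space R n)"

definition free_right_module :: "('a, 'r) ring_scheme \<Rightarrow> ('a, 'm, 'x) module_scheme \<Rightarrow> bool"
  where "free_right_module R M \<longleftrightarrow> (\<exists>t. mod_iso R M (right_space R t))"

definition free_code :: "('a, 'r) ring_scheme \<Rightarrow> nat \<Rightarrow> 'a vec set \<Rightarrow> bool"
  where "free_code R n C \<longleftrightarrow>
    linear_code R n C \<and> free_right_module R ((right_space R n)\<lparr>carrier := C\<rparr>)"

definition LCP :: "('a, 'r) ring_scheme \<Rightarrow> nat \<Rightarrow> 'a vec set \<Rightarrow> 'a vec set \<Rightarrow> bool"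
  where "LCP R n C D \<longleftrightarrow>
    C <+>\<^bsub>right_space R n\<^esub> D = carrier (right_space R n) \<and>
    C \<inter> D = {\<zero>\<^bsub>right_space R n\<^esub>}"

definition vec_pairing :: "('a, 'r) ring_scheme \<Rightarrow> nat \<Rightarrow> 'a vec \<Rightarrow> 'a vec \<Rightarrow> 'a"
  where "vec_pairing R n x y = (\<Oplus>\<^bsub>R\<^esub>i\<in>{..<n}. x $ i \<otimes>\<^bsub>R\<^esub> y $ i)"

definition dual_code :: "('a, 'r) ring_scheme \<Rightarrow> nat \<Rightarrow> 'a vec set \<Rightarrow> 'a vec set"
  where "dual_code R n C =
    {v \<in> carrier (left_space R n). \<forall>c\<in>C. vec_pairing R n v c = \<zero>\<^bsub>R\<^esub>}"

text \<open>The rows are required to be distinct, since they list the elements of a minimal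
  generating set; otherwise the number of rows would not be determined.\<close>

definition generator_matrix :: "('a, 'r) ring_scheme \<Rightarrow> nat \<Rightarrow> 'a vec set \<Rightarrow> 'a mat \<Rightarrow> bool"
  where "generator_matrix R n C G \<longleftrightarrow>
    dim_col G = n \<and> distinct (rows G) \<and>
    minimal_generating_set R (right_space R n) C (set (rows G))"

definition parity_check_matrix :: "('a, 'r) ring_scheme \<Rightarrow> nat \<Rightarrow> 'a vec set \<Rightarrow> 'a mat \<Rightarrow> bool"
  where "parity_check_matrix R n C H \<longleftrightarrow>
    dim_col H = n \<and> distinct (rows H) \<and>
    minimal_generating_set R (left_space R n) (dual_code R n C) (set (rows H))"

definition stack_rows :: "'a mat \<Rightarrow> 'a mat \<Rightarrow> 'a mat"
  where "stack_rows A B = mat_of_rows (dim_col A) (rows A @ rows B)"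

text \<open>The matrix operations of the library are tied to type classes, so the product and the
  identity matrix are written out for a ring given by a record.\<close>

definition ring_mat_mult :: "('a, 'r) ring_scheme \<Rightarrow> 'a mat \<Rightarrow> 'a mat \<Rightarrow> 'a mat"
  where "ring_mat_mult S A B = mat (dim_row A) (dim_col B)
    (\<lambda>(i, j). \<Oplus>\<^bsub>S\<^esub>k\<in>{..<dim_col A}. A $$ (i, k) \<otimes>\<^bsub>S\<^esub> B $$ (k, j))"

definition ring_one_mat :: "('a, 'r) ring_scheme \<Rightarrow> nat \<Rightarrow> 'a mat"
  where "ring_one_mat S m = mat m m (\<lambda>(i, j). if i = j then \<one>\<^bsub>S\<^esub> else \<zero>\<^bsub>S\<^esub>)"

definition ring_invertible_mat :: "('a, 'r) ring_scheme \<Rightarrow> 'a mat \<Rightarrow> bool"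
  where "ring_invertible_mat S A \<longleftrightarrow>
    square_mat A \<and> elements_mat A \<subseteq> carrier S \<and>
    (\<exists>B \<in> carrier_mat (dim_row A) (dim_row A). elements_mat B \<subseteq> carrier S \<and>
      ring_mat_mult S A B = ring_one_mat S (dim_row A) \<and>
      ring_mat_mult S B A = ring_one_mat S (dim_row A))"

definition invertible_over :: "('a, 'r) ring_scheme \<Rightarrow> 'a mat \<Rightarrow> bool"
  where "invertible_over R A \<longleftrightarrow>
    square_mat A \<and> elements_mat A \<subseteq> carrier R \<and>
    ring_invertible_mat (residue_ring_mod_J R) (map_mat (residue_map R) A)"

end

theory Submission
  imports Defs "HOL-Algebra.Group_Action" "HOL-Algebra.Multiplicative_Group" "HOL-Algebra.Subrings"
    "HOL-Computational_Algebra.Fundamental_Theorem_Algebra"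
    "HOL-Computational_Algebra.Polynomial_Factorial"
begin

text \<open>Let \<open>J\<close> be the set of nonunits, \<open>F = R / J\<close>, and let \<open>C\<close> and \<open>D\<close> have ranks \<open>t\<close> and \<open>n - t\<close>.
  A minimal generating set of a free code is a basis, so the stacked matrices are square. By
  cardinality, \<open>(C, D)\<close> is LCP if and only if the \<open>n\<close> stacked rows of \<open>G\<^sub>1\<close> and \<open>G\<^sub>2\<close> span \<open>R\<^sup>n\<close> with
  scalars on the right, and by Nakayama's lemma this can be tested over \<open>F\<close>. Invertibility over \<open>F\<close>
  is the corresponding property for scalars on the left; the two agree because \<open>F\<close> is commutative
  by Wedderburn's little theorem, which is therefore indispensable for the generator matrices.

  For the parity check matrices, a basis of \<open>C\<close> stays independent over \<open>F\<close>, because an element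
  annihilated by \<open>J\<close> from the left detects coefficients outside \<open>J\<close>. Hence it extends to a basis of
  \<open>R\<^sup>n\<close>, and \<open>C\<^sup>\<bottom>\<close> is free of rank \<open>n - t\<close> as a left module. Then \<open>C + D = R\<^sup>n\<close> forces
  \<open>C\<^sup>\<bottom> \<inter> D\<^sup>\<bottom> = 0\<close>, so \<open>C\<^sup>\<bottom> + D\<^sup>\<bottom> = R\<^sup>n\<close> by cardinality, and this in turn forces \<open>C \<inter> D = 0\<close>.
  Left modules are treated as right modules over the opposite ring.

  Wedderburn's theorem is proved after Witt: a suitable divisor of \<open>q\<^sup>n - 1\<close> divides the size of every
  conjugacy class of noncentral elements but not \<open>q - 1\<close>.\<close>

section \<open>A cyclotomic divisor\<close>

text \<open>The obstacle is a mismatch of sides. A row vector times a matrix puts the scalars on the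
  left, while a code takes them on the right. A dual code is a left module, so for \<open>H1\<close>
  and \<open>H2\<close> the sides agree; for \<open>G1\<close> and \<open>G2\<close> the factors
  have to be swapped, which is legitimate in the residue ring but not in a noncommutative
  \<open>R\<close>. Hence the descent to the residue ring comes before the swap. Counting takes the
  place of dimension theory: between finite sets of equal size surjective and injective coincide,
  and comparing powers of the order of a ring compares ranks. This is also how the two halves of
  LCP, and the sum and intersection conditions on the dual codes, are exchanged. Witt's argument
  needs a polynomial with leading coefficient 1 or -1 whose roots are \<open>n\<close>-th roots of
  unity other than 1, and which divides \<open>(x^n - 1) / (x^d - 1)\<close> for each proper divisor
  \<open>d\<close> of \<open>n\<close>. Any prime factor of \<open>x^n - 1\<close> in the integral
  polynomials that vanishes at a primitive root has these properties, so the cyclotomic polynomial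
  itself is never constructed.\<close>

lemma norm_poly_gt_of_roots_in_disc:
  fixes P :: "complex poly" and x :: real
  assumes x: "x \<ge> 2" and deg: "degree P > 0" and lc: "norm (lead_coeff P) \<ge> 1"
    and roots: "\<And>z. poly P z = 0 \<Longrightarrow> norm z \<le> 1 \<and> z \<noteq> 1"
  shows "norm (poly P (of_real x)) > x - 1"
proof -
  obtain r where r: "smult (lead_coeff P) (\<Prod>i<degree P. [:- r i, 1:]) = P"
    using complex_poly_decompose' by blast
  have val: "poly P z = lead_coeff P * (\<Prod>i<degree P. z - r i)" for z
    by (subst r [symmetric]) (simp add: poly_prod)
  have root: "norm (r i) \<le> 1" "r i \<noteq> 1" if "i < degree P" for i
  proof -
    have "poly P (r i) = 0"
      using that unfolding val by force
    then show "norm (r i) \<le> 1" "r i \<noteq> 1"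
      using roots by auto
  qed
  \<comment> \<open>A point of the closed unit disc with real part 1 is 1 itself, so every root has
    real part below 1, and the distance to \<open>x\<close> is at least the difference of the real
    parts.\<close>
  have gt: "norm (of_real x - r i) > x - 1" if i: "i < degree P" for i
  proof -
    have "Re (r i) < 1"
    proof (rule ccontr)
      assume "\<not> Re (r i) < 1"
      then have "Re (r i) = 1"
        using root(1)[OF i] complex_Re_le_cmod[of "r i"] by linarith
      moreover from this have "Im (r i) = 0"
        using root(1)[OF i] unfolding cmod_def by (auto simp: add_nonneg_eq_0_iff)
      ultimately show False
        using root(2)[OF i] by (simp add: complex_eq_iff)
    qed
    then show ?thesis
      using complex_Re_le_cmod[of "of_real x - r i"] by simp
  qed
  \<comment> \<open>One factor is set aside to carry the strict bound; the others are at least 1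
    because \<open>x - 1\<close> is.\<close>
  obtain d where d: "degree P = Suc d"
    using deg gr0_implies_Suc by blast
  have "1 \<le> (\<Prod>i<d. norm (of_real x - r i))"
  proof (intro prod_ge_1)
    fix i assume "i \<in> {..<d}"
    then show "1 \<le> norm (of_real x - r i)"
      using gt[of i] x d by simp
  qed
  moreover have "norm (of_real x - r d) > x - 1"
    using gt[of d] d by simp
  ultimately have "1 * (x - 1) < (\<Prod>i<d. norm (of_real x - r i)) * norm (of_real x - r d)"
    using x by (intro mult_le_less_imp_less) auto
  also have "\<dots> \<le> norm (lead_coeff P) * ((\<Prod>i<d. norm (of_real x - r i)) * norm (of_real x - r d))"
    using mult_right_mono[OF lc, of "(\<Prod>i<d. norm (of_real x - r i)) * norm (of_real x - r d)"]
    by (simp add: prod_nonneg)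
  also have "\<dots> = norm (poly P (of_real x))"
    unfolding val by (simp add: d norm_mult flip: prod_norm)
  finally show ?thesis
    by simp
qed

lemma map_poly_of_int_mult:
  "(map_poly of_int (p * q) :: complex poly) = map_poly of_int p * map_poly of_int q"
  by (intro poly_eqI) (simp add: coeff_map_poly coeff_mult)

lemma primitive_root_unity_exists:
  assumes "n > 0"
  obtains z :: complex where "z ^ n = 1" "\<And>d. 0 < d \<Longrightarrow> d < n \<Longrightarrow> z ^ d \<noteq> 1"
proof
  let ?z = "cis (2 * pi / n)"
  show "?z ^ n = 1"
    using assms by (simp add: Complex.DeMoivre)
  fix d assume d: "0 < d" "d < n"
  have "inj_on (\<lambda>k. cis (2 * pi * real k / real n)) {..<n}"
    using Complex.bij_betw_roots_unity[OF assms] by (rule bij_betw_imp_inj_on)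
  then have "cis (2 * pi * real d / real n) \<noteq> cis (2 * pi * real 0 / real n)"
    using d by (metis assms inj_on_eq_iff lessThan_iff less_numeral_extra(3))
  then show "?z ^ d \<noteq> 1"
    by (simp add: Complex.DeMoivre mult_ac)
qed

text \<open>The divisor is the value at \<open>q\<close> of the prime factor of \<open>x\<^sup>n - 1\<close> in the integral polynomials
  that vanishes at a primitive \<open>n\<close>-th root of unity.\<close>

lemma cyclotomic_divisor_exists:
  fixes q n :: nat
  assumes q: "q \<ge> 2" and n: "n > 1"
  obtains N :: int where "\<not> N dvd int q - 1"
    and "\<And>d m. 0 < d \<Longrightarrow> d < n \<Longrightarrow> d dvd n \<Longrightarrow> m * (int q ^ d - 1) = int q ^ n - 1 \<Longrightarrow> N dvd m"
proof -
  obtain z :: complex where z: "z ^ n = 1" "\<And>d. 0 < d \<Longrightarrow> d < n \<Longrightarrow> z ^ d \<noteq> 1"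
    by (rule primitive_root_unity_exists[of n]) (use n in auto)
  define X where "X d = (monom 1 d - 1 :: int poly)" for d
  have X_of_int: "map_poly of_int (X d) = (monom 1 d - 1 :: complex poly)" for d
    by (intro poly_eqI) (simp add: X_def coeff_map_poly)
  have X_poly: "poly (X d) (int q) = int q ^ d - 1" for d
    by (simp add: X_def poly_monom)
  have X_nz: "X d \<noteq> 0" if "d > 0" for d
  proof
    assume "X d = 0"
    then have "poly (X d) 0 = 0"
      by simp
    with that show False
      by (simp add: X_def poly_monom power_0_left)
  qed
  \<comment> \<open>Induction along the prime factorization of \<open>A\<close>: evaluation at
    \<open>z\<close> is multiplicative, so some factor vanishes there, and a unit cannot, since its
    value is invertible.\<close>
  have "\<exists>p. prime_elem p \<and> p dvd A \<and> poly (map_poly of_int p :: complex poly) z = 0"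
    if "A \<noteq> 0" "poly (map_poly of_int A :: complex poly) z = 0" for A :: "int poly"
    using that
  proof (induction A rule: prime_divisors_induct)
    case (unit x)
    then obtain y where "x * y = 1"
      by (metis dvdE)
    then have "map_poly of_int x * map_poly of_int y = (1 :: complex poly)"
      using map_poly_of_int_mult[of x y] by simp
    then have "poly (map_poly of_int x) z * poly (map_poly of_int y) z = (1 :: complex)"
      by (simp flip: poly_mult)
    with unit show ?case
      by simp
  next
    case (factor p x)
    show ?case
    proof (cases "poly (map_poly of_int p :: complex poly) z = 0")
      case True
      then show ?thesis
        using factor.hyps by auto
    next
      case False
      then show ?thesis
        using factor by (fastforce simp: map_poly_of_int_mult)
    qed
  qed simp
  from this[of "X n"] obtain p where p: "prime_elem p" "p dvd X n"
    and pz: "poly (map_poly of_int p :: complex poly) z = 0"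
    using X_nz[of n] n z by (auto simp: X_of_int poly_monom)
  let ?P = "map_poly of_int p :: complex poly"
  have lcdeg: "lead_coeff ?P = of_int (lead_coeff p)" "degree ?P = degree p"
    by (simp_all add: degree_map_poly coeff_map_poly)
  have root_dvd: "poly (map_poly of_int A :: complex poly) w = 0"
    if "poly ?P w = 0" "p dvd A" for w A
    using that by (auto simp: dvd_def map_poly_of_int_mult)
  \<comment> \<open>\<open>p\<close> vanishes at \<open>z\<close> but \<open>X d\<close> does not,
    because \<open>z\<close> is primitive; hence the prime \<open>p\<close> must divide the
    cofactor.\<close>
  have p_dvd: "p dvd B" if "0 < d" "d < n" "X n = X d * B" for d B
  proof -
    have "\<not> p dvd X d"
      using root_dvd[OF pz, of "X d"] z(2)[OF that(1,2)] by (auto simp: X_of_int poly_monom)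
    then show ?thesis
      using p that(3) by (metis prime_elem_dvd_multD)
  qed
  have quot: "X n = X d * (\<Sum>i<k. monom 1 (d * i))" if "n = d * k" for d k
    using power_diff_1_eq[of "monom 1 d :: int poly" k]
    by (simp add: X_def that monom_power)
  have deg: "degree p > 0"
  proof (rule ccontr)
    assume "\<not> degree p > 0"
    then obtain c where c: "p = [:c:]"
      by (metis degree_eq_zeroE gr0I)
    then have "c = 0"
      using pz by (simp add: map_poly_pCons)
    with c p show False
      by simp
  qed
  \<comment> \<open>Leading coefficients multiply, and that of \<open>x^n - 1\<close> is 1.\<close>
  have "lead_coeff p dvd 1"
  proof -
    have "lead_coeff p dvd lead_coeff (X n)"
      using p(2) by (auto simp: dvd_def lead_coeff_mult)
    moreover have "degree (X n) = n"
      unfolding X_def diff_conv_add_uminus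
      using n by (subst degree_add_eq_left) (simp_all add: degree_monom_eq)
    ultimately show ?thesis
      using n by (simp add: X_def)
  qed
  then have "\<bar>lead_coeff p\<bar> = 1"
    by simp
  then have lc: "norm (lead_coeff ?P) \<ge> 1"
    unfolding lcdeg(1) norm_of_int by linarith
  \<comment> \<open>The case \<open>d = 1\<close>. The sum takes the value \<open>n\<close> at 1,
    which keeps 1 from being a root of \<open>p\<close>.\<close>
  have p1: "p dvd (\<Sum>i<n. monom 1 i)"
    using p_dvd[of 1] quot[of 1 n] n by simp
  \<comment> \<open>This bound prevents \<open>poly p (int q)\<close>, the number \<open>N\<close>
    sought, from dividing the positive number \<open>q - 1\<close>.\<close>
  have "norm (poly ?P (of_real (real q))) > real q - 1"
  proof (rule norm_poly_gt_of_roots_in_disc)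
    fix w assume w: "poly ?P w = 0"
    have "w ^ n = 1"
      using root_dvd[OF w p(2)] by (simp add: X_of_int poly_monom)
    then have "norm w = 1"
      using n by (metis norm_power norm_one power_eq_1_iff norm_ge_zero bot_nat_0.not_eq_extremum not_less_zero)
    moreover have "w \<noteq> 1"
    proof
      assume "w = 1"
      have "map_poly of_int (\<Sum>i<n. monom 1 i) = (\<Sum>i<n. monom 1 i :: complex poly)"
        by (intro poly_eqI) (simp add: coeff_map_poly coeff_sum)
      then have "(\<Sum>i<n. poly (monom 1 i) w) = 0"
        using root_dvd[OF w p1] by (simp add: poly_sum)
      then show False
        using n by (simp add: \<open>w = 1\<close> poly_monom)
    qed
    ultimately show "norm w \<le> 1 \<and> w \<noteq> 1"
      by simp
  qed (use q deg lc lcdeg in simp_all)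
  moreover have "poly ?P (of_real (real q)) = of_int (poly p (int q))"
    by (simp add: poly_altdef lcdeg coeff_map_poly)
  ultimately have gt: "\<bar>poly p (int q)\<bar> > int q - 1"
    by (smt (verit) norm_of_int of_int_abs of_int_less_iff of_int_diff of_int_of_nat_eq of_int_1)
  show thesis
  proof
    show "\<not> poly p (int q) dvd int q - 1"
    proof
      assume "poly p (int q) dvd int q - 1"
      then have "\<bar>poly p (int q)\<bar> \<le> int q - 1"
        using q by (intro zdvd_imp_le) auto
      with gt show False
        by simp
    qed
    fix d m assume d: "0 < d" "d < n" "d dvd n" and m: "m * (int q ^ d - 1) = int q ^ n - 1"
    from d(3) obtain k where k: "n = d * k"
      by auto
    \<comment> \<open>The quotient of \<open>x^n - 1\<close> by \<open>x^d - 1\<close>. As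
      \<open>q^d - 1\<close> is nonzero, \<open>m\<close> has to be its value at
      \<open>q\<close>.\<close>
    let ?B = "\<Sum>i<k. monom 1 (d * i) :: int poly"
    have "int q ^ n - 1 = (int q ^ d - 1) * poly ?B (int q)"
      using arg_cong[OF quot[OF k], of "\<lambda>A. poly A (int q)"] by (simp only: poly_mult X_poly)
    moreover have "int q ^ d - 1 \<noteq> 0"
    proof -
      have "1 < int q ^ d"
        using q d(1) by (intro one_less_power) auto
      then show ?thesis
        by simp
    qed
    ultimately have "m = poly ?B (int q)"
      using m by (metis mult.commute mult_cancel_left)
    moreover have "p dvd ?B"
      using p_dvd d quot[OF k] by blast
    ultimately show "poly p (int q) dvd m"
      by (metis dvd_def poly_mult)
  qed
qed

section \<open>Wedderburn's little theorem\<close>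

locale finite_ring = ring +
  assumes finite_carrier: "finite (carrier R)"

locale finite_division_ring = finite_ring +
  assumes Units_eq: "Units R = carrier R - {\<zero>}"
begin

lemma one_neq_zero: "\<one> \<noteq> \<zero>"
  using Units_one_closed Units_eq by auto

text \<open>Scalars act from the left. \<open>K\<close> is an arbitrary set here; that it is a
  division subring is assumed where it is used.\<close>

definition subspace :: "'a set \<Rightarrow> 'a set \<Rightarrow> bool"
  where "subspace K W \<longleftrightarrow> W \<subseteq> carrier R \<and> \<zero> \<in> W \<and> (\<forall>x\<in>W. \<forall>y\<in>W. x \<oplus> y \<in> W) \<and>
    (\<forall>k\<in>K. \<forall>x\<in>W. k \<otimes> x \<in> W)"

text \<open>A largest subspace \<open>W\<close> of \<open>V\<close> whose order is a power of
  \<open>card K\<close> is all of \<open>V\<close>: a vector \<open>v\<close> outside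
  \<open>W\<close> would give the subspace \<open>W + Kv\<close>, which has \<open>card K\<close>
  times as many elements.\<close>

lemma card_subspace:
  assumes K: "subring K R" "\<And>k. k \<in> K \<Longrightarrow> k \<noteq> \<zero> \<Longrightarrow> inv k \<in> K"
    and V: "subspace K V"
  obtains k where "card V = card K ^ k"
proof -
  interpret K: subring K R by (rule K)
  define S where "S = {W. W \<subseteq> V \<and> subspace K W \<and> (\<exists>k. card W = card K ^ k)}"
  have Kc: "K \<subseteq> carrier R" by (rule K.subset)
  have "finite V"
    using V finite_carrier by (auto simp: subspace_def intro: finite_subset)
  then have "finite S"
    by (simp add: S_def)
  have "{\<zero>} \<in> S"
    using V Kc by (auto simp: S_def subspace_def intro: exI[of _ 0])
  then have "Max (card ` S) \<in> card ` S"
    using \<open>finite S\<close> by (intro Max_in) auto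
  then obtain W where W: "W \<in> S" and "card W = Max (card ` S)"
    by auto
  then have W_max: "card U \<le> card W" if "U \<in> S" for U
    using that \<open>finite S\<close> by simp
  have Wc: "W \<subseteq> carrier R" and W0: "\<zero> \<in> W"
    and Wadd: "\<And>x y. x \<in> W \<Longrightarrow> y \<in> W \<Longrightarrow> x \<oplus> y \<in> W"
    and Wmult: "\<And>k x. k \<in> K \<Longrightarrow> x \<in> W \<Longrightarrow> k \<otimes> x \<in> W"
    using W by (auto simp: S_def subspace_def)
  have Wminus: "\<ominus> x \<in> W" if "x \<in> W" for x
    using Wmult[of "\<ominus> \<one>" x] subringE(3,5)[OF K(1)] that Wc by (auto simp: l_minus)
  have "W = V"
  proof (rule ccontr)
    assume "W \<noteq> V"
    then obtain v where v: "v \<in> V" "v \<notin> W"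
      using W by (auto simp: S_def)
    have vc: "v \<in> carrier R"
      using v V by (auto simp: subspace_def)
    define f where "f = (\<lambda>(w, k). w \<oplus> k \<otimes> v)"
    \<comment> \<open>A coincidence puts \<open>(k - k') v\<close> into \<open>W\<close>; were
      \<open>k - k'\<close> nonzero, multiplying by its inverse, which lies in \<open>K\<close>,
      would put \<open>v\<close> into \<open>W\<close>.\<close>
    have inj: "inj_on f (W \<times> K)"
    proof (rule inj_onI, clarify)
      fix w k w' k' assume *: "w \<in> W" "k \<in> K" "w' \<in> W" "k' \<in> K" and eq: "f (w, k) = f (w', k')"
      have c: "w \<in> carrier R" "w' \<in> carrier R" "k \<in> carrier R" "k' \<in> carrier R"
        using * Wc Kc by auto
      have "(k \<ominus> k') \<otimes> v = (w \<oplus> k \<otimes> v) \<ominus> w \<ominus> k' \<otimes> v"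
        using c vc by algebra
      also have "\<dots> = (w' \<oplus> k' \<otimes> v) \<ominus> w \<ominus> k' \<otimes> v"
        using eq by (simp add: f_def)
      also have "\<dots> = w' \<oplus> \<ominus> w"
        using c vc by algebra
      finally have "(k \<ominus> k') \<otimes> v = w' \<oplus> \<ominus> w" .
      then have mem: "(k \<ominus> k') \<otimes> v \<in> W"
        using * by (simp add: Wadd Wminus)
      have "k \<ominus> k' = \<zero>"
      proof (rule ccontr)
        assume nz: "k \<ominus> k' \<noteq> \<zero>"
        have "k \<ominus> k' \<in> K"
          using * subringE(5,7)[OF K(1)] by (simp add: a_minus_def)
        then have "inv (k \<ominus> k') \<otimes> ((k \<ominus> k') \<otimes> v) \<in> W"
          using mem nz K(2) Wmult by blast
        moreover have "k \<ominus> k' \<in> Units R"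
          using nz c Units_eq by auto
        ultimately show False
          using v(2) vc c by (simp add: m_assoc[symmetric] Units_closed del: minus_closed)
      qed
      then have "k = k'"
        using c by (simp add: r_right_minus_eq)
      moreover from this have "w = w'"
        using eq c vc unfolding f_def split by simp
      ultimately show "w = w' \<and> k = k'"
        by simp
    qed
    have "f ` (W \<times> K) \<in> S"
      unfolding S_def
    proof (intro CollectI conjI)
      show "f ` (W \<times> K) \<subseteq> V"
      proof clarify
        fix w k assume "w \<in> W" "k \<in> K"
        moreover have "W \<subseteq> V"
          using W by (simp add: S_def)
        ultimately show "f (w, k) \<in> V"
          using V v(1) unfolding f_def subspace_def split by blast
      qed
      show "subspace K (f ` (W \<times> K))"
        unfolding subspace_def
      proof (intro conjI ballI)
        show "f ` (W \<times> K) \<subseteq> carrier R"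
          using Wc Kc vc by (auto simp: f_def)
        have "\<zero> = f (\<zero>, \<zero>)"
          using vc by (simp add: f_def)
        then show "\<zero> \<in> f ` (W \<times> K)"
          using W0 subringE(2)[OF K(1)] by blast
      next
        fix x y assume "x \<in> f ` (W \<times> K)" "y \<in> f ` (W \<times> K)"
        then obtain w k w' k' where *: "w \<in> W" "k \<in> K" "w' \<in> W" "k' \<in> K"
          and xy: "x = f (w, k)" "y = f (w', k')"
          by auto
        have c: "w \<in> carrier R" "w' \<in> carrier R" "k \<in> carrier R" "k' \<in> carrier R"
          using * Wc Kc by auto
        have "x \<oplus> y = f (w \<oplus> w', k \<oplus> k')"
          unfolding xy f_def split using c vc by algebra
        then show "x \<oplus> y \<in> f ` (W \<times> K)"
          using * Wadd subringE(7)[OF K(1)] by blast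
      next
        fix l x assume l: "l \<in> K" and "x \<in> f ` (W \<times> K)"
        then obtain w k where *: "w \<in> W" "k \<in> K" and x: "x = f (w, k)"
          by auto
        have c: "w \<in> carrier R" "k \<in> carrier R" "l \<in> carrier R"
          using * Wc Kc l by auto
        have "l \<otimes> x = f (l \<otimes> w, l \<otimes> k)"
          unfolding x f_def split using c vc by algebra
        then show "l \<otimes> x \<in> f ` (W \<times> K)"
          using * l Wmult subringE(6)[OF K(1)] by blast
      qed
      obtain k where "card W = card K ^ k"
        using W by (auto simp: S_def)
      then have "card (f ` (W \<times> K)) = card K ^ Suc k"
        using inj by (simp add: card_image card_cartesian_product)
      then show "\<exists>k. card (f ` (W \<times> K)) = card K ^ k"
        by blast
    qed
    \<comment> \<open>Contradicts maximality, because \<open>K\<close> contains both 0 and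
      1.\<close>
    then have "card W * card K \<le> card W"
      using W_max inj by (metis card_image card_cartesian_product)
    moreover have "card W > 0"
      using W0 finite_subset[OF Wc finite_carrier] by (auto simp: card_gt_0_iff)
    moreover have "card {\<zero>, \<one>} \<le> card K"
      using finite_subset[OF Kc finite_carrier] subringE(2,3)[OF K(1)] by (intro card_mono) auto
    ultimately show False
      using one_neq_zero by simp
  qed
  with W that show thesis
    by (auto simp: S_def)
qed

definition centralizer :: "'a set \<Rightarrow> 'a set"
  where "centralizer A = {x \<in> carrier R. \<forall>a\<in>A. x \<otimes> a = a \<otimes> x}"

lemma subring_centralizer:
  assumes "A \<subseteq> carrier R"
  shows "subring (centralizer A) R"
proof (rule subringI)
  fix x y assume x: "x \<in> centralizer A" and y: "y \<in> centralizer A"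
  show "x \<otimes> y \<in> centralizer A"
    unfolding centralizer_def
  proof (intro CollectI conjI ballI)
    fix a assume a: "a \<in> A"
    have c: "x \<in> carrier R" "y \<in> carrier R" "a \<in> carrier R"
      using x y a assms by (auto simp: centralizer_def)
    have "x \<otimes> y \<otimes> a = x \<otimes> (a \<otimes> y)"
      using c y a by (simp add: m_assoc centralizer_def)
    also have "\<dots> = a \<otimes> (x \<otimes> y)"
      using c x a by (simp add: m_assoc[symmetric] centralizer_def)
    finally show "x \<otimes> y \<otimes> a = a \<otimes> (x \<otimes> y)" .
  qed (use x y in \<open>auto simp: centralizer_def\<close>)
qed (use assms in \<open>auto simp: centralizer_def l_minus r_minus l_distr r_distr subset_iff\<close>)

lemma inv_mem_centralizer:
  assumes "A \<subseteq> carrier R" and "x \<in> centralizer A" and "x \<noteq> \<zero>"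
  shows "inv x \<in> centralizer A"
  unfolding centralizer_def
proof (intro CollectI conjI ballI)
  have x: "x \<in> Units R"
    using assms Units_eq by (auto simp: centralizer_def)
  then show "inv x \<in> carrier R"
    by simp
  fix a assume a: "a \<in> A"
  have c: "x \<in> carrier R" "inv x \<in> carrier R" "a \<in> carrier R"
    using x a assms by auto
  have "inv x \<otimes> a = inv x \<otimes> (a \<otimes> x) \<otimes> inv x"
    using x c by (simp add: m_assoc)
  also have "\<dots> = inv x \<otimes> (x \<otimes> a) \<otimes> inv x"
    using a assms by (simp add: centralizer_def)
  also have "\<dots> = a \<otimes> inv x"
    using x c by (simp add: m_assoc[symmetric])
  finally show "inv x \<otimes> a = a \<otimes> inv x" .
qed

text \<open>A centralizer is a division subring, so every subring containing it is a left vector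
  space over it. The three uses compare the center with \<open>R\<close>, the center with the
  centralizer of one element, and that centralizer with \<open>R\<close>.\<close>

lemma card_power_centralizer:
  assumes A: "A \<subseteq> carrier R" and V: "subring V R" "centralizer A \<subseteq> V"
  obtains k where "card V = card (centralizer A) ^ k"
proof (rule card_subspace[OF subring_centralizer[OF A] inv_mem_centralizer[OF A], of V])
  interpret V: subring V R by (rule V)
  show "subspace (centralizer A) V"
    using V(2) V.subset subringE[OF V(1)] by (auto simp: subspace_def)
qed

text \<open>If the conjugate \<open>g x g^-1\<close> were central, it would commute with
  \<open>g\<close>, and cancelling \<open>g\<close> would make it equal to \<open>x\<close>.\<close>

lemma conj_mem_noncentral:
  assumes g: "g \<in> Units R" and x: "x \<in> carrier R - centralizer (carrier R)"
  shows "g \<otimes> x \<otimes> inv g \<in> carrier R - centralizer (carrier R)"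
proof (intro DiffI notI)
  have c: "g \<in> carrier R" "inv g \<in> carrier R" "x \<in> carrier R"
    using g x by auto
  then show "g \<otimes> x \<otimes> inv g \<in> carrier R"
    by simp
  assume "g \<otimes> x \<otimes> inv g \<in> centralizer (carrier R)"
  then have "g \<otimes> x \<otimes> inv g \<otimes> g = g \<otimes> (g \<otimes> x \<otimes> inv g)"
    using c by (simp add: centralizer_def)
  then have "g \<otimes> x = g \<otimes> (g \<otimes> x \<otimes> inv g)"
    using g c by (simp add: m_assoc)
  then have "x = g \<otimes> x \<otimes> inv g"
    using g c by simp
  with \<open>g \<otimes> x \<otimes> inv g \<in> centralizer (carrier R)\<close> x show False
    by simp
qed

text \<open>Leaving out the center discards the one-element classes. The restriction in the action
  makes each map extensional, as \<open>BijGroup\<close> demands.\<close>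

lemma conj_action:
  "group_action (units_of R) (carrier R - centralizer (carrier R))
    (\<lambda>g. \<lambda>x \<in> carrier R - centralizer (carrier R). g \<otimes> x \<otimes> inv g)"
  (is "group_action _ ?E ?\<phi>")
proof (unfold group_action_def group_hom_def group_hom_axioms_def, intro conjI homI)
  show "group (units_of R)" "group (BijGroup ?E)"
    by (simp_all add: units_group group_BijGroup)
  have comp: "g \<otimes> (h \<otimes> x \<otimes> inv h) \<otimes> inv g = (g \<otimes> h) \<otimes> x \<otimes> inv (g \<otimes> h)"
    if "g \<in> Units R" "h \<in> Units R" "x \<in> carrier R" for g h x
  proof -
    have "inv (g \<otimes> h) = inv h \<otimes> inv g"
      using group.inv_mult_group[OF units_group, of g h] that
      by (simp add: units_of_inv units_of_mult units_of_carrier)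
    moreover have "g \<in> carrier R" "h \<in> carrier R" "inv g \<in> carrier R" "inv h \<in> carrier R"
      using that by auto
    ultimately show ?thesis
      using that(3) by (simp add: m_assoc)
  qed
  have bij: "?\<phi> g \<in> Bij ?E" if g: "g \<in> Units R" for g
    unfolding Bij_def bij_betw_def
  proof (intro CollectI IntI conjI restrict_extensional)
    show "inj_on (?\<phi> g) ?E"
    proof (rule inj_onI)
      fix x y assume xy: "x \<in> ?E" "y \<in> ?E" "?\<phi> g x = ?\<phi> g y"
      then have "inv g \<otimes> (g \<otimes> x \<otimes> inv g) \<otimes> inv (inv g) = inv g \<otimes> (g \<otimes> y \<otimes> inv g) \<otimes> inv (inv g)"
        by simp
      then show "x = y"
        using xy comp[of "inv g" g x] comp[of "inv g" g y] g by simp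
    qed
    show "?\<phi> g ` ?E = ?E"
    proof (intro equalityI subsetI)
      fix x assume "x \<in> ?\<phi> g ` ?E"
      then show "x \<in> ?E"
        using conj_mem_noncentral[OF g] by auto
    next
      fix x assume x: "x \<in> ?E"
      have "inv g \<otimes> x \<otimes> inv (inv g) \<in> ?E"
        using g x by (intro conj_mem_noncentral) auto
      moreover have "x = g \<otimes> (inv g \<otimes> x \<otimes> inv (inv g)) \<otimes> inv g"
        using comp[of g "inv g" x] g x by simp
      ultimately show "x \<in> ?\<phi> g ` ?E"
        by (intro image_eqI[of _ _ "inv g \<otimes> x \<otimes> inv (inv g)"]) auto
    qed
  qed
  fix g h assume "g \<in> carrier (units_of R)" "h \<in> carrier (units_of R)"
  then have g: "g \<in> Units R" and h: "h \<in> Units R"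
    by (auto simp: units_of_def)
  show "?\<phi> g \<in> carrier (BijGroup ?E)"
    using bij[OF g] by (simp add: BijGroup_def)
  show "?\<phi> (g \<otimes>\<^bsub>units_of R\<^esub> h) = ?\<phi> g \<otimes>\<^bsub>BijGroup ?E\<^esub> ?\<phi> h"
  proof
    fix x
    show "?\<phi> (g \<otimes>\<^bsub>units_of R\<^esub> h) x = (?\<phi> g \<otimes>\<^bsub>BijGroup ?E\<^esub> ?\<phi> h) x"
      using bij[OF g] bij[OF h] g h comp[OF g h, of x] conj_mem_noncentral[OF h, of x]
      by (auto simp: BijGroup_def units_of_def compose_def)
  qed
qed

text \<open>The class equation, with \<open>q\<close> the order of the center and \<open>q^n\<close>
  that of \<open>R\<close>. The class of a noncentral \<open>a\<close> has
  \<open>(q^n - 1) / (q^d - 1)\<close> elements, where \<open>q^d\<close> is the order of the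
  centralizer of \<open>a\<close> and \<open>d\<close> is a proper divisor of \<open>n\<close>. So
  \<open>N\<close> divides each class, hence \<open>q^n - q\<close>, and it also divides
  \<open>q^n - 1\<close>; the difference \<open>q - 1\<close> is the contradiction.\<close>

theorem wedderburn:
  assumes "x \<in> carrier R" and "y \<in> carrier R"
  shows "x \<otimes> y = y \<otimes> x"
proof (rule ccontr)
  assume neq: "x \<otimes> y \<noteq> y \<otimes> x"
  define Z where "Z = centralizer (carrier R)"
  define q where "q = card Z"
  define \<phi> where "\<phi> = (\<lambda>g. \<lambda>x \<in> carrier R - Z. g \<otimes> x \<otimes> inv g)"
  interpret act: group_action "units_of R" "carrier R - Z" \<phi>
    unfolding Z_def \<phi>_def by (rule conj_action)
  have Zsub: "subring Z R" and Zc: "Z \<subseteq> carrier R"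
    using subring_centralizer[of "carrier R"] by (auto simp: Z_def centralizer_def)
  have finZ: "finite Z"
    using Zc finite_carrier by (rule finite_subset)
  have "x \<notin> Z"
    using neq assms by (auto simp: Z_def centralizer_def)
  have q: "q \<ge> 2"
  proof -
    have "card {\<zero>, \<one>} \<le> card Z"
      using finZ subringE(2,3)[OF Zsub] by (intro card_mono) auto
    then show ?thesis
      using one_neq_zero by (simp add: q_def)
  qed
  obtain n where n: "card (carrier R) = q ^ n"
    unfolding q_def Z_def
    by (rule card_power_centralizer[of "carrier R" "carrier R"])
      (auto simp: centralizer_def carrier_is_subring)
  have "q < q ^ n"
    using psubset_card_mono[OF finite_carrier, of Z] \<open>x \<notin> Z\<close> assms Zc by (auto simp: n q_def[symmetric])
  then have "n > 1"
    using q power_less_imp_less_exp[of q 1 n] by simp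
  obtain N where N: "\<not> N dvd int q - 1"
    and Ndvd: "\<And>d m. 0 < d \<Longrightarrow> d < n \<Longrightarrow> d dvd n \<Longrightarrow> m * (int q ^ d - 1) = int q ^ n - 1 \<Longrightarrow> N dvd m"
    using cyclotomic_divisor_exists[OF q \<open>n > 1\<close>] by metis
  have card_Units: "int (card (Units R)) = int q ^ n - 1"
    using n finite_carrier q by (simp add: Units_eq card_Diff_singleton of_nat_diff)
  have orbit: "N dvd int (card orb)" if orb_mem: "orb \<in> orbits (units_of R) (carrier R - Z) \<phi>" for orb
  proof -
    obtain a where a: "a \<in> carrier R - Z" and orb: "orb = orbit (units_of R) \<phi> a"
      using orb_mem by (auto simp: orbits_def)
    have ac: "a \<in> carrier R"
      using a by simp
    define C where "C = centralizer {a}"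
    have Csub: "subring C R"
      unfolding C_def using ac by (intro subring_centralizer) simp
    have Cc: "C \<subseteq> carrier R"
      by (auto simp: C_def centralizer_def)
    obtain d where d: "card C = q ^ d"
      unfolding q_def Z_def
    proof (rule card_power_centralizer[of "carrier R" C])
      show "centralizer (carrier R) \<subseteq> C"
        using ac by (auto simp: C_def centralizer_def)
    qed (use Csub in auto)
    \<comment> \<open>\<open>R\<close> is a vector space over the centralizer of \<open>a\<close>,
      and this is what makes \<open>d\<close> divide \<open>n\<close>.\<close>
    obtain k where "q ^ n = (q ^ d) ^ k"
      unfolding n[symmetric] d[symmetric] C_def
      by (rule card_power_centralizer[of "{a}" "carrier R"])
        (use ac in \<open>auto simp: centralizer_def carrier_is_subring\<close>)
    then have "n = d * k"
      using q by (simp flip: power_mult)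
    moreover have "C \<noteq> carrier R"
    proof
      assume C: "C = carrier R"
      have "x \<otimes> a = a \<otimes> x" if "x \<in> carrier R" for x
        using that unfolding C[symmetric] by (simp add: C_def centralizer_def)
      then have "a \<in> Z"
        using ac by (simp add: Z_def centralizer_def)
      with a show False by simp
    qed
    then have "q ^ d < q ^ n"
      using psubset_card_mono[OF finite_carrier, of C] Cc by (auto simp: n d)
    then have "d < n"
      using q power_less_imp_less_exp[of q d n] by simp
    ultimately have dn: "0 < d" "d < n" "d dvd n"
      using \<open>n > 1\<close> by (auto intro: gr0I)
    \<comment> \<open>Fixing \<open>a\<close> under conjugation means commuting with it; zero is
      removed because only units act.\<close>
    have "stabilizer (units_of R) \<phi> a = C - {\<zero>}"
    proof -
      have "g \<otimes> a \<otimes> inv g = a \<longleftrightarrow> g \<otimes> a = a \<otimes> g" if g: "g \<in> Units R" for g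
      proof
        have gc: "g \<in> carrier R" "inv g \<in> carrier R"
          using g by auto
        assume "g \<otimes> a \<otimes> inv g = a"
        then have "g \<otimes> a \<otimes> inv g \<otimes> g = a \<otimes> g"
          by simp
        then show "g \<otimes> a = a \<otimes> g"
          using g gc ac by (simp add: m_assoc)
      next
        assume "g \<otimes> a = a \<otimes> g"
        then show "g \<otimes> a \<otimes> inv g = a"
          using g ac by (simp add: m_assoc Units_closed)
      qed
      then show ?thesis
        using a by (auto simp: \<phi>_def stabilizer_def units_of_def C_def centralizer_def Units_eq)
    qed
    moreover have "int (card (C - {\<zero>})) = int q ^ d - 1"
      using d Cc finite_carrier q subringE(2)[OF Csub]
      by (subst card_Diff_singleton) (auto simp: of_nat_diff)
    moreover have "int (card orb) * int (card (stabilizer (units_of R) \<phi> a)) = int (card (Units R))"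
      using act.orbit_stabilizer_theorem[OF a]
      by (simp add: orb Coset.order_def units_of_carrier flip: of_nat_mult)
    ultimately have "int (card orb) * (int q ^ d - 1) = int q ^ n - 1"
      by (simp add: card_Units)
    then show ?thesis
      using Ndvd dn by blast
  qed
  have "int (card (carrier R - Z)) =
      int (\<Sum>orb\<in>orbits (units_of R) (carrier R - Z) \<phi>. \<Sum>x\<in>orb. 1)"
    using finite_carrier by (subst act.disjoint_sum) auto
  also have "\<dots> = (\<Sum>orb\<in>orbits (units_of R) (carrier R - Z) \<phi>. int (card orb))"
    by simp
  finally have "N dvd int (card (carrier R - Z))"
    using orbit by (simp add: dvd_sum)
  then have "N dvd int q ^ n - int q"
    using n finZ Zc finite_carrier \<open>q < q ^ n\<close> by (simp add: card_Diff_subset q_def of_nat_diff)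
  \<comment> \<open>The case \<open>d = 1\<close> gives the geometric sum, a factor of
    \<open>q^n - 1\<close>.\<close>
  moreover have "N dvd int q ^ n - 1"
  proof -
    have "N dvd (\<Sum>i<n. int q ^ i)"
      using Ndvd[of 1 "\<Sum>i<n. int q ^ i"] \<open>n > 1\<close> power_diff_1_eq[of "int q" n] by (simp add: mult.commute)
    then show ?thesis
      using power_diff_1_eq[of "int q" n] by (metis dvd_mult)
  qed
  ultimately have "N dvd (int q ^ n - 1) - (int q ^ n - int q)"
    by (rule dvd_diff[rotated])
  with N show False
    by simp
qed

end

section \<open>Linear combinations in free one-sided modules\<close>

text \<open>Only the field \<open>mult\<close> is updated, so the additive structure and all
  carriers stay literally the same and the operation is an involution on records.\<close>

definition opposite_ring :: "('a, 'r) ring_scheme \<Rightarrow> ('a, 'r) ring_scheme"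
  where "opposite_ring R = R\<lparr>mult := \<lambda>x y. y \<otimes>\<^bsub>R\<^esub> x\<rparr>"

lemma opposite_ring_simps [simp]:
  "carrier (opposite_ring R) = carrier R"
  "\<zero>\<^bsub>opposite_ring R\<^esub> = \<zero>\<^bsub>R\<^esub>"
  "\<one>\<^bsub>opposite_ring R\<^esub> = \<one>\<^bsub>R\<^esub>"
  "x \<oplus>\<^bsub>opposite_ring R\<^esub> y = x \<oplus>\<^bsub>R\<^esub> y"
  "x \<otimes>\<^bsub>opposite_ring R\<^esub> y = y \<otimes>\<^bsub>R\<^esub> x"
  "finsum (opposite_ring R) f A = finsum R f A"
  "opposite_ring (opposite_ring R) = R"
  by (simp_all add: opposite_ring_def finsum_def)

lemma Units_opposite_ring [simp]: "Units (opposite_ring R) = Units R"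
  by (auto simp: Units_def)

lemma right_space_opposite_ring: "right_space (opposite_ring R) n = left_space R n"
  by (simp add: left_space_def right_space_def opposite_ring_def)

lemma (in ring) ring_opposite_ring: "ring (opposite_ring R)"
proof (rule ringI)
  show "abelian_group (opposite_ring R)"
    by (rule abelian_groupI) (auto simp: a_ac intro: l_neg a_inv_closed)
  show "monoid (opposite_ring R)"
    by (rule monoidI) (auto simp: m_assoc)
qed (auto simp: l_distr r_distr)

text \<open>Coefficients stand on the right. Over \<open>opposite_ring R\<close> the same formula
  becomes the product of the row vector \<open>a\<close> with the matrix whose rows are
  \<open>gs\<close>.\<close>

definition lincomb :: "('a, 'r) ring_scheme \<Rightarrow> nat \<Rightarrow> 'a vec list \<Rightarrow> 'a vec \<Rightarrow> 'a vec"
  where "lincomb R n gs a = vec n (\<lambda>j. \<Oplus>\<^bsub>R\<^esub>i\<in>{..<length gs}. gs ! i $ j \<otimes>\<^bsub>R\<^esub> a $ i)"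

definition std_unit :: "('a, 'r) ring_scheme \<Rightarrow> nat \<Rightarrow> nat \<Rightarrow> 'a vec"
  where "std_unit R n i = vec n (\<lambda>j. if j = i then \<one>\<^bsub>R\<^esub> else \<zero>\<^bsub>R\<^esub>)"

lemma mem_right_space_iff:
  "v \<in> carrier (right_space R n) \<longleftrightarrow> dim_vec v = n \<and> (\<forall>i<n. v $ i \<in> carrier R)"
  unfolding right_space_def carrier_vec_def partial_object.select_convs mem_Collect_eq by (rule refl)

lemma right_space_simps [simp]:
  "\<zero>\<^bsub>right_space R n\<^esub> = vec n (\<lambda>_. \<zero>\<^bsub>R\<^esub>)"
  "v \<oplus>\<^bsub>right_space R n\<^esub> w = vec n (\<lambda>i. v $ i \<oplus>\<^bsub>R\<^esub> w $ i)"
  "r \<odot>\<^bsub>right_space R n\<^esub> v = vec n (\<lambda>i. v $ i \<otimes>\<^bsub>R\<^esub> r)"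
  unfolding right_space_def by (rule refl | simp only: ring.select_convs module.select_convs)+

lemma carrier_right_space_opposite_ring [simp]:
  "carrier (right_space (opposite_ring R) n) = carrier (right_space R n)"
  by (intro Set.set_eqI) (simp only: mem_right_space_iff opposite_ring_simps)

lemma nth_in_right_space:
  assumes "set gs \<subseteq> carrier (right_space R n)" and "i < length gs"
  shows "gs ! i \<in> carrier (right_space R n)" and "dim_vec (gs ! i) = n"
    and "j < n \<Longrightarrow> gs ! i $ j \<in> carrier R"
proof -
  show "gs ! i \<in> carrier (right_space R n)"
    using assms nth_mem by blast
  then show "dim_vec (gs ! i) = n" and "j < n \<Longrightarrow> gs ! i $ j \<in> carrier R"
    by (simp_all add: mem_right_space_iff)
qed

lemma dim_lincomb [simp]: "dim_vec (lincomb R n gs a) = n"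
  by (simp add: lincomb_def)

lemma lincomb_nth:
  "j < n \<Longrightarrow> lincomb R n gs a $ j = (\<Oplus>\<^bsub>R\<^esub>i\<in>{..<length gs}. gs ! i $ j \<otimes>\<^bsub>R\<^esub> a $ i)"
  by (simp add: lincomb_def)

context ring
begin

lemma abelian_group_right_space: "abelian_group (right_space R n)"
proof (rule abelian_groupI)
  fix v assume v: "v \<in> carrier (right_space R n)"
  show "\<exists>w\<in>carrier (right_space R n). w \<oplus>\<^bsub>right_space R n\<^esub> v = \<zero>\<^bsub>right_space R n\<^esub>"
    by (rule bexI[of _ "vec n (\<lambda>i. \<ominus> v $ i)"])
      (use v in \<open>auto simp: mem_right_space_iff l_neg\<close>)
qed (auto simp: mem_right_space_iff a_ac intro!: eq_vecI)

lemma a_inv_right_space: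
  assumes "v \<in> carrier (right_space R n)"
  shows "\<ominus>\<^bsub>right_space R n\<^esub> v = (\<ominus> \<one>) \<odot>\<^bsub>right_space R n\<^esub> v"
proof -
  interpret M: abelian_group "right_space R n"
    by (rule abelian_group_right_space)
  show ?thesis
    by (rule M.minus_equality)
      (use assms in \<open>auto simp: mem_right_space_iff r_minus l_neg\<close>)
qed

text \<open>Closure under negation comes for free, since negation is multiplication by the scalar
  \<open>-1\<close>.\<close>

lemma submodule_right_space_iff:
  "submodule C R (right_space R n) \<longleftrightarrow>
    C \<subseteq> carrier (right_space R n) \<and> \<zero>\<^bsub>right_space R n\<^esub> \<in> C \<and>
    (\<forall>x\<in>C. \<forall>y\<in>C. x \<oplus>\<^bsub>right_space R n\<^esub> y \<in> C) \<and>
    (\<forall>r\<in>carrier R. \<forall>x\<in>C. r \<odot>\<^bsub>right_space R n\<^esub> x \<in> C)" (is "_ \<longleftrightarrow> ?rhs")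
proof
  assume "submodule C R (right_space R n)"
  then interpret submodule C R "right_space R n" .
  show ?rhs
    using subset one_closed m_closed smult_closed by (auto simp del: right_space_simps)
next
  assume rhs: ?rhs
  have "\<ominus>\<^bsub>right_space R n\<^esub> x \<in> C" if "x \<in> C" for x
    using that rhs by (subst a_inv_right_space) (auto simp del: right_space_simps)
  with rhs show "submodule C R (right_space R n)"
    by (auto simp: submodule_def submodule_axioms_def subgroup_def a_inv_def simp del: right_space_simps)
qed

lemma lincomb_closed:
  assumes "set gs \<subseteq> carrier (right_space R n)" and "a \<in> carrier (right_space R (length gs))"
  shows "lincomb R n gs a \<in> carrier (right_space R n)"
proof -
  have "gs ! i \<in> carrier (right_space R n)" if "i < length gs" for i
    using that assms by auto
  then show ?thesis
    using assms by (auto simp: mem_right_space_iff lincomb_nth intro!: finsum_closed)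
qed

lemma lincomb_add:
  assumes "set gs \<subseteq> carrier (right_space R n)"
    and "a \<in> carrier (right_space R (length gs))" "b \<in> carrier (right_space R (length gs))"
  shows "lincomb R n gs (a \<oplus>\<^bsub>right_space R (length gs)\<^esub> b) =
    lincomb R n gs a \<oplus>\<^bsub>right_space R n\<^esub> lincomb R n gs b"
proof (rule eq_vecI)
  fix j assume "j < dim_vec (lincomb R n gs a \<oplus>\<^bsub>right_space R n\<^esub> lincomb R n gs b)"
  then have j: "j < n"
    by simp
  have g: "gs ! i $ j \<in> carrier R" "a $ i \<in> carrier R" "b $ i \<in> carrier R" if "i < length gs" for i
    using that assms j nth_in_right_space(3)[of gs R n i j] by (simp_all add: mem_right_space_iff)
  have "(\<Oplus>i\<in>{..<length gs}. gs ! i $ j \<otimes> (a $ i \<oplus> b $ i)) =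
      (\<Oplus>i\<in>{..<length gs}. gs ! i $ j \<otimes> a $ i \<oplus> gs ! i $ j \<otimes> b $ i)"
    using g by (intro finsum_cong') (auto simp: r_distr)
  also have "\<dots> = (\<Oplus>i\<in>{..<length gs}. gs ! i $ j \<otimes> a $ i) \<oplus> (\<Oplus>i\<in>{..<length gs}. gs ! i $ j \<otimes> b $ i)"
    using g by (intro finsum_addf) auto
  also have "(\<Oplus>i\<in>{..<length gs}. gs ! i $ j \<otimes> (a $ i \<oplus> b $ i)) =
      (\<Oplus>i\<in>{..<length gs}. gs ! i $ j \<otimes> (a \<oplus>\<^bsub>right_space R (length gs)\<^esub> b) $ i)"
    using g by (intro finsum_cong') auto
  finally show "lincomb R n gs (a \<oplus>\<^bsub>right_space R (length gs)\<^esub> b) $ j =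
      (lincomb R n gs a \<oplus>\<^bsub>right_space R n\<^esub> lincomb R n gs b) $ j"
    using j by (simp add: lincomb_nth)
qed simp

lemma lincomb_smult:
  assumes "set gs \<subseteq> carrier (right_space R n)"
    and "a \<in> carrier (right_space R (length gs))" "r \<in> carrier R"
  shows "lincomb R n gs (r \<odot>\<^bsub>right_space R (length gs)\<^esub> a) =
    r \<odot>\<^bsub>right_space R n\<^esub> lincomb R n gs a"
proof (rule eq_vecI)
  fix j assume "j < dim_vec (r \<odot>\<^bsub>right_space R n\<^esub> lincomb R n gs a)"
  then have j: "j < n"
    by simp
  have g: "gs ! i $ j \<in> carrier R" "a $ i \<in> carrier R" if "i < length gs" for i
    using that assms j nth_in_right_space(3)[of gs R n i j] by (simp_all add: mem_right_space_iff)
  have "(\<Oplus>i\<in>{..<length gs}. gs ! i $ j \<otimes> a $ i) \<otimes> r = (\<Oplus>i\<in>{..<length gs}. gs ! i $ j \<otimes> a $ i \<otimes> r)"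
    using g assms(3) by (intro finsum_ldistr) auto
  also have "\<dots> = (\<Oplus>i\<in>{..<length gs}. gs ! i $ j \<otimes> (r \<odot>\<^bsub>right_space R (length gs)\<^esub> a) $ i)"
    using g assms(3) by (intro finsum_cong') (auto simp: m_assoc)
  finally show "lincomb R n gs (r \<odot>\<^bsub>right_space R (length gs)\<^esub> a) $ j =
      (r \<odot>\<^bsub>right_space R n\<^esub> lincomb R n gs a) $ j"
    using j by (simp add: lincomb_nth)
qed simp

lemma std_unit_closed: "std_unit R n i \<in> carrier (right_space R n)"
  by (auto simp: std_unit_def mem_right_space_iff)

lemma lincomb_std_unit:
  assumes "set gs \<subseteq> carrier (right_space R n)" and i: "i < length gs"
  shows "lincomb R n gs (std_unit R (length gs) i) = gs ! i"
proof (rule eq_vecI)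
  fix j assume "j < dim_vec (gs ! i)"
  then have j: "j < n"
    using nth_in_right_space(2)[OF assms] by simp
  have g: "gs ! i $ j \<in> carrier R" if "i < length gs" for i
    using that assms j nth_in_right_space(3)[of gs R n i j] by (simp_all add: mem_right_space_iff)
  have "(\<Oplus>k\<in>{..<length gs}. gs ! k $ j \<otimes> std_unit R (length gs) i $ k) =
      (\<Oplus>k\<in>{..<length gs}. if i = k then gs ! k $ j else \<zero>)"
    using g by (intro finsum_cong') (auto simp: std_unit_def)
  also have "\<dots> = gs ! i $ j"
    using g i by (intro finsum_singleton) auto
  finally show "lincomb R n gs (std_unit R (length gs) i) $ j = gs ! i $ j"
    using j by (simp add: lincomb_nth)
qed (use nth_in_right_space(2)[OF assms] in simp)

lemma lincomb_std_units:
  assumes v: "v \<in> carrier (right_space R n)"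
  shows "lincomb R n (map (std_unit R n) [0..<n]) v = v"
proof (rule eq_vecI)
  fix j assume "j < dim_vec v"
  then have j: "j < n"
    using v by (simp add: mem_right_space_iff)
  have "(\<Oplus>k\<in>{..<n}. map (std_unit R n) [0..<n] ! k $ j \<otimes> v $ k) = (\<Oplus>k\<in>{..<n}. if j = k then v $ k else \<zero>)"
    using v j by (intro finsum_cong') (auto simp: std_unit_def mem_right_space_iff)
  also have "\<dots> = v $ j"
    using v j by (intro finsum_singleton) (auto simp: mem_right_space_iff)
  finally show "lincomb R n (map (std_unit R n) [0..<n]) v $ j = v $ j"
    using j by (simp add: lincomb_nth)
qed (use v in \<open>simp add: mem_right_space_iff\<close>)

text \<open>\<open>lincomb\<close> is defined entry by entry; this recursion makes induction on the
  number of terms possible at the level of vectors.\<close>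

lemma partial_sum_Suc:
  assumes "\<And>i. i \<le> k \<Longrightarrow> g i \<in> carrier (right_space R n)" "\<And>i. i \<le> k \<Longrightarrow> a i \<in> carrier R"
  shows "vec n (\<lambda>j. \<Oplus>i\<in>{..<Suc k}. g i $ j \<otimes> a i) =
    vec n (\<lambda>j. \<Oplus>i\<in>{..<k}. g i $ j \<otimes> a i) \<oplus>\<^bsub>right_space R n\<^esub> (a k \<odot>\<^bsub>right_space R n\<^esub> g k)"
proof (rule eq_vecI)
  fix j assume "j < dim_vec (vec n (\<lambda>j. \<Oplus>i\<in>{..<k}. g i $ j \<otimes> a i) \<oplus>\<^bsub>right_space R n\<^esub> (a k \<odot>\<^bsub>right_space R n\<^esub> g k))"
  then have j: "j < n"
    by simp
  have g: "g i $ j \<in> carrier R" "a i \<in> carrier R" if "i \<le> k" for i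
    using assms(1)[OF that] assms(2)[OF that] j by (auto simp: mem_right_space_iff)
  have "(\<Oplus>i\<in>{..<Suc k}. g i $ j \<otimes> a i) = g k $ j \<otimes> a k \<oplus> (\<Oplus>i\<in>{..<k}. g i $ j \<otimes> a i)"
    unfolding lessThan_Suc using g by (intro finsum_insert) auto
  also have "\<dots> = (\<Oplus>i\<in>{..<k}. g i $ j \<otimes> a i) \<oplus> g k $ j \<otimes> a k"
    using g by (intro a_comm finsum_closed) auto
  finally show "vec n (\<lambda>j. \<Oplus>i\<in>{..<Suc k}. g i $ j \<otimes> a i) $ j =
      (vec n (\<lambda>j. \<Oplus>i\<in>{..<k}. g i $ j \<otimes> a i) \<oplus>\<^bsub>right_space R n\<^esub> (a k \<odot>\<^bsub>right_space R n\<^esub> g k)) $ j"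
    using j by simp
qed simp

lemma lincomb_in_submodule:
  assumes C: "submodule C R (right_space R n)" and "set gs \<subseteq> C"
    and a: "a \<in> carrier (right_space R (length gs))"
  shows "lincomb R n gs a \<in> C"
proof -
  have g: "gs ! i \<in> C" "gs ! i \<in> carrier (right_space R n)" "a $ i \<in> carrier R" if "i < length gs" for i
  proof -
    show "gs ! i \<in> C"
      using that assms(2) nth_mem by blast
    then show "gs ! i \<in> carrier (right_space R n)"
      using C unfolding submodule_right_space_iff by blast
    show "a $ i \<in> carrier R"
      using a that by (simp add: mem_right_space_iff)
  qed
  have "vec n (\<lambda>j. \<Oplus>i\<in>{..<k}. gs ! i $ j \<otimes> a $ i) \<in> C" if "k \<le> length gs" for k
    using that
  proof (induction k)
    case 0
    then show ?case
      using C by (simp add: submodule_right_space_iff)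
  next
    case (Suc k)
    then show ?case
      using C g by (subst partial_sum_Suc)
        (auto simp: submodule_right_space_iff simp del: right_space_simps(2,3))
  qed
  then show ?thesis
    by (simp add: lincomb_def)
qed

text \<open>Stated for an arbitrary functional because it serves twice: for the coordinates of a
  linear map and for the pairing with a fixed vector.\<close>

lemma linear_functional_lincomb:
  assumes closed: "\<And>x. x \<in> carrier (right_space R n) \<Longrightarrow> \<phi> x \<in> carrier R"
    and add: "\<And>x y. x \<in> carrier (right_space R n) \<Longrightarrow> y \<in> carrier (right_space R n) \<Longrightarrow>
      \<phi> (x \<oplus>\<^bsub>right_space R n\<^esub> y) = \<phi> x \<oplus> \<phi> y"
    and smult: "\<And>r x. r \<in> carrier R \<Longrightarrow> x \<in> carrier (right_space R n) \<Longrightarrow>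
      \<phi> (r \<odot>\<^bsub>right_space R n\<^esub> x) = \<phi> x \<otimes> r"
    and gs: "set gs \<subseteq> carrier (right_space R n)"
    and a: "a \<in> carrier (right_space R (length gs))"
  shows "\<phi> (lincomb R n gs a) = (\<Oplus>i\<in>{..<length gs}. \<phi> (gs ! i) \<otimes> a $ i)"
proof -
  interpret M: abelian_group "right_space R n"
    by (rule abelian_group_right_space)
  have g: "gs ! i \<in> carrier (right_space R n)" "a $ i \<in> carrier R" if "i < length gs" for i
    using that a nth_in_right_space(1)[OF gs] by (simp_all add: mem_right_space_iff)
  have smult_closed: "r \<odot>\<^bsub>right_space R n\<^esub> x \<in> carrier (right_space R n)"
    if "r \<in> carrier R" "x \<in> carrier (right_space R n)" for r x
    using that by (auto simp: mem_right_space_iff)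
  have psum: "vec n (\<lambda>j. \<Oplus>i\<in>{..<k}. gs ! i $ j \<otimes> a $ i) \<in> carrier (right_space R n)"
    if "k \<le> length gs" for k
    using that g by (auto simp: mem_right_space_iff intro!: finsum_closed)
  have zero: "\<phi> (vec n (\<lambda>_. \<zero>)) = \<zero>"
  proof -
    have "\<zero> \<odot>\<^bsub>right_space R n\<^esub> vec n (\<lambda>_. \<zero>) = vec n (\<lambda>_. \<zero>)"
      by (intro eq_vecI) auto
    then show ?thesis
      using smult[of \<zero> "vec n (\<lambda>_. \<zero>)"] closed[of "vec n (\<lambda>_. \<zero>)"] by (simp add: mem_right_space_iff)
  qed
  have "\<phi> (vec n (\<lambda>j. \<Oplus>i\<in>{..<k}. gs ! i $ j \<otimes> a $ i)) = (\<Oplus>i\<in>{..<k}. \<phi> (gs ! i) \<otimes> a $ i)"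
    if "k \<le> length gs" for k
    using that
  proof (induction k)
    case 0
    then show ?case
      by (simp add: zero)
  next
    case (Suc k)
    then have k: "k < length gs" "k \<le> length gs"
      by auto
    have "\<phi> (vec n (\<lambda>j. \<Oplus>i\<in>{..<Suc k}. gs ! i $ j \<otimes> a $ i)) =
        (\<Oplus>i\<in>{..<k}. \<phi> (gs ! i) \<otimes> a $ i) \<oplus> \<phi> (gs ! k) \<otimes> a $ k"
      using Suc.IH[OF k(2)] g k psum[OF k(2)]
      by (subst partial_sum_Suc) (simp_all add: add smult smult_closed del: right_space_simps)
    also have "\<dots> = \<phi> (gs ! k) \<otimes> a $ k \<oplus> (\<Oplus>i\<in>{..<k}. \<phi> (gs ! i) \<otimes> a $ i)"
      using g closed k by (intro a_comm finsum_closed) auto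
    also have "\<dots> = (\<Oplus>i\<in>{..<Suc k}. \<phi> (gs ! i) \<otimes> a $ i)"
      unfolding lessThan_Suc using g closed k by (intro finsum_insert[symmetric]) auto
    finally show ?case .
  qed
  then show ?thesis
    by (simp add: lincomb_def)
qed

lemma linear_map_lincomb:
  assumes f: "f \<in> mod_Hom R (right_space R m) (right_space R n)"
    and gs: "set gs \<subseteq> carrier (right_space R m)"
    and a: "a \<in> carrier (right_space R (length gs))"
  shows "f (lincomb R m gs a) = lincomb R n (map f gs) a"
proof (rule eq_vecI)
  have cl: "f x \<in> carrier (right_space R n)" if "x \<in> carrier (right_space R m)" for x
    using f that by (auto simp: mod_Hom_def)
  have len: "dim_vec (f (lincomb R m gs a)) = n"
    using cl[OF lincomb_closed[OF gs a]] by (simp add: mem_right_space_iff)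
  then show "dim_vec (f (lincomb R m gs a)) = dim_vec (lincomb R n (map f gs) a)"
    by simp
  fix j assume "j < dim_vec (lincomb R n (map f gs) a)"
  then have j: "j < n"
    by simp
  have cl_j: "f x $ j \<in> carrier R" if "x \<in> carrier (right_space R m)" for x
    using cl[OF that] j by (simp add: mem_right_space_iff)
  have "f (lincomb R m gs a) $ j = (\<Oplus>i\<in>{..<length gs}. f (gs ! i) $ j \<otimes> a $ i)"
    by (rule linear_functional_lincomb[OF _ _ _ gs a])
      (use f j cl_j in \<open>auto simp: mod_Hom_def simp del: right_space_simps(1)\<close>)
  also have "\<dots> = (\<Oplus>i\<in>{..<length gs}. map f gs ! i $ j \<otimes> a $ i)"
  proof (rule finsum_cong')
    show "(\<lambda>i. map f gs ! i $ j \<otimes> a $ i) \<in> {..<length gs} \<rightarrow> carrier R"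
      using cl_j nth_in_right_space(1)[OF gs] a by (auto simp: mem_right_space_iff)
  qed auto
  finally show "f (lincomb R m gs a) $ j = lincomb R n (map f gs) a $ j"
    using j by (simp add: lincomb_nth)
qed

lemma lincomb_mod_Hom:
  assumes "set gs \<subseteq> carrier (right_space R n)"
  shows "lincomb R n gs \<in> mod_Hom R (right_space R (length gs)) (right_space R n)"
  using assms unfolding mod_Hom_def
  by (auto simp: lincomb_closed lincomb_add lincomb_smult simp del: right_space_simps)

text \<open>Associativity of the matrix product, obtained from the linearity of
  \<open>lincomb\<close> in its coefficients.\<close>

lemma lincomb_lincomb:
  assumes "set gs \<subseteq> carrier (right_space R n)" and "set bs \<subseteq> carrier (right_space R (length gs))"
    and "a \<in> carrier (right_space R (length bs))"
  shows "lincomb R n gs (lincomb R (length gs) bs a) = lincomb R n (map (lincomb R n gs) bs) a"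
  using assms by (intro linear_map_lincomb lincomb_mod_Hom)

lemma submodule_range_lincomb:
  assumes "set gs \<subseteq> carrier (right_space R n)"
  shows "submodule (lincomb R n gs ` carrier (right_space R (length gs))) R (right_space R n)"
proof -
  let ?m = "length gs"
  interpret M: abelian_group "right_space R ?m"
    by (rule abelian_group_right_space)
  have "lincomb R n gs (\<zero>\<^bsub>right_space R ?m\<^esub>) = \<zero>\<^bsub>right_space R n\<^esub>"
  proof (rule eq_vecI)
    fix j assume "j < dim_vec (\<zero>\<^bsub>right_space R n\<^esub>)"
    then have j: "j < n"
      by simp
    have "gs ! i $ j \<in> carrier R" if "i < ?m" for i
      using that assms j nth_in_right_space(3)[of gs R n i j] by (simp_all add: mem_right_space_iff)
    then have "(\<Oplus>i\<in>{..<?m}. gs ! i $ j \<otimes> \<zero>\<^bsub>right_space R ?m\<^esub> $ i) = (\<Oplus>i\<in>{..<?m}. \<zero>)"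
      by (intro finsum_cong') auto
    then show "lincomb R n gs (\<zero>\<^bsub>right_space R ?m\<^esub>) $ j = \<zero>\<^bsub>right_space R n\<^esub> $ j"
      using j by (simp add: lincomb_nth)
  qed simp
  then have zero: "\<zero>\<^bsub>right_space R n\<^esub> \<in> lincomb R n gs ` carrier (right_space R ?m)"
    using M.zero_closed by (rule image_eqI[OF sym])
  have smult_closed: "r \<odot>\<^bsub>right_space R ?m\<^esub> x \<in> carrier (right_space R ?m)"
    if "r \<in> carrier R" "x \<in> carrier (right_space R ?m)" for r x
    using that by (auto simp: mem_right_space_iff)
  show ?thesis
    unfolding submodule_right_space_iff
  proof (intro conjI ballI zero)
    show "lincomb R n gs ` carrier (right_space R ?m) \<subseteq> carrier (right_space R n)"
      using assms lincomb_closed by blast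
  next
    fix x y assume "x \<in> lincomb R n gs ` carrier (right_space R ?m)"
      "y \<in> lincomb R n gs ` carrier (right_space R ?m)"
    then obtain a b where a: "a \<in> carrier (right_space R ?m)" and b: "b \<in> carrier (right_space R ?m)"
      and xy: "x = lincomb R n gs a" "y = lincomb R n gs b"
      by blast
    show "x \<oplus>\<^bsub>right_space R n\<^esub> y \<in> lincomb R n gs ` carrier (right_space R ?m)"
      unfolding xy lincomb_add[OF assms a b, symmetric] using M.a_closed[OF a b] by (rule imageI)
  next
    fix r x assume r: "r \<in> carrier R" and "x \<in> lincomb R n gs ` carrier (right_space R ?m)"
    then obtain a where a: "a \<in> carrier (right_space R ?m)" and x: "x = lincomb R n gs a"
      by blast
    show "r \<odot>\<^bsub>right_space R n\<^esub> x \<in> lincomb R n gs ` carrier (right_space R ?m)"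
      unfolding x lincomb_smult[OF assms a r, symmetric] using smult_closed[OF r a] by (rule imageI)
  qed
qed

lemma mod_span_eq_lincomb:
  assumes "set gs \<subseteq> carrier (right_space R n)"
  shows "mod_span R (right_space R n) (set gs) = lincomb R n gs ` carrier (right_space R (length gs))"
    (is "_ = ?L")
proof
  have "g \<in> ?L" if g: "g \<in> set gs" for g
  proof -
    obtain i where "i < length gs" "g = gs ! i"
      using g by (auto simp: in_set_conv_nth)
    then show ?thesis
      using lincomb_std_unit[OF assms, of i] std_unit_closed
      by (intro image_eqI[of _ _ "std_unit R (length gs) i"]) auto
  qed
  then show "mod_span R (right_space R n) (set gs) \<subseteq> ?L"
    using submodule_range_lincomb[OF assms] unfolding mod_span_def by blast
  show "?L \<subseteq> mod_span R (right_space R n) (set gs)"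
    unfolding mod_span_def using lincomb_in_submodule by blast
qed

lemma append_right_space_iff:
  assumes "dim_vec a = m" "dim_vec b = k"
  shows "a @\<^sub>v b \<in> carrier (right_space R (m + k)) \<longleftrightarrow>
    a \<in> carrier (right_space R m) \<and> b \<in> carrier (right_space R k)"
proof
  assume ab: "a @\<^sub>v b \<in> carrier (right_space R (m + k))"
  have "a $ i \<in> carrier R" if "i < m" for i
    using ab that assms by (auto simp: mem_right_space_iff dest!: spec[of _ i])
  moreover have "b $ i \<in> carrier R" if "i < k" for i
    using ab that assms by (auto simp: mem_right_space_iff dest!: spec[of _ "m + i"])
  ultimately show "a \<in> carrier (right_space R m) \<and> b \<in> carrier (right_space R k)"
    using assms by (simp add: mem_right_space_iff)
next
  assume "a \<in> carrier (right_space R m) \<and> b \<in> carrier (right_space R k)"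
  then show "a @\<^sub>v b \<in> carrier (right_space R (m + k))"
    by (auto simp: mem_right_space_iff)
qed

lemma lincomb_append:
  assumes gs: "set gs \<subseteq> carrier (right_space R n)" and hs: "set hs \<subseteq> carrier (right_space R n)"
    and a: "a \<in> carrier (right_space R (length gs))" and b: "b \<in> carrier (right_space R (length hs))"
  shows "lincomb R n (gs @ hs) (a @\<^sub>v b) = lincomb R n gs a \<oplus>\<^bsub>right_space R n\<^esub> lincomb R n hs b"
proof (rule eq_vecI)
  fix j assume "j < dim_vec (lincomb R n gs a \<oplus>\<^bsub>right_space R n\<^esub> lincomb R n hs b)"
  then have j: "j < n"
    by simp
  let ?m = "length gs" and ?k = "length hs"
  have g: "gs ! i $ j \<in> carrier R" "a $ i \<in> carrier R" if "i < ?m" for i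
    using that a j nth_in_right_space(3)[OF gs] by (simp_all add: mem_right_space_iff)
  have h: "hs ! i $ j \<in> carrier R" "b $ i \<in> carrier R" if "i < ?k" for i
    using that b j nth_in_right_space(3)[OF hs] by (simp_all add: mem_right_space_iff)
  have dims: "dim_vec a = ?m" "dim_vec b = ?k"
    using a b by (auto simp: mem_right_space_iff)
  let ?f = "\<lambda>i. (gs @ hs) ! i $ j \<otimes> (a @\<^sub>v b) $ i"
  have split: "{..<?m + ?k} = {..<?m} \<union> (\<lambda>i. i + ?m) ` {..<?k}"
  proof (intro equalityI subsetI)
    fix i assume i: "i \<in> {..<?m + ?k}"
    show "i \<in> {..<?m} \<union> (\<lambda>i. i + ?m) ` {..<?k}"
    proof (cases "i < ?m")
      case False
      then show ?thesis
        using i by (intro UnI2 image_eqI[of _ _ "i - ?m"]) auto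
    qed simp
  qed auto
  have "(\<Oplus>i\<in>{..<?m + ?k}. ?f i) = (\<Oplus>i\<in>{..<?m}. ?f i) \<oplus> (\<Oplus>i\<in>(\<lambda>i. i + ?m) ` {..<?k}. ?f i)"
    unfolding split using g h dims by (intro finsum_Un_disjoint) (auto simp: nth_append)
  also have "(\<Oplus>i\<in>(\<lambda>i. i + ?m) ` {..<?k}. ?f i) = (\<Oplus>i\<in>{..<?k}. ?f (i + ?m))"
    using h dims by (intro finsum_reindex) (auto simp: nth_append)
  also have "\<dots> = (\<Oplus>i\<in>{..<?k}. hs ! i $ j \<otimes> b $ i)"
    using h dims by (intro finsum_cong') (auto simp: nth_append)
  also have "(\<Oplus>i\<in>{..<?m}. ?f i) = (\<Oplus>i\<in>{..<?m}. gs ! i $ j \<otimes> a $ i)"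
    using g dims by (intro finsum_cong') (auto simp: nth_append)
  finally show "lincomb R n (gs @ hs) (a @\<^sub>v b) $ j =
      (lincomb R n gs a \<oplus>\<^bsub>right_space R n\<^esub> lincomb R n hs b) $ j"
    using j by (simp add: lincomb_nth)
qed simp

lemma mem_set_add_right_space_iff:
  "x \<in> A <+>\<^bsub>right_space R n\<^esub> B \<longleftrightarrow> (\<exists>a\<in>A. \<exists>b\<in>B. x = a \<oplus>\<^bsub>right_space R n\<^esub> b)"
  unfolding set_add_def set_mult_def by simp

text \<open>The link between a block matrix and the sum of the codes spanned by its blocks: a
  coefficient vector is cut at \<open>length gs\<close>.\<close>

lemma range_lincomb_append:
  assumes gs: "set gs \<subseteq> carrier (right_space R n)" and hs: "set hs \<subseteq> carrier (right_space R n)"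
  shows "lincomb R n (gs @ hs) ` carrier (right_space R (length (gs @ hs))) =
    lincomb R n gs ` carrier (right_space R (length gs)) <+>\<^bsub>right_space R n\<^esub>
    lincomb R n hs ` carrier (right_space R (length hs))" (is "?A = ?B")
proof
  show "?A \<subseteq> ?B"
  proof (rule image_subsetI)
    fix c assume c: "c \<in> carrier (right_space R (length (gs @ hs)))"
    define a b where "a = vec_first c (length gs)" and "b = vec_last c (length hs)"
    have "c \<in> carrier_vec (length gs + length hs)"
      using c by (intro carrier_vecI) (simp add: mem_right_space_iff)
    then have ab: "c = a @\<^sub>v b"
      unfolding a_def b_def by (rule vec_first_last_append[symmetric])
    have "dim_vec a = length gs" "dim_vec b = length hs"
      by (simp_all add: a_def b_def)
    then have a: "a \<in> carrier (right_space R (length gs))" and b: "b \<in> carrier (right_space R (length hs))"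
      using append_right_space_iff[of a "length gs" b "length hs"] c[unfolded ab] by simp_all
    show "lincomb R n (gs @ hs) c \<in> ?B"
      unfolding ab lincomb_append[OF gs hs a b] mem_set_add_right_space_iff
      using a b by blast
  qed
  show "?B \<subseteq> ?A"
  proof
    fix x assume "x \<in> ?B"
    then obtain a b where a: "a \<in> carrier (right_space R (length gs))"
      and b: "b \<in> carrier (right_space R (length hs))"
      and x: "x = lincomb R n gs a \<oplus>\<^bsub>right_space R n\<^esub> lincomb R n hs b"
      unfolding mem_set_add_right_space_iff by blast
    have "a @\<^sub>v b \<in> carrier (right_space R (length (gs @ hs)))"
      using append_right_space_iff[of a "length gs" b "length hs"] a b
      by (simp add: mem_right_space_iff)
    then show "x \<in> ?A"
      unfolding x lincomb_append[OF gs hs a b, symmetric] by (rule imageI)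
  qed
qed

end

lemma elements_matD:
  "elements_mat A \<subseteq> S \<Longrightarrow> i < dim_row A \<Longrightarrow> j < dim_col A \<Longrightarrow> A $$ (i, j) \<in> S"
  using elements_matI[of A "dim_row A" "dim_col A" i j] by auto

lemma (in ring) mod_Hom_minus:
  assumes f: "f \<in> mod_Hom R (right_space R m) (right_space R n)"
    and a: "a \<in> carrier (right_space R m)" and b: "b \<in> carrier (right_space R m)"
  shows "f (vec m (\<lambda>i. a $ i \<ominus> b $ i)) = vec n (\<lambda>i. f a $ i \<ominus> f b $ i)"
proof -
  have fc: "f a \<in> carrier (right_space R n)" "f b \<in> carrier (right_space R n)"
    using f a b by (auto simp: mod_Hom_def)
  have minus: "vec k (\<lambda>i. x $ i \<ominus> y $ i) = x \<oplus>\<^bsub>right_space R k\<^esub> (\<ominus> \<one>) \<odot>\<^bsub>right_space R k\<^esub> y"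
    if "x \<in> carrier (right_space R k)" "y \<in> carrier (right_space R k)" for x y k
    using that by (intro eq_vecI) (auto simp: mem_right_space_iff a_minus_def r_minus)
  have "(\<ominus> \<one>) \<odot>\<^bsub>right_space R m\<^esub> b \<in> carrier (right_space R m)"
    using b by (simp add: mem_right_space_iff)
  then show ?thesis
    unfolding minus[OF a b] minus[OF fc] using f a b
    by (simp add: mod_Hom_def del: right_space_simps)
qed

lemma (in ring) minus_eq_zero_vec_iff:
  assumes "a \<in> carrier (right_space R m)" and "b \<in> carrier (right_space R m)"
  shows "vec m (\<lambda>i. a $ i \<ominus> b $ i) = \<zero>\<^bsub>right_space R m\<^esub> \<longleftrightarrow> a = b"
proof
  assume eq: "vec m (\<lambda>i. a $ i \<ominus> b $ i) = \<zero>\<^bsub>right_space R m\<^esub>"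
  have "a $ i = b $ i" if "i < m" for i
    using arg_cong[OF eq, of "\<lambda>v. v $ i"] that assms by (simp add: mem_right_space_iff r_right_minus_eq)
  then show "a = b"
    using assms by (intro eq_vecI) (auto simp: mem_right_space_iff)
qed (use assms in \<open>auto simp: mem_right_space_iff r_right_minus_eq intro!: eq_vecI\<close>)

lemma (in ring) inj_on_mod_HomI:
  assumes f: "f \<in> mod_Hom R (right_space R m) (right_space R n)"
    and kernel: "\<And>a. a \<in> carrier (right_space R m) \<Longrightarrow> f a = \<zero>\<^bsub>right_space R n\<^esub> \<Longrightarrow> a = \<zero>\<^bsub>right_space R m\<^esub>"
  shows "inj_on f (carrier (right_space R m))"
proof (rule inj_onI)
  fix a b assume a: "a \<in> carrier (right_space R m)" and b: "b \<in> carrier (right_space R m)" and eq: "f a = f b"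
  have "f a \<in> carrier (right_space R n)"
    using f a by (auto simp: mod_Hom_def)
  then have "f (vec m (\<lambda>i. a $ i \<ominus> b $ i)) = \<zero>\<^bsub>right_space R n\<^esub>"
    using mod_Hom_minus[OF f a b] eq minus_eq_zero_vec_iff[of "f a" n "f b"] by simp
  then have "vec m (\<lambda>i. a $ i \<ominus> b $ i) = \<zero>\<^bsub>right_space R m\<^esub>"
    using a b by (intro kernel) (simp_all add: mem_right_space_iff)
  then show "a = b"
    using minus_eq_zero_vec_iff[OF a b] by simp
qed

lemma (in ring) mod_Hom_zero:
  assumes f: "f \<in> mod_Hom R (right_space R m) (right_space R n)"
  shows "f (\<zero>\<^bsub>right_space R m\<^esub>) = \<zero>\<^bsub>right_space R n\<^esub>"
proof -
  have z: "\<zero>\<^bsub>right_space R m\<^esub> \<in> carrier (right_space R m)"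
    by (simp add: mem_right_space_iff)
  then have fz: "f (\<zero>\<^bsub>right_space R m\<^esub>) \<in> carrier (right_space R n)"
    using f by (auto simp: mod_Hom_def)
  have "vec m (\<lambda>i. \<zero>\<^bsub>right_space R m\<^esub> $ i \<ominus> \<zero>\<^bsub>right_space R m\<^esub> $ i) = \<zero>\<^bsub>right_space R m\<^esub>"
    using minus_eq_zero_vec_iff[OF z z] by blast
  then show ?thesis
    using mod_Hom_minus[OF f z z] minus_eq_zero_vec_iff[OF fz fz] by simp
qed

section \<open>Finite rings: counting, one-sided inverses and matrices\<close>

context finite_ring
begin

lemma finite_ring_opposite_ring: "finite_ring (opposite_ring R)"
  by (rule finite_ring.intro) (simp_all add: ring_opposite_ring finite_ring_axioms_def finite_carrier)

lemma bij_betw_right_space: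
  "bij_betw (\<lambda>v. \<lambda>i\<in>{..<n}. v $ i) (carrier (right_space R n)) ({..<n} \<rightarrow>\<^sub>E carrier R)"
proof (rule bij_betw_byWitness[where f' = "vec n"])
  show "\<forall>v\<in>carrier (right_space R n). vec n (\<lambda>i\<in>{..<n}. v $ i) = v"
    by (auto simp: mem_right_space_iff intro!: eq_vecI)
  show "\<forall>f\<in>{..<n} \<rightarrow>\<^sub>E carrier R. (\<lambda>i\<in>{..<n}. vec n f $ i) = f"
  proof
    fix f assume f: "f \<in> {..<n} \<rightarrow>\<^sub>E carrier R"
    show "(\<lambda>i\<in>{..<n}. vec n f $ i) = f"
    proof
      fix i show "(\<lambda>i\<in>{..<n}. vec n f $ i) i = f i"
        using PiE_arb[OF f, of i] by (cases "i < n") simp_all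
    qed
  qed
  show "(\<lambda>v. \<lambda>i\<in>{..<n}. v $ i) ` carrier (right_space R n) \<subseteq> {..<n} \<rightarrow>\<^sub>E carrier R"
    by (rule image_subsetI) (simp add: mem_right_space_iff)
  show "vec n ` ({..<n} \<rightarrow>\<^sub>E carrier R) \<subseteq> carrier (right_space R n)"
    by (rule image_subsetI) (auto simp: mem_right_space_iff dest: PiE_mem)
qed

lemma finite_right_space: "finite (carrier (right_space R n))"
proof -
  have "finite ({..<n} \<rightarrow>\<^sub>E carrier R)"
    by (intro finite_PiE) (simp_all add: finite_carrier)
  then show ?thesis
    using bij_betw_finite[OF bij_betw_right_space[of n]] by simp
qed

lemma card_right_space: "card (carrier (right_space R n)) = card (carrier R) ^ n"
  using bij_betw_same_card[OF bij_betw_right_space[of n]] by (simp add: card_PiE)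

text \<open>Left multiplication by \<open>y\<close> is injective because \<open>x\<close> undoes it,
  so by finiteness it is onto; \<open>y\<close> then has a right inverse, which must be
  \<open>x\<close>.\<close>

lemma right_invertible_imp_Units:
  assumes x: "x \<in> carrier R" and y: "y \<in> carrier R" and xy: "x \<otimes> y = \<one>"
  shows "x \<in> Units R"
proof -
  have "inj_on (\<lambda>z. y \<otimes> z) (carrier R)"
  proof (rule inj_onI)
    fix z w assume zw: "z \<in> carrier R" "w \<in> carrier R" "y \<otimes> z = y \<otimes> w"
    then have "x \<otimes> y \<otimes> z = x \<otimes> y \<otimes> w"
      using x y by (simp add: m_assoc)
    then show "z = w"
      using zw by (simp add: xy)
  qed
  then have "(\<lambda>z. y \<otimes> z) ` carrier R = carrier R"
    using y by (intro endo_inj_surj finite_carrier) auto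
  then obtain z where z: "z \<in> carrier R" "y \<otimes> z = \<one>"
    by (metis imageE one_closed)
  have "x = x \<otimes> (y \<otimes> z)"
    using x z by simp
  also have "\<dots> = x \<otimes> y \<otimes> z"
    using x y z(1) by (simp only: m_assoc)
  also have "\<dots> = z"
    using z(1) by (simp add: xy)
  finally show ?thesis
    using x y xy z by (auto simp: Units_def)
qed

text \<open>Addition maps \<open>C \<times> D\<close> to a set of the same finite size, so it is
  onto exactly when it is injective, and what it identifies is measured by
  \<open>C \<inter> D\<close>.\<close>

lemma set_add_eq_iff_Int_eq:
  assumes C: "submodule C R (right_space R n)" and D: "submodule D R (right_space R n)"
    and card: "card C * card D = card (carrier (right_space R n))"
  shows "C <+>\<^bsub>right_space R n\<^esub> D = carrier (right_space R n) \<longleftrightarrow>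
    C \<inter> D = {\<zero>\<^bsub>right_space R n\<^esub>}"
proof -
  interpret M: abelian_group "right_space R n"
    by (rule abelian_group_right_space)
  have Cc: "C \<subseteq> carrier (right_space R n)" and Dc: "D \<subseteq> carrier (right_space R n)"
    and C0: "\<zero>\<^bsub>right_space R n\<^esub> \<in> C" and D0: "\<zero>\<^bsub>right_space R n\<^esub> \<in> D"
    using C D unfolding submodule_right_space_iff by blast+
  have add: "x \<oplus>\<^bsub>right_space R n\<^esub> y \<in> E" and neg: "\<ominus>\<^bsub>right_space R n\<^esub> x \<in> E"
    if "submodule E R (right_space R n)" "x \<in> E" "y \<in> E" for E x y
  proof -
    show "x \<oplus>\<^bsub>right_space R n\<^esub> y \<in> E"
      using that unfolding submodule_right_space_iff by blast
    have "x \<in> carrier (right_space R n)"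
      using that unfolding submodule_right_space_iff by blast
    from a_inv_right_space[OF this] show "\<ominus>\<^bsub>right_space R n\<^esub> x \<in> E"
      using that a_inv_closed[OF one_closed] unfolding submodule_right_space_iff
      by (simp del: right_space_simps)
  qed
  define s where "s = (\<lambda>(c, d). c \<oplus>\<^bsub>right_space R n\<^esub> d)"
  have sum: "C <+>\<^bsub>right_space R n\<^esub> D = s ` (C \<times> D)"
  proof (rule Set.set_eqI)
    fix x show "x \<in> C <+>\<^bsub>right_space R n\<^esub> D \<longleftrightarrow> x \<in> s ` (C \<times> D)"
      unfolding mem_set_add_right_space_iff s_def by (simp add: image_iff del: right_space_simps)
  qed
  have fin: "finite (C \<times> D)"
    using finite_subset[OF Cc finite_right_space] finite_subset[OF Dc finite_right_space] by simp
  have sub: "s ` (C \<times> D) \<subseteq> carrier (right_space R n)"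
  proof clarify
    fix c d assume "c \<in> C" "d \<in> D"
    then have "c \<in> carrier (right_space R n)" "d \<in> carrier (right_space R n)"
      using Cc Dc by auto
    then show "s (c, d) \<in> carrier (right_space R n)"
      unfolding s_def split by (rule M.a_closed)
  qed
  have "s ` (C \<times> D) = carrier (right_space R n) \<longleftrightarrow> inj_on s (C \<times> D)"
  proof
    assume "s ` (C \<times> D) = carrier (right_space R n)"
    then show "inj_on s (C \<times> D)"
      using fin card by (intro eq_card_imp_inj_on) (simp_all add: card_cartesian_product)
  next
    assume "inj_on s (C \<times> D)"
    then show "s ` (C \<times> D) = carrier (right_space R n)"
      using sub card by (intro card_subset_eq finite_right_space) (simp_all add: card_image card_cartesian_product)
  qed
  also have "\<dots> \<longleftrightarrow> C \<inter> D = {\<zero>\<^bsub>right_space R n\<^esub>}"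
  proof
    assume inj: "inj_on s (C \<times> D)"
    have "x = \<zero>\<^bsub>right_space R n\<^esub>" if x: "x \<in> C" "x \<in> D" for x
    proof -
      have xc: "x \<in> carrier (right_space R n)"
        using x Cc by auto
      have "s (x, \<ominus>\<^bsub>right_space R n\<^esub> x) = s (\<zero>\<^bsub>right_space R n\<^esub>, \<zero>\<^bsub>right_space R n\<^esub>)"
        unfolding s_def split M.r_neg[OF xc] M.r_zero[OF M.zero_closed] ..
      moreover have "(x, \<ominus>\<^bsub>right_space R n\<^esub> x) \<in> C \<times> D" "(\<zero>\<^bsub>right_space R n\<^esub>, \<zero>\<^bsub>right_space R n\<^esub>) \<in> C \<times> D"
        using x neg[OF D] C0 D0 by blast+
      ultimately have "(x, \<ominus>\<^bsub>right_space R n\<^esub> x) = (\<zero>\<^bsub>right_space R n\<^esub>, \<zero>\<^bsub>right_space R n\<^esub>)"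
        by (rule inj_onD[OF inj])
      then show ?thesis
        by blast
    qed
    then show "C \<inter> D = {\<zero>\<^bsub>right_space R n\<^esub>}"
      using C0 D0 by blast
  next
    assume Int: "C \<inter> D = {\<zero>\<^bsub>right_space R n\<^esub>}"
    show "inj_on s (C \<times> D)"
    proof (rule inj_onI, clarify)
      fix c d c' d' assume m: "c \<in> C" "d \<in> D" "c' \<in> C" "d' \<in> D" and eq: "s (c, d) = s (c', d')"
      have mc: "c \<in> carrier (right_space R n)" "d \<in> carrier (right_space R n)"
        "c' \<in> carrier (right_space R n)" "d' \<in> carrier (right_space R n)"
        using m Cc Dc by auto
      have eq': "c \<oplus>\<^bsub>right_space R n\<^esub> d = c' \<oplus>\<^bsub>right_space R n\<^esub> d'"
        using eq by (simp only: s_def split)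
      \<comment> \<open>The left side lies in \<open>C\<close> and the right side in
        \<open>D\<close>, so both vanish.\<close>
      have e: "c \<oplus>\<^bsub>right_space R n\<^esub> \<ominus>\<^bsub>right_space R n\<^esub> c' = d' \<oplus>\<^bsub>right_space R n\<^esub> \<ominus>\<^bsub>right_space R n\<^esub> d"
      proof -
        have "c \<oplus>\<^bsub>right_space R n\<^esub> \<ominus>\<^bsub>right_space R n\<^esub> c' =
            (c \<oplus>\<^bsub>right_space R n\<^esub> d) \<oplus>\<^bsub>right_space R n\<^esub> (\<ominus>\<^bsub>right_space R n\<^esub> d \<oplus>\<^bsub>right_space R n\<^esub> \<ominus>\<^bsub>right_space R n\<^esub> c')"
          using mc by (simp only: M.a_assoc M.r_neg2 M.a_inv_closed M.a_closed)
        also have "\<dots> = d' \<oplus>\<^bsub>right_space R n\<^esub> \<ominus>\<^bsub>right_space R n\<^esub> d"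
          unfolding eq' M.a_comm[OF mc(3,4)] M.a_comm[OF M.a_inv_closed[OF mc(2)] M.a_inv_closed[OF mc(3)]]
          using mc by (simp only: M.a_assoc M.r_neg2 M.a_inv_closed M.a_closed)
        finally show ?thesis .
      qed
      have inC: "c \<oplus>\<^bsub>right_space R n\<^esub> \<ominus>\<^bsub>right_space R n\<^esub> c' \<in> C"
        using add[OF C m(1) neg[OF C m(3) m(3)]] .
      have inD: "d' \<oplus>\<^bsub>right_space R n\<^esub> \<ominus>\<^bsub>right_space R n\<^esub> d \<in> D"
        using add[OF D m(4) neg[OF D m(2) m(2)]] .
      have "d' \<oplus>\<^bsub>right_space R n\<^esub> \<ominus>\<^bsub>right_space R n\<^esub> d \<in> C \<inter> D"
        using inC[unfolded e] inD by (rule IntI)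
      then have z: "d' \<oplus>\<^bsub>right_space R n\<^esub> \<ominus>\<^bsub>right_space R n\<^esub> d = \<zero>\<^bsub>right_space R n\<^esub>"
        unfolding Int by (rule singletonD)
      have eqI: "x = y" if "x \<oplus>\<^bsub>right_space R n\<^esub> \<ominus>\<^bsub>right_space R n\<^esub> y = \<zero>\<^bsub>right_space R n\<^esub>"
        "x \<in> carrier (right_space R n)" "y \<in> carrier (right_space R n)" for x y
        using M.minus_equality[OF that(1) M.a_inv_closed[OF that(3)] that(2)] M.minus_minus[OF that(3)] by (rule trans[OF sym])
      show "c = c' \<and> d = d'"
        using eqI[OF e[unfolded z] mc(1,3)] eqI[OF z mc(4,2)] by (intro conjI) (assumption, rule sym)
    qed
  qed
  finally show ?thesis
    unfolding sum .
qed

text \<open>A row of \<open>BA\<close> combines the rows of \<open>A\<close> with coefficients from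
  \<open>B\<close> standing on the left; this is where the opposite ring enters the matrix
  computations.\<close>

lemma rows_ring_mat_mult:
  assumes "dim_col B = dim_row A" and "elements_mat A \<subseteq> carrier R" and "elements_mat B \<subseteq> carrier R"
  shows "rows (ring_mat_mult R B A) = map (lincomb (opposite_ring R) (dim_col A) (rows A)) (rows B)"
proof (rule nth_equalityI)
  fix i assume "i < length (rows (ring_mat_mult R B A))"
  then have i: "i < dim_row B"
    by (simp add: ring_mat_mult_def)
  have el: "A $$ (k, j) \<in> carrier R" "B $$ (i, k) \<in> carrier R" if "k < dim_row A" "j < dim_col A" for k j
    using that i assms by (auto intro: elements_matD)
  show "rows (ring_mat_mult R B A) ! i = map (lincomb (opposite_ring R) (dim_col A) (rows A)) (rows B) ! i"
  proof (rule eq_vecI)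
    fix j assume "j < dim_vec (map (lincomb (opposite_ring R) (dim_col A) (rows A)) (rows B) ! i)"
    then have j: "j < dim_col A"
      using i by simp
    have "(\<Oplus>k\<in>{..<dim_row A}. B $$ (i, k) \<otimes> A $$ (k, j)) =
        (\<Oplus>k\<in>{..<dim_row A}. row B i $ k \<otimes> rows A ! k $ j)"
      using el i j assms(1) by (intro finsum_cong') auto
    then show "rows (ring_mat_mult R B A) ! i $ j =
        map (lincomb (opposite_ring R) (dim_col A) (rows A)) (rows B) ! i $ j"
      using i j assms(1) by (simp add: ring_mat_mult_def lincomb_nth)
  qed (use i in \<open>simp add: ring_mat_mult_def\<close>)
qed (simp add: ring_mat_mult_def)

lemma rows_ring_one_mat: "rows (ring_one_mat R m) = map (std_unit R m) [0..<m]"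
  by (rule nth_equalityI) (auto simp: ring_one_mat_def std_unit_def intro!: eq_vecI)

lemma mat_eq_iff_rows_eq:
  assumes "dim_col A = dim_col B"
  shows "A = B \<longleftrightarrow> rows A = rows B"
  using assms by (metis carrier_mat_triv mat_of_rows_rows)

text \<open>A matrix acts on row vectors from the right, so its row space is taken with scalars on the
  left, that is, over the opposite ring. On a finite ring a surjective endomorphism is injective,
  which turns a left inverse into a two-sided one.\<close>

lemma ring_invertible_mat_iff:
  assumes A: "A \<in> carrier_mat m m" and el: "elements_mat A \<subseteq> carrier R"
  shows "ring_invertible_mat R A \<longleftrightarrow>
    lincomb (opposite_ring R) m (rows A) ` carrier (right_space R m) = carrier (right_space R m)"
proof -
  interpret opp: finite_ring "opposite_ring R"
    by (rule finite_ring_opposite_ring)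
  have unit: "std_unit (opposite_ring R) m = std_unit R m" for m
    by (intro ext) (simp only: std_unit_def opposite_ring_simps)
  have dim: "dim_row A = m" "dim_col A = m" "length (rows A) = m"
    using A by auto
  have rows_sub: "set (rows B) \<subseteq> carrier (right_space R k)"
    if "elements_mat B \<subseteq> carrier R" "dim_col B = k" for B k
    using that by (auto simp: rows_def mem_right_space_iff intro: elements_matD)
  have rA: "set (rows A) \<subseteq> carrier (right_space (opposite_ring R) m)"
    using rows_sub[OF el dim(2)] by simp
  let ?f = "lincomb (opposite_ring R) m (rows A)"
  have fc: "?f v \<in> carrier (right_space R m)" if "v \<in> carrier (right_space R m)" for v
    using opp.lincomb_closed[OF rA] that dim by simp
  show ?thesis
  proof
    assume "ring_invertible_mat R A"
    then obtain B where B: "B \<in> carrier_mat m m" "elements_mat B \<subseteq> carrier R"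
      and BA: "ring_mat_mult R B A = ring_one_mat R m"
      using dim by (auto simp: ring_invertible_mat_def)
    have rB: "set (rows B) \<subseteq> carrier (right_space (opposite_ring R) (length (rows A)))"
      using rows_sub[OF B(2)] B(1) dim by simp
    have "v \<in> ?f ` carrier (right_space R m)" if v: "v \<in> carrier (right_space R m)" for v
    proof -
      have "?f (lincomb (opposite_ring R) m (rows B) v) =
          lincomb (opposite_ring R) m (map ?f (rows B)) v"
        using opp.lincomb_lincomb[OF rA rB, of v] v B(1) dim by simp
      also have "map ?f (rows B) = map (std_unit (opposite_ring R) m) [0..<m]"
        using rows_ring_mat_mult[of B A] BA B el dim rows_ring_one_mat[of m] unit by simp
      also have "lincomb (opposite_ring R) m (map (std_unit (opposite_ring R) m) [0..<m]) v = v"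
        using opp.lincomb_std_units[of v m] v by simp
      finally have "v = ?f (lincomb (opposite_ring R) m (rows B) v)"
        by simp
      moreover have "lincomb (opposite_ring R) m (rows B) v \<in> carrier (right_space R m)"
        using opp.lincomb_closed[of "rows B" m v] rB v B(1) dim by simp
      ultimately show ?thesis
        by (rule image_eqI)
    qed
    then show "?f ` carrier (right_space R m) = carrier (right_space R m)"
      using fc by blast
  next
    assume surj: "?f ` carrier (right_space R m) = carrier (right_space R m)"
    then have inj: "inj_on ?f (carrier (right_space R m))"
      by (intro eq_card_imp_inj_on finite_right_space) simp
    \<comment> \<open>Preimages of the standard units are the rows of a left inverse.\<close>
    have "\<exists>b\<in>carrier (right_space R m). ?f b = std_unit R m i" for i
      using surj std_unit_closed[of m i] by (metis imageE)
    then obtain b where b: "\<And>i. b i \<in> carrier (right_space R m)" "\<And>i. ?f (b i) = std_unit R m i"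
      by metis
    define B where "B = mat_of_rows m (map b [0..<m])"
    have bdim: "b i \<in> carrier_vec m" for i
      using b(1)[of i] by (intro carrier_vecI) (simp add: mem_right_space_iff)
    have B: "B \<in> carrier_mat m m"
      by (simp add: B_def mat_of_rows_def)
    have rB: "rows B = map b [0..<m]"
      unfolding B_def using bdim by (intro rows_mat_of_rows) auto
    have elB: "elements_mat B \<subseteq> carrier R"
      using b(1) by (auto simp: B_def elements_mat_def mat_of_rows_index mem_right_space_iff)
    have one_dim: "dim_col (ring_one_mat R m) = m"
      by (simp add: ring_one_mat_def)
    have BA: "ring_mat_mult R B A = ring_one_mat R m"
    proof (subst mat_eq_iff_rows_eq)
      show "rows (ring_mat_mult R B A) = rows (ring_one_mat R m)"
        using rows_ring_mat_mult[of B A] B el elB dim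
        by (simp add: rows_ring_one_mat rB b(2))
    qed (simp add: ring_mat_mult_def one_dim dim)
    \<comment> \<open>The map \<open>?f\<close> is right multiplication by \<open>A\<close>. It
      sends row \<open>i\<close> of \<open>AB\<close> to row \<open>i\<close> of \<open>ABA\<close>,
      which is row \<open>i\<close> of \<open>A\<close> because \<open>BA\<close> is the identity,
      and it sends the \<open>i\<close>-th standard unit there as well; injectivity
      finishes.\<close>
    have AB: "ring_mat_mult R A B = ring_one_mat R m"
    proof (subst mat_eq_iff_rows_eq)
      have rBc: "set (rows B) \<subseteq> carrier (right_space (opposite_ring R) m)"
        using b(1) by (auto simp: rB)
      have "lincomb (opposite_ring R) m (rows B) (rows A ! i) = std_unit R m i" if i: "i < m" for i
      proof (rule inj_onD[OF inj])
        have ri: "rows A ! i \<in> carrier (right_space R m)"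
          using nth_in_right_space(1)[OF rA] i dim by simp
        have "?f (lincomb (opposite_ring R) m (rows B) (rows A ! i)) =
            lincomb (opposite_ring R) m (map (std_unit (opposite_ring R) m) [0..<m]) (rows A ! i)"
          using opp.lincomb_lincomb[OF rA, of "rows B" "rows A ! i"] rBc ri dim
          by (simp add: rB b(2) unit comp_def)
        also have "\<dots> = rows A ! i"
          using opp.lincomb_std_units ri by simp
        also have "\<dots> = ?f (std_unit R m i)"
          using opp.lincomb_std_unit[OF rA, of i] i dim by (simp add: unit)
        finally show "?f (lincomb (opposite_ring R) m (rows B) (rows A ! i)) = ?f (std_unit R m i)" .
        show "lincomb (opposite_ring R) m (rows B) (rows A ! i) \<in> carrier (right_space R m)"
          using opp.lincomb_closed[OF rBc, of "rows A ! i"] ri B by simp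
      qed (rule std_unit_closed)
      then show "rows (ring_mat_mult R A B) = rows (ring_one_mat R m)"
        using rows_ring_mat_mult[of A B] B el elB dim
        by (intro nth_equalityI) (simp_all add: rows_ring_one_mat)
    qed (use B in \<open>simp add: ring_mat_mult_def one_dim\<close>)
    show "ring_invertible_mat R A"
      unfolding ring_invertible_mat_def using B elB BA AB el dim by auto
  qed
qed

end

section \<open>Bases over a finite division ring\<close>

context finite_division_ring
begin

text \<open>In a relation involving \<open>x\<close>, a nonzero coefficient of \<open>x\<close>
  could be inverted, and \<open>x\<close> would lie in the span of \<open>gs\<close>.\<close>

lemma inj_on_lincomb_snoc:
  assumes gs: "set gs \<subseteq> carrier (right_space R n)" and x: "x \<in> carrier (right_space R n)"
    and inj: "inj_on (lincomb R n gs) (carrier (right_space R (length gs)))"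
    and notin: "x \<notin> lincomb R n gs ` carrier (right_space R (length gs))"
  shows "inj_on (lincomb R n (gs @ [x])) (carrier (right_space R (length (gs @ [x]))))"
proof (rule inj_on_mod_HomI)
  let ?m = "length gs"
  have gx: "set (gs @ [x]) \<subseteq> carrier (right_space R n)"
    using gs x by simp
  show "lincomb R n (gs @ [x]) \<in> mod_Hom R (right_space R (length (gs @ [x]))) (right_space R n)"
    by (rule lincomb_mod_Hom[OF gx])
  fix c assume c: "c \<in> carrier (right_space R (length (gs @ [x])))"
    and zero: "lincomb R n (gs @ [x]) c = \<zero>\<^bsub>right_space R n\<^esub>"
  define a where "a = vec_first c ?m"
  define r where "r = c $ ?m"
  have a: "a \<in> carrier (right_space R ?m)" and r: "r \<in> carrier R"
    using c by (auto simp: a_def r_def mem_right_space_iff vec_first_def)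
  have cr: "c = a @\<^sub>v vec 1 (\<lambda>_. r)"
    using c by (intro eq_vecI) (auto simp: a_def r_def mem_right_space_iff vec_first_def less_Suc_eq)
  have rv: "vec 1 (\<lambda>_. r) \<in> carrier (right_space R (length [x]))"
    using r by (simp add: mem_right_space_iff)
  have "lincomb R n [x] (vec 1 (\<lambda>_. r)) = r \<odot>\<^bsub>right_space R n\<^esub> x"
    using x r by (intro eq_vecI) (auto simp: lincomb_nth mem_right_space_iff lessThan_Suc)
  then have sum: "lincomb R n gs a \<oplus>\<^bsub>right_space R n\<^esub> (r \<odot>\<^bsub>right_space R n\<^esub> x) = \<zero>\<^bsub>right_space R n\<^esub>"
    using lincomb_append[OF gs _ a rv] x zero[unfolded cr] by simp
  have la: "lincomb R n gs a \<in> carrier (right_space R n)"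
    by (rule lincomb_closed[OF gs a])
  have sum_nth: "lincomb R n gs a $ j \<oplus> x $ j \<otimes> r = \<zero>" if "j < n" for j
    using arg_cong[OF sum, of "\<lambda>v. v $ j"] that by simp
  have "r = \<zero>"
  proof (rule ccontr)
    assume "r \<noteq> \<zero>"
    then have ru: "r \<in> Units R"
      using r Units_eq by simp
    have "lincomb R n gs ((\<ominus> (inv r)) \<odot>\<^bsub>right_space R ?m\<^esub> a) = (\<ominus> (inv r)) \<odot>\<^bsub>right_space R n\<^esub> lincomb R n gs a"
      using ru by (intro lincomb_smult[OF gs a]) simp
    also have "\<dots> = x"
    proof (rule eq_vecI)
      fix j assume "j < dim_vec x"
      then have j: "j < n"
        using x by (simp add: mem_right_space_iff)
      have cl: "lincomb R n gs a $ j \<in> carrier R" "x $ j \<in> carrier R"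
        using la x j by (simp_all add: mem_right_space_iff)
      have "lincomb R n gs a $ j = \<ominus> (x $ j \<otimes> r)"
        using sum_nth[OF j] cl r by (intro minus_equality[symmetric]) simp_all
      then show "((\<ominus> (inv r)) \<odot>\<^bsub>right_space R n\<^esub> lincomb R n gs a) $ j = x $ j"
        using cl r ru j by (simp add: l_minus r_minus m_assoc)
    qed (use x in \<open>simp add: mem_right_space_iff\<close>)
    finally have "x = lincomb R n gs ((\<ominus> (inv r)) \<odot>\<^bsub>right_space R ?m\<^esub> a)"
      by simp
    moreover have "(\<ominus> (inv r)) \<odot>\<^bsub>right_space R ?m\<^esub> a \<in> carrier (right_space R ?m)"
      using a ru by (simp add: mem_right_space_iff)
    ultimately show False
      using notin by blast
  qed
  have "lincomb R n gs a = \<zero>\<^bsub>right_space R n\<^esub>"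
    using sum_nth la x by (intro eq_vecI) (auto simp: \<open>r = \<zero>\<close> mem_right_space_iff)
  also have "\<dots> = lincomb R n gs (\<zero>\<^bsub>right_space R ?m\<^esub>)"
    using mod_Hom_zero[OF lincomb_mod_Hom[OF gs]] by simp
  finally have "a = \<zero>\<^bsub>right_space R ?m\<^esub>"
    using a by (rule inj_onD[OF inj]) (simp add: mem_right_space_iff)
  then show "c = \<zero>\<^bsub>right_space R (length (gs @ [x]))\<^esub>"
    unfolding cr \<open>r = \<zero>\<close> by (intro eq_vecI) auto
qed

lemma card_carrier_gt_1: "card (carrier R) > 1"
proof -
  have "card {\<zero>, \<one>} \<le> card (carrier R)"
    by (intro card_mono finite_carrier) auto
  then show ?thesis
    using one_neq_zero by simp
qed

text \<open>Independent vectors span a set of \<open>card (carrier R) ^ length gs\<close> elements.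
  Comparing with the order of the whole space shows that a full span means
  \<open>length gs = n\<close> and a proper one leaves room for another vector.\<close>

lemma extend_to_basis:
  assumes "set gs \<subseteq> carrier (right_space R n)"
    and "inj_on (lincomb R n gs) (carrier (right_space R (length gs)))"
  obtains hs where "set hs \<subseteq> carrier (right_space R n)" and "length (gs @ hs) = n"
    and "lincomb R n (gs @ hs) ` carrier (right_space R n) = carrier (right_space R n)"
proof -
  have "\<exists>hs. set hs \<subseteq> carrier (right_space R n) \<and> length (gs @ hs) = n \<and>
      lincomb R n (gs @ hs) ` carrier (right_space R n) = carrier (right_space R n)"
    using assms
  proof (induction "n - length gs" arbitrary: gs rule: less_induct)
    case less
    have card: "card (lincomb R n gs ` carrier (right_space R (length gs))) = card (carrier R) ^ length gs"
      using less.prems(2) by (simp add: card_image card_right_space)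
    have sub: "lincomb R n gs ` carrier (right_space R (length gs)) \<subseteq> carrier (right_space R n)"
      using lincomb_closed[OF less.prems(1)] by blast
    show ?case
    proof (cases "lincomb R n gs ` carrier (right_space R (length gs)) = carrier (right_space R n)")
      case True
      then have "card (carrier R) ^ length gs = card (carrier R) ^ n"
        using card by (simp add: card_right_space)
      then have "length gs = n"
        using card_carrier_gt_1 by simp
      with True show ?thesis
        by (intro exI[of _ "[]"]) simp
    next
      case False
      then obtain x where x: "x \<in> carrier (right_space R n)"
        "x \<notin> lincomb R n gs ` carrier (right_space R (length gs))"
        using sub by blast
      have "card (carrier R) ^ length gs < card (carrier R) ^ n"
        using psubset_card_mono[OF finite_right_space, of _ n] False sub card by (metis card_right_space psubsetI)
      then have "length gs < n"
        using card_carrier_gt_1 by simp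
      then have "\<exists>hs. set hs \<subseteq> carrier (right_space R n) \<and> length ((gs @ [x]) @ hs) = n \<and>
          lincomb R n ((gs @ [x]) @ hs) ` carrier (right_space R n) = carrier (right_space R n)"
        using less.prems x inj_on_lincomb_snoc[OF less.prems(1) x(1) less.prems(2) x(2)]
        by (intro less.hyps) auto
      then obtain hs where "set hs \<subseteq> carrier (right_space R n)" "length ((gs @ [x]) @ hs) = n"
        "lincomb R n ((gs @ [x]) @ hs) ` carrier (right_space R n) = carrier (right_space R n)"
        by blast
      then show ?thesis
        using x(1) by (intro exI[of _ "x # hs"]) simp
    qed
  qed
  then show thesis
    using that by blast
qed

end

section \<open>Finite local rings\<close>

locale finite_local_ring = finite_ring +
  assumes nonunits: "additive_subgroup (carrier R - Units R) R"
begin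

lemma one_neq_zero: "\<one> \<noteq> \<zero>"
  using additive_subgroup.zero_closed[OF nonunits] Units_one_closed by (metis DiffE)

text \<open>If \<open>x r\<close> were a unit, \<open>x\<close> would have a right inverse, which
  suffices in a finite ring.\<close>

lemma nonunit_mult_right:
  assumes "x \<in> carrier R - Units R" and "r \<in> carrier R"
  shows "x \<otimes> r \<in> carrier R - Units R"
proof (rule ccontr)
  assume "x \<otimes> r \<notin> carrier R - Units R"
  then have u: "x \<otimes> r \<in> Units R"
    using assms by simp
  then have "x \<otimes> (r \<otimes> inv (x \<otimes> r)) = \<one>"
    using assms by (simp add: m_assoc[symmetric])
  then show False
    using right_invertible_imp_Units[of x "r \<otimes> inv (x \<otimes> r)"] u assms by simp
qed

lemma nonunit_mult_left:
  assumes "x \<in> carrier R - Units R" and "r \<in> carrier R"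
  shows "r \<otimes> x \<in> carrier R - Units R"
proof (rule ccontr)
  assume "r \<otimes> x \<notin> carrier R - Units R"
  then have u: "r \<otimes> x \<in> Units R"
    using assms by simp
  define l where "l = inv (r \<otimes> x) \<otimes> r"
  have l: "l \<in> carrier R" and lx: "l \<otimes> x = \<one>"
    using u assms by (simp_all add: l_def m_assoc)
  then have "l \<in> Units R"
    using assms by (intro right_invertible_imp_Units[of l x]) simp_all
  then have "x = inv l \<otimes> (l \<otimes> x)"
    using l assms by (simp add: m_assoc[symmetric] del: m_assoc)
  then have "x = inv l"
    using lx \<open>l \<in> Units R\<close> by simp
  then show False
    using \<open>l \<in> Units R\<close> assms by simp
qed

lemma ideal_nonunits: "ideal (carrier R - Units R) R"
  by (intro idealI ring_axioms additive_subgroup.a_subgroup nonunits nonunit_mult_left nonunit_mult_right)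

lemma minus_nonunit:
  "x \<in> carrier R - Units R \<Longrightarrow> y \<in> carrier R - Units R \<Longrightarrow> x \<ominus> y \<in> carrier R - Units R"
  using additive_subgroup.a_closed[OF nonunits] additive_subgroup.a_inv_closed[OF nonunits]
  unfolding a_minus_def by blast

lemma subgroup_right_regular_iff:
  "subgroup I (add_monoid (right_regular R)) \<longleftrightarrow> subgroup I (add_monoid R)"
  by (simp add: subgroup_def m_inv_def right_regular_def)

text \<open>A proper right ideal contains no unit, so it lies inside the nonunits; these form a
  right ideal themselves, hence the only maximal one.\<close>

lemma jacobson_radical_eq: "jacobson_radical R = carrier R - Units R"
proof -
  have unit_mem: "I = carrier R" if I: "submodule I R (right_regular R)" and u: "u \<in> I" "u \<in> Units R" for I u
  proof
    have sub: "subgroup I (add_monoid R)"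
      using I subgroup_right_regular_iff by (simp add: submodule_def)
    then show "I \<subseteq> carrier R"
      using subgroup.subset by fastforce
    show "carrier R \<subseteq> I"
    proof
      fix r assume r: "r \<in> carrier R"
      have "(inv u \<otimes> r) \<odot>\<^bsub>right_regular R\<^esub> u \<in> I"
        using I u r by (intro submodule.smult_closed[OF I]) auto
      then show "r \<in> I"
        using u r by (simp add: right_regular_def m_assoc[symmetric] Units_closed)
    qed
  qed
  have J: "submodule (carrier R - Units R) R (right_regular R)"
    using additive_subgroup.a_subgroup[OF nonunits] nonunit_mult_right subgroup_right_regular_iff
    by (simp add: submodule_def submodule_axioms_def right_regular_def)
  have ne: "carrier R - Units R \<noteq> carrier R"
    using one_closed Units_one_closed by blast
  have sub: "I \<subseteq> carrier R - Units R" if "submodule I R (right_regular R)" "I \<noteq> carrier R" for I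
  proof -
    have "I \<subseteq> carrier R"
      using that(1) subgroup_right_regular_iff subgroup.subset[of I "add_monoid R"] by (simp add: submodule_def)
    then show ?thesis
      using unit_mem[OF that(1)] that(2) by blast
  qed
  have "maximal_submodule I R (right_regular R) \<longleftrightarrow> I = carrier R - Units R" for I
  proof
    assume "maximal_submodule I R (right_regular R)"
    then have I: "submodule I R (right_regular R)" "I \<noteq> carrier R"
      and max: "\<And>K. submodule K R (right_regular R) \<Longrightarrow> I \<subseteq> K \<Longrightarrow> K = I \<or> K = carrier R"
      unfolding maximal_submodule_def by (auto simp: right_regular_def)
    show "I = carrier R - Units R"
      using max[OF J sub[OF I]] ne by blast
  next
    assume I: "I = carrier R - Units R"
    show "maximal_submodule I R (right_regular R)"
      unfolding maximal_submodule_def I using J ne sub by (auto simp: right_regular_def)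
  qed
  then show ?thesis
    by (auto simp: jacobson_radical_def)
qed

lemma residue_ring_eq: "residue_ring_mod_J R = R Quot (carrier R - Units R)"
  by (simp add: residue_ring_mod_J_def jacobson_radical_eq)

lemma residue_map_eq: "residue_map R a = (carrier R - Units R) +> a"
  by (simp add: residue_map_def jacobson_radical_eq)

lemma carrier_residue_ring: "carrier (residue_ring_mod_J R) = residue_map R ` carrier R"
  unfolding residue_ring_eq residue_map_eq by (auto simp: FactRing_def A_RCOSETS_def')

lemma ring_residue_ring: "ring (residue_ring_mod_J R)"
  unfolding residue_ring_eq by (rule ideal.quotient_is_ring[OF ideal_nonunits])

lemma residue_map_hom: "ring_hom_ring R (residue_ring_mod_J R) (residue_map R)"
proof (rule ring_hom_ringI2)
  show "residue_map R \<in> ring_hom R (residue_ring_mod_J R)"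
    using ideal.rcos_ring_hom[OF ideal_nonunits] unfolding residue_ring_eq residue_map_eq .
qed (simp_all add: ring_axioms ring_residue_ring)

lemma residue_map_eq_iff:
  "a \<in> carrier R \<Longrightarrow> b \<in> carrier R \<Longrightarrow> residue_map R a = residue_map R b \<longleftrightarrow> a \<ominus> b \<in> carrier R - Units R"
  unfolding residue_map_eq using quotient_eq_iff_same_a_r_cos[OF ideal_nonunits] by blast

lemma residue_map_zero_iff:
  assumes "a \<in> carrier R"
  shows "residue_map R a = \<zero>\<^bsub>residue_ring_mod_J R\<^esub> \<longleftrightarrow> a \<in> carrier R - Units R"
proof -
  interpret h: ring_hom_ring R "residue_ring_mod_J R" "residue_map R"
    by (rule residue_map_hom)
  show ?thesis
    using residue_map_eq_iff[OF assms zero_closed] assms by (simp add: a_minus_def)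
qed

text \<open>A nonzero class is represented by a unit of \<open>R\<close>, whose inverse
  descends.\<close>

lemma finite_division_ring_residue_ring: "finite_division_ring (residue_ring_mod_J R)"
proof -
  interpret h: ring_hom_ring R "residue_ring_mod_J R" "residue_map R"
    by (rule residue_map_hom)
  let ?F = "residue_ring_mod_J R"
  have fin: "finite (carrier ?F)"
    unfolding carrier_residue_ring using finite_carrier by simp
  have one: "\<one>\<^bsub>?F\<^esub> \<noteq> \<zero>\<^bsub>?F\<^esub>"
    using residue_map_zero_iff[OF one_closed] by simp
  have "X \<noteq> \<zero>\<^bsub>?F\<^esub>" if "X \<in> Units ?F" for X
  proof
    assume "X = \<zero>\<^bsub>?F\<^esub>"
    with that obtain Y where "Y \<in> carrier ?F" "Y \<otimes>\<^bsub>?F\<^esub> \<zero>\<^bsub>?F\<^esub> = \<one>\<^bsub>?F\<^esub>"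
      by (auto simp: Units_def)
    with one show False
      by simp
  qed
  moreover have "X \<in> Units ?F" if X: "X \<in> carrier ?F" "X \<noteq> \<zero>\<^bsub>?F\<^esub>" for X
  proof -
    obtain a where a: "a \<in> carrier R" "X = residue_map R a"
      using X(1) unfolding carrier_residue_ring by auto
    then have u: "a \<in> Units R"
      using X(2) residue_map_zero_iff by auto
    have "residue_map R (inv a) \<otimes>\<^bsub>?F\<^esub> X = \<one>\<^bsub>?F\<^esub>" "X \<otimes>\<^bsub>?F\<^esub> residue_map R (inv a) = \<one>\<^bsub>?F\<^esub>"
      unfolding a(2) using u a(1) by (simp_all flip: h.hom_mult)
    moreover have "residue_map R (inv a) \<in> carrier ?F"
      using u by simp
    ultimately show ?thesis
      using X(1) unfolding Units_def by blast
  qed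
  ultimately have "Units ?F = carrier ?F - {\<zero>\<^bsub>?F\<^esub>}"
    by (auto simp: Units_def)
  then show ?thesis
    by (intro finite_division_ring.intro finite_ring.intro ring_residue_ring
        finite_ring_axioms.intro finite_division_ring_axioms.intro fin)
qed

text \<open>A generator of a minimal nonzero left ideal is annihilated by the nonunits.\<close>

lemma nonunits_annihilator:
  obtains s where "s \<in> carrier R" "s \<noteq> \<zero>" "\<And>x. x \<in> carrier R - Units R \<Longrightarrow> x \<otimes> s = \<zero>"
proof -
  define L where "L s = (\<lambda>r. r \<otimes> s) ` carrier R" for s
  \<comment> \<open>Every nonzero left ideal contains a nonzero principal one, so it is enough to
    minimize the size of \<open>L s\<close>, the left ideal \<open>Rs\<close>.\<close>
  define s where "s = arg_min_on (\<lambda>s. card (L s)) (carrier R - {\<zero>})"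
  have ne: "carrier R - {\<zero>} \<noteq> {}"
    using one_neq_zero by auto
  have s: "s \<in> carrier R - {\<zero>}"
    unfolding s_def using finite_carrier ne by (intro arg_min_if_finite(1)) auto
  have min: "card (L s) \<le> card (L y)" if "y \<in> carrier R - {\<zero>}" for y
    unfolding s_def using finite_carrier ne that by (intro arg_min_least) auto
  have "x \<otimes> s = \<zero>" if x: "x \<in> carrier R - Units R" for x
  proof (rule ccontr)
    assume nz: "x \<otimes> s \<noteq> \<zero>"
    have xc: "x \<in> carrier R" and sc: "s \<in> carrier R"
      using x s by auto
    have "L (x \<otimes> s) \<subseteq> L s"
      unfolding L_def
    proof (rule image_subsetI)
      fix r assume r: "r \<in> carrier R"
      then have "r \<otimes> (x \<otimes> s) = (r \<otimes> x) \<otimes> s" "r \<otimes> x \<in> carrier R"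
        using xc sc by (simp_all add: m_assoc)
      then show "r \<otimes> (x \<otimes> s) \<in> (\<lambda>r. r \<otimes> s) ` carrier R"
        by (rule image_eqI)
    qed
    moreover have "card (L s) \<le> card (L (x \<otimes> s))"
      using nz xc sc by (intro min) simp
    \<comment> \<open>Consequently \<open>s = r x s\<close> for some \<open>r\<close>, that is
      \<open>(1 - r x) s = 0\<close>.\<close>
    ultimately have "L (x \<otimes> s) = L s"
      using finite_carrier by (intro card_seteq) (auto simp: L_def)
    moreover have "s \<in> L s"
      unfolding L_def using sc by (intro image_eqI[of _ _ \<one>]) simp_all
    ultimately obtain r where r: "r \<in> carrier R" "s = r \<otimes> (x \<otimes> s)"
      unfolding L_def by auto
    have rx: "r \<otimes> x \<in> carrier R - Units R"
      using x r by (intro nonunit_mult_left)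
    \<comment> \<open>Otherwise 1 would be the sum of the nonunits \<open>1 - r x\<close> and
      \<open>r x\<close>.\<close>
    have u: "\<one> \<ominus> r \<otimes> x \<in> Units R"
    proof (rule ccontr)
      assume "\<one> \<ominus> r \<otimes> x \<notin> Units R"
      then have "\<one> \<ominus> r \<otimes> x \<in> carrier R - Units R"
        using rx by simp
      then have "(\<one> \<ominus> r \<otimes> x) \<oplus> r \<otimes> x \<in> carrier R - Units R"
        using additive_subgroup.a_closed[OF nonunits _ rx] by blast
      moreover have "(\<one> \<ominus> r \<otimes> x) \<oplus> r \<otimes> x = \<one>"
        using r xc by (simp add: a_minus_def a_assoc l_neg)
      ultimately show False
        by simp
    qed
    have "(\<one> \<ominus> r \<otimes> x) \<otimes> s = s \<ominus> r \<otimes> (x \<otimes> s)"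
      using r(1) xc sc by (simp add: a_minus_def l_distr l_minus m_assoc)
    also have "\<dots> = \<zero>"
      using r(2) sc by (simp add: r_right_minus_eq)
    finally have "inv (\<one> \<ominus> r \<otimes> x) \<otimes> ((\<one> \<ominus> r \<otimes> x) \<otimes> s) = \<zero>"
      using u by simp
    moreover have "inv (\<one> \<ominus> r \<otimes> x) \<otimes> ((\<one> \<ominus> r \<otimes> x) \<otimes> s) = s"
      using u sc Units_closed[OF u] Units_inv_closed[OF u] by (simp only: m_assoc[symmetric] Units_l_inv l_one)
    ultimately show False
      using s by simp
  qed
  with s that show thesis
    by blast
qed

lemma finite_local_ring_opposite_ring: "finite_local_ring (opposite_ring R)"
proof (intro finite_local_ring.intro finite_local_ring_axioms.intro finite_ring_opposite_ring)
  have "add_monoid (opposite_ring R) = add_monoid R"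
    by (simp add: opposite_ring_def)
  then show "additive_subgroup (carrier (opposite_ring R) - Units (opposite_ring R)) (opposite_ring R)"
    using additive_subgroup.a_subgroup[OF nonunits] by (simp add: additive_subgroup_def)
qed

lemma residue_map_opposite_ring: "residue_map (opposite_ring R) = residue_map R"
proof -
  interpret opp: finite_local_ring "opposite_ring R"
    by (rule finite_local_ring_opposite_ring)
  show ?thesis
    by (rule ext, simp only: opp.residue_map_eq residue_map_eq opposite_ring_simps Units_opposite_ring)
      (simp add: a_r_coset_def r_coset_def opposite_ring_def)
qed

text \<open>The cosets depend on addition only and remain the same sets; just the order of the
  factors in the coset product is reversed.\<close>

lemma residue_ring_opposite_ring:
  "residue_ring_mod_J (opposite_ring R) = opposite_ring (residue_ring_mod_J R)"
proof -
  interpret opp: finite_local_ring "opposite_ring R"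
    by (rule finite_local_ring_opposite_ring)
  let ?J = "carrier R - Units R"
  have coset: "?J +>\<^bsub>opposite_ring R\<^esub> x = ?J +> x" for x
    by (simp add: a_r_coset_def r_coset_def opposite_ring_def)
  have "rcoset_mult (opposite_ring R) ?J = (\<lambda>A B. rcoset_mult R ?J B A)"
    unfolding rcoset_mult_def coset by (intro ext) auto
  moreover have "set_add (opposite_ring R) = set_add R"
    by (intro ext) (simp add: set_add_def set_mult_def opposite_ring_def)
  moreover have "a_rcosets\<^bsub>opposite_ring R\<^esub> ?J = a_rcosets ?J"
    by (simp add: A_RCOSETS_def' coset)
  ultimately show ?thesis
    unfolding opp.residue_ring_eq residue_ring_eq
    by (simp add: FactRing_def opposite_ring_def[of "\<lparr>carrier = _, \<dots> = _\<rparr>"] coset)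
qed

end

section \<open>Reduction modulo the nonunits, Nakayama's lemma and relations between
  generators\<close>

context finite_local_ring
begin

abbreviation reduce :: "'a vec \<Rightarrow> 'a set vec"
  where "reduce \<equiv> map_vec (residue_map R)"

abbreviation F :: "'a set ring"
  where "F \<equiv> residue_ring_mod_J R"

lemma residue_map_closed: "a \<in> carrier R \<Longrightarrow> residue_map R a \<in> carrier F"
  unfolding carrier_residue_ring by (rule imageI)

lemma reduce_closed: "v \<in> carrier (right_space R n) \<Longrightarrow> reduce v \<in> carrier (right_space F n)"
  by (simp add: mem_right_space_iff residue_map_closed)

lemma set_map_reduce:
  "set gs \<subseteq> carrier (right_space R n) \<Longrightarrow> set (map reduce gs) \<subseteq> carrier (right_space F n)"
  using reduce_closed by auto

lemma reduce_surj:
  assumes "w \<in> carrier (right_space F n)"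
  obtains v where "v \<in> carrier (right_space R n)" and "reduce v = w"
proof -
  have "\<forall>i\<in>{..<n}. \<exists>a. a \<in> carrier R \<and> residue_map R a = w $ i"
  proof
    fix i assume "i \<in> {..<n}"
    then have "w $ i \<in> residue_map R ` carrier R"
      using assms unfolding carrier_residue_ring mem_right_space_iff by simp
    then show "\<exists>a. a \<in> carrier R \<and> residue_map R a = w $ i"
      by (elim imageE) (intro exI conjI, assumption, simp)
  qed
  from bchoice[OF this] obtain f where "\<And>i. i < n \<Longrightarrow> f i \<in> carrier R \<and> residue_map R (f i) = w $ i"
    by auto
  then show thesis
    using assms by (intro that[of "vec n f"]) (auto simp: mem_right_space_iff intro!: eq_vecI)
qed

lemma reduce_eq_iff:
  assumes "v \<in> carrier (right_space R n)" and "w \<in> carrier (right_space R n)"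
  shows "reduce v = reduce w \<longleftrightarrow> (\<forall>i<n. v $ i \<ominus> w $ i \<in> carrier R - Units R)"
proof -
  have d: "dim_vec v = n" "dim_vec w = n"
    and c: "\<And>i. i < n \<Longrightarrow> v $ i \<in> carrier R" "\<And>i. i < n \<Longrightarrow> w $ i \<in> carrier R"
    using assms by (simp_all add: mem_right_space_iff)
  have "reduce v = reduce w \<longleftrightarrow> (\<forall>i<n. residue_map R (v $ i) = residue_map R (w $ i))"
    using d by (auto simp: vec_eq_iff)
  then show ?thesis
    using residue_map_eq_iff c by simp
qed

lemma reduce_eq_zero_iff:
  assumes "v \<in> carrier (right_space R n)"
  shows "reduce v = \<zero>\<^bsub>right_space F n\<^esub> \<longleftrightarrow> (\<forall>i<n. v $ i \<in> carrier R - Units R)"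
proof -
  have d: "dim_vec v = n" and c: "\<And>i. i < n \<Longrightarrow> v $ i \<in> carrier R"
    using assms by (simp_all add: mem_right_space_iff)
  have "reduce v = \<zero>\<^bsub>right_space F n\<^esub> \<longleftrightarrow> (\<forall>i<n. residue_map R (v $ i) = \<zero>\<^bsub>F\<^esub>)"
    using d by (auto simp: vec_eq_iff)
  then show ?thesis
    using residue_map_zero_iff c by simp
qed

lemma reduce_lincomb:
  assumes gs: "set gs \<subseteq> carrier (right_space R n)" and a: "a \<in> carrier (right_space R (length gs))"
  shows "reduce (lincomb R n gs a) = lincomb F n (map reduce gs) (reduce a)"
proof (rule eq_vecI)
  interpret h: ring_hom_ring R F "residue_map R"
    by (rule residue_map_hom)
  fix j assume "j < dim_vec (lincomb F n (map reduce gs) (reduce a))"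
  then have j: "j < n"
    by simp
  have g: "gs ! i $ j \<in> carrier R" "a $ i \<in> carrier R" "dim_vec (gs ! i) = n" if "i < length gs" for i
    using that a j nth_in_right_space(2,3)[OF gs that] by (simp_all add: mem_right_space_iff)
  have da: "dim_vec a = length gs"
    using a by (simp add: mem_right_space_iff)
  have "residue_map R (\<Oplus>i\<in>{..<length gs}. gs ! i $ j \<otimes> a $ i) =
      (\<Oplus>\<^bsub>F\<^esub>i\<in>{..<length gs}. residue_map R (gs ! i $ j \<otimes> a $ i))"
    using g by (subst h.hom_finsum) (auto simp: comp_def)
  also have "\<dots> = (\<Oplus>\<^bsub>F\<^esub>i\<in>{..<length gs}. map reduce gs ! i $ j \<otimes>\<^bsub>F\<^esub> reduce a $ i)"
    using g da j by (intro h.S.finsum_cong') (auto simp: residue_map_closed)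
  finally show "reduce (lincomb R n gs a) $ j = lincomb F n (map reduce gs) (reduce a) $ j"
    using j by (simp add: lincomb_nth)
qed simp

lemma nonunit_add:
  "x \<in> carrier R - Units R \<Longrightarrow> y \<in> carrier R - Units R \<Longrightarrow> x \<oplus> y \<in> carrier R - Units R"
  by (rule additive_subgroup.a_closed[OF nonunits])

text \<open>The coordinates are corrected one at a time.\<close>

lemma nakayama:
  assumes W: "submodule W R (right_space R n)"
    and surj: "\<And>x. x \<in> carrier (right_space R n) \<Longrightarrow> \<exists>v\<in>W. reduce v = reduce x"
  shows "W = carrier (right_space R n)"
proof
  show Wc: "W \<subseteq> carrier (right_space R n)"
    using W unfolding submodule_right_space_iff by blast
  \<comment> \<open>The quantifier over \<open>x\<close> stays inside the induction, because the
    step uses the hypothesis both for \<open>x\<close> and for a standard unit.\<close>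
  have claim: "\<forall>x\<in>carrier (right_space R n). \<exists>v\<in>W. (\<forall>i<k. v $ i = x $ i) \<and> reduce v = reduce x"
    if "k \<le> n" for k
    using that
  proof (induction k)
    case 0
    then show ?case
      using surj by simp
  next
    case (Suc k)
    then have k: "k < n"
      by simp
    show ?case
    proof
      fix x assume x: "x \<in> carrier (right_space R n)"
      obtain v where v: "v \<in> W" "\<And>i. i < k \<Longrightarrow> v $ i = x $ i" "reduce v = reduce x"
        using Suc x by (meson Suc_leD)
      \<comment> \<open>\<open>u\<close> vanishes in the first \<open>k\<close> coordinates, and its
        coordinate \<open>k\<close> is congruent to 1, hence a unit.\<close>
      obtain u where u: "u \<in> W" "\<And>i. i < k \<Longrightarrow> u $ i = std_unit R n k $ i"
        "reduce u = reduce (std_unit R n k)"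
        using Suc std_unit_closed by (meson Suc_leD)
      have vc: "v \<in> carrier (right_space R n)" and uc: "u \<in> carrier (right_space R n)"
        using v(1) u(1) Wc by auto
      have vi: "v $ i \<in> carrier R" and ui: "u $ i \<in> carrier R" and xi: "x $ i \<in> carrier R"
        and vx: "v $ i \<ominus> x $ i \<in> carrier R - Units R" if "i < n" for i
        using vc uc x v(3) reduce_eq_iff[OF vc x] that by (auto simp: mem_right_space_iff)
      have uk: "u $ k \<in> Units R"
      proof (rule ccontr)
        assume "u $ k \<notin> Units R"
        then have "u $ k \<in> carrier R - Units R"
          using ui k by simp
        moreover have "u $ k \<ominus> std_unit R n k $ k \<in> carrier R - Units R"
          using iffD1[OF reduce_eq_iff[OF uc std_unit_closed] u(3)] k by blast
        then have "u $ k \<ominus> \<one> \<in> carrier R - Units R"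
          using k by (simp add: std_unit_def)
        ultimately have "u $ k \<ominus> (u $ k \<ominus> \<one>) \<in> carrier R - Units R"
          by (rule minus_nonunit)
        moreover have "u $ k \<ominus> (u $ k \<ominus> \<one>) = \<one>"
          using ui[OF k] by algebra
        ultimately show False
          by simp
      qed
      \<comment> \<open>Adding \<open>u c\<close> to \<open>v\<close> repairs coordinate
        \<open>k\<close> and leaves the earlier ones alone. As \<open>x\<close> and \<open>v\<close>
        agree modulo the nonunits, \<open>c\<close> is a nonunit, so no residue changes.\<close>
      define c where "c = inv (u $ k) \<otimes> (x $ k \<ominus> v $ k)"
      have "x $ k \<ominus> v $ k = \<ominus> (v $ k \<ominus> x $ k)"
        using xi[OF k] vi[OF k] by algebra
      then have "x $ k \<ominus> v $ k \<in> carrier R - Units R"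
        using additive_subgroup.a_inv_closed[OF nonunits vx[OF k]] by simp
      then have c: "c \<in> carrier R - Units R"
        unfolding c_def using uk by (intro nonunit_mult_left) auto
      then have cc: "c \<in> carrier R"
        by simp
      define w where "w = v \<oplus>\<^bsub>right_space R n\<^esub> (c \<odot>\<^bsub>right_space R n\<^esub> u)"
      have wW: "w \<in> W"
        unfolding w_def using W v(1) u(1) cc unfolding submodule_right_space_iff by blast
      have wi: "w $ i = v $ i \<oplus> u $ i \<otimes> c" if "i < n" for i
        using that by (simp add: w_def)
      have "w $ i = x $ i" if "i < Suc k" for i
      proof (cases "i = k")
        case True
        have "u $ k \<otimes> c = x $ k \<ominus> v $ k"
          using uk ui[OF k] xi[OF k] vi[OF k] by (simp add: c_def m_assoc[symmetric])
        then show ?thesis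
          unfolding True wi[OF k] using xi[OF k] vi[OF k] by algebra
      next
        case False
        then have "i < k"
          using that by simp
        then show ?thesis
          using u(2)[of i] v(2)[of i] xi[of i] wi[of i] cc k by (simp add: std_unit_def)
      qed
      moreover have "reduce w = reduce x"
      proof (subst reduce_eq_iff)
        show "\<forall>i<n. w $ i \<ominus> x $ i \<in> carrier R - Units R"
        proof (intro allI impI)
          fix i assume i: "i < n"
          have "w $ i \<ominus> x $ i = (v $ i \<ominus> x $ i) \<oplus> u $ i \<otimes> c"
            unfolding wi[OF i] using vi[OF i] xi[OF i] ui[OF i] cc by algebra
          then show "w $ i \<ominus> x $ i \<in> carrier R - Units R"
            using nonunit_add[OF vx[OF i] nonunit_mult_left[OF c ui[OF i]]] by simp
        qed
      qed (use wW Wc x in auto)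
      ultimately show "\<exists>v\<in>W. (\<forall>i<Suc k. v $ i = x $ i) \<and> reduce v = reduce x"
        using wW by blast
    qed
  qed
  show "carrier (right_space R n) \<subseteq> W"
  proof
    fix x assume x: "x \<in> carrier (right_space R n)"
    obtain v where v: "v \<in> W" "\<And>i. i < n \<Longrightarrow> v $ i = x $ i"
      using claim[of n] x by blast
    then have "v = x"
      using Wc x by (intro eq_vecI) (auto simp: mem_right_space_iff)
    with v show "x \<in> W"
      by simp
  qed
qed

text \<open>From \<open>F\<close> back to \<open>R\<close>, lifting the coefficients shows that the
  span over \<open>R\<close> meets every residue class of vectors, which is the hypothesis of
  \<open>nakayama\<close>.\<close>

lemma lincomb_surj_iff_residue:
  assumes gs: "set gs \<subseteq> carrier (right_space R n)"
  shows "lincomb R n gs ` carrier (right_space R (length gs)) = carrier (right_space R n) \<longleftrightarrow>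
    lincomb F n (map reduce gs) ` carrier (right_space F (length gs)) = carrier (right_space F n)"
proof
  interpret F: finite_division_ring F
    by (rule finite_division_ring_residue_ring)
  assume surj: "lincomb R n gs ` carrier (right_space R (length gs)) = carrier (right_space R n)"
  show "lincomb F n (map reduce gs) ` carrier (right_space F (length gs)) = carrier (right_space F n)"
  proof
    show "lincomb F n (map reduce gs) ` carrier (right_space F (length gs)) \<subseteq> carrier (right_space F n)"
      using F.lincomb_closed[OF set_map_reduce[OF gs]] by auto
    show "carrier (right_space F n) \<subseteq> lincomb F n (map reduce gs) ` carrier (right_space F (length gs))"
    proof
      fix w assume "w \<in> carrier (right_space F n)"
      then obtain v where v: "v \<in> carrier (right_space R n)" "reduce v = w"
        by (rule reduce_surj)
      then obtain a where a: "a \<in> carrier (right_space R (length gs))" "v = lincomb R n gs a"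
        using surj by blast
      then have "w = lincomb F n (map reduce gs) (reduce a)"
        using reduce_lincomb[OF gs a(1)] v(2) by simp
      then show "w \<in> lincomb F n (map reduce gs) ` carrier (right_space F (length gs))"
        using reduce_closed[OF a(1)] by (rule image_eqI)
    qed
  qed
next
  assume surj: "lincomb F n (map reduce gs) ` carrier (right_space F (length gs)) = carrier (right_space F n)"
  show "lincomb R n gs ` carrier (right_space R (length gs)) = carrier (right_space R n)"
  proof (rule nakayama[OF submodule_range_lincomb[OF gs]])
    fix x assume "x \<in> carrier (right_space R n)"
    then have "reduce x \<in> lincomb F n (map reduce gs) ` carrier (right_space F (length gs))"
      unfolding surj by (rule reduce_closed)
    then obtain b where b: "b \<in> carrier (right_space F (length gs))"
      "reduce x = lincomb F n (map reduce gs) b"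
      by blast
    obtain a where a: "a \<in> carrier (right_space R (length gs))" "reduce a = b"
      using b(1) by (rule reduce_surj)
    have "reduce (lincomb R n gs a) = reduce x"
      using reduce_lincomb[OF gs a(1)] a(2) b(2) by simp
    then show "\<exists>v\<in>lincomb R n gs ` carrier (right_space R (length gs)). reduce v = reduce x"
      using a(1) by blast
  qed
qed

text \<open>A relation over \<open>F\<close> lifts to a combination with nonunit entries.
  Multiplying it by \<open>s\<close> from the right kills these entries, so independence over
  \<open>R\<close> yields \<open>a_i s = 0\<close> for every coefficient, and a unit coefficient
  would give \<open>s = 0\<close>.\<close>

lemma inj_on_lincomb_residue:
  assumes gs: "set gs \<subseteq> carrier (right_space R n)"
    and inj: "inj_on (lincomb R n gs) (carrier (right_space R (length gs)))"
  shows "inj_on (lincomb F n (map reduce gs)) (carrier (right_space F (length gs)))"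
proof -
  interpret F: finite_division_ring F
    by (rule finite_division_ring_residue_ring)
  let ?m = "length gs"
  obtain s where s: "s \<in> carrier R" "s \<noteq> \<zero>" "\<And>x. x \<in> carrier R - Units R \<Longrightarrow> x \<otimes> s = \<zero>"
    by (rule nonunits_annihilator) blast
  show ?thesis
  proof (rule F.inj_on_mod_HomI)
    show "lincomb F n (map reduce gs) \<in> mod_Hom F (right_space F ?m) (right_space F n)"
      using F.lincomb_mod_Hom[OF set_map_reduce[OF gs]] by simp
    fix b assume "b \<in> carrier (right_space F ?m)" and zero: "lincomb F n (map reduce gs) b = \<zero>\<^bsub>right_space F n\<^esub>"
    then obtain a where a: "a \<in> carrier (right_space R ?m)" "reduce a = b"
      by (elim reduce_surj)
    have la: "lincomb R n gs a \<in> carrier (right_space R n)"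
      by (rule lincomb_closed[OF gs a(1)])
    have "reduce (lincomb R n gs a) = \<zero>\<^bsub>right_space F n\<^esub>"
      using reduce_lincomb[OF gs a(1)] a(2) zero by simp
    then have "lincomb R n gs a $ i \<in> carrier R - Units R" if "i < n" for i
      using reduce_eq_zero_iff[OF la] that by blast
    then have "s \<odot>\<^bsub>right_space R n\<^esub> lincomb R n gs a = \<zero>\<^bsub>right_space R n\<^esub>"
      using s(3) by (intro eq_vecI) auto
    then have "lincomb R n gs (s \<odot>\<^bsub>right_space R ?m\<^esub> a) = \<zero>\<^bsub>right_space R n\<^esub>"
      using lincomb_smult[OF gs a(1) s(1)] by simp
    also have "\<dots> = lincomb R n gs (\<zero>\<^bsub>right_space R ?m\<^esub>)"
      using mod_Hom_zero[OF lincomb_mod_Hom[OF gs]] by simp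
    finally have sa: "s \<odot>\<^bsub>right_space R ?m\<^esub> a = \<zero>\<^bsub>right_space R ?m\<^esub>"
      by (rule inj_onD[OF inj]) (use a(1) s(1) in \<open>simp_all add: mem_right_space_iff\<close>)
    have "a $ i \<in> carrier R - Units R" if i: "i < ?m" for i
    proof (rule ccontr)
      have ai: "a $ i \<in> carrier R"
        using a(1) i by (simp add: mem_right_space_iff)
      assume "a $ i \<notin> carrier R - Units R"
      then have u: "a $ i \<in> Units R"
        using ai by simp
      have "a $ i \<otimes> s = \<zero>"
        using arg_cong[OF sa, of "\<lambda>v. v $ i"] i by simp
      then have "inv (a $ i) \<otimes> (a $ i \<otimes> s) = \<zero>"
        using u by simp
      then show False
        using u ai s(1,2) by (simp add: m_assoc[symmetric])
    qed
    then show "b = \<zero>\<^bsub>right_space F ?m\<^esub>"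
      using reduce_eq_zero_iff[OF a(1)] a(2) by simp
  qed
qed

lemma minimal_generating_coefficients:
  assumes gs: "set gs \<subseteq> carrier (right_space R n)" and dist: "distinct gs"
    and min: "minimal_generating_set R (right_space R n) C (set gs)"
    and a: "a \<in> carrier (right_space R (length gs))"
    and zero: "lincomb R n gs a = \<zero>\<^bsub>right_space R n\<^esub>"
    and i: "i < length gs"
  shows "a $ i \<in> carrier R - Units R"
proof (rule ccontr)
  have ai: "a $ i \<in> carrier R"
    using a i by (simp add: mem_right_space_iff)
  assume "a $ i \<notin> carrier R - Units R"
  then have u: "a $ i \<in> Units R"
    using ai by simp
  \<comment> \<open>\<open>mod_span\<close> is an intersection of submodules, so dropping
    \<open>gs ! i\<close> leaves the span unchanged once every submodule with the other generators
    contains it.\<close>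
  have mem: "gs ! i \<in> N" if N: "submodule N R (right_space R n)" and sub: "set gs - {gs ! i} \<subseteq> N" for N
  proof -
    have Nc: "N \<subseteq> carrier (right_space R n)" and N0: "\<zero>\<^bsub>right_space R n\<^esub> \<in> N"
      and Nsmult: "\<And>r x. r \<in> carrier R \<Longrightarrow> x \<in> N \<Longrightarrow> r \<odot>\<^bsub>right_space R n\<^esub> x \<in> N"
      using N unfolding submodule_right_space_iff by blast+
    \<comment> \<open>Replacing the generator by zero, instead of deleting it, keeps the indices and
      the coefficient vector \<open>a\<close>. Distinctness of \<open>gs\<close> ensures that the
      remaining entries survive the removal of \<open>gs ! i\<close> from the set.\<close>
    define hs where "hs = gs[i := \<zero>\<^bsub>right_space R n\<^esub>]"
    have "hs ! k \<in> N" if "k < length gs" for k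
    proof (cases "k = i")
      case False
      then have "gs ! k \<in> set gs - {gs ! i}"
        using that i dist by (simp add: nth_eq_iff_index_eq)
      then show ?thesis
        using False sub that by (auto simp: hs_def)
    qed (use N0 i in \<open>simp add: hs_def\<close>)
    then have hsN: "set hs \<subseteq> N"
      by (auto simp: in_set_conv_nth hs_def)
    have len: "length hs = length gs"
      by (simp add: hs_def)
    have lN: "lincomb R n hs a \<in> N"
      using lincomb_in_submodule[OF N hsN] a len by simp
    have g: "gs ! k $ j \<in> carrier R" "a $ k \<in> carrier R" if "k < length gs" "j < n" for k j
      using that a nth_in_right_space(3)[OF gs] by (simp_all add: mem_right_space_iff)
    have split: "lincomb R n gs a $ j = gs ! i $ j \<otimes> a $ i \<oplus> lincomb R n hs a $ j" if j: "j < n" for j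
    proof -
      let ?I = "{..<length gs} - {i}"
      have I: "{..<length gs} = insert i ?I"
        using i by auto
      have "lincomb R n gs a $ j = (\<Oplus>k\<in>insert i ?I. gs ! k $ j \<otimes> a $ k)"
        using j I by (simp add: lincomb_nth)
      also have "\<dots> = gs ! i $ j \<otimes> a $ i \<oplus> (\<Oplus>k\<in>?I. gs ! k $ j \<otimes> a $ k)"
        using g j i by (intro finsum_insert) auto
      also have "(\<Oplus>k\<in>?I. gs ! k $ j \<otimes> a $ k) = (\<Oplus>k\<in>?I. hs ! k $ j \<otimes> a $ k)"
        using g j by (intro finsum_cong') (auto simp: hs_def)
      also have "\<dots> = hs ! i $ j \<otimes> a $ i \<oplus> (\<Oplus>k\<in>?I. hs ! k $ j \<otimes> a $ k)"
      proof -
        have "(\<Oplus>k\<in>?I. hs ! k $ j \<otimes> a $ k) \<in> carrier R"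
          using g j by (intro finsum_closed) (auto simp: hs_def)
        then show ?thesis
          using i j ai by (simp add: hs_def)
      qed
      also have "\<dots> = (\<Oplus>k\<in>insert i ?I. hs ! k $ j \<otimes> a $ k)"
        using g j i ai by (intro finsum_insert[symmetric]) (auto simp: hs_def)
      also have "\<dots> = lincomb R n hs a $ j"
        using j I len by (simp add: lincomb_nth)
      finally show ?thesis .
    qed
    have "(\<ominus> (inv (a $ i))) \<odot>\<^bsub>right_space R n\<^esub> lincomb R n hs a = gs ! i"
    proof (rule eq_vecI)
      fix j assume "j < dim_vec (gs ! i)"
      then have j: "j < n"
        using nth_in_right_space(2)[OF gs i] by simp
      have lj: "lincomb R n hs a $ j \<in> carrier R"
        using lN Nc j by (auto simp: mem_right_space_iff)
      have gj: "gs ! i $ j \<in> carrier R"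
        using g i j by simp
      have "lincomb R n hs a $ j \<oplus> gs ! i $ j \<otimes> a $ i = \<zero>"
        using split[OF j] zero j lj gj ai by (simp add: a_comm)
      then have "lincomb R n hs a $ j = \<ominus> (gs ! i $ j \<otimes> a $ i)"
        using lj gj ai by (intro minus_equality[symmetric]) simp_all
      then show "((\<ominus> (inv (a $ i))) \<odot>\<^bsub>right_space R n\<^esub> lincomb R n hs a) $ j = gs ! i $ j"
        using gj ai u j by (simp add: l_minus r_minus m_assoc)
    qed (use nth_in_right_space(2)[OF gs i] in simp)
    moreover have "(\<ominus> (inv (a $ i))) \<odot>\<^bsub>right_space R n\<^esub> lincomb R n hs a \<in> N"
      using u lN by (intro Nsmult) simp_all
    ultimately show ?thesis
      by simp
  qed
  have "{N. submodule N R (right_space R n) \<and> set gs - {gs ! i} \<subseteq> N} =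
      {N. submodule N R (right_space R n) \<and> set gs \<subseteq> N}"
    using mem by blast
  then have "mod_span R (right_space R n) (set gs - {gs ! i}) = mod_span R (right_space R n) (set gs)"
    by (simp only: mod_span_def)
  moreover have "set gs - {gs ! i} \<subset> set gs"
    using nth_mem[OF i] by blast
  ultimately show False
    using min unfolding minimal_generating_set_def by blast
qed

end

section \<open>Minimal generating sets of free modules\<close>

context finite_local_ring
begin

text \<open>The kernel of the coordinate map onto the residue space consists of the nonunit vectors: every
  element of \<open>C\<close> whose coordinates are nonunits is a combination of the generators with nonunit
  coefficients, and a relation between the generators has nonunit coefficients by minimality.\<close>

lemma minimal_generating_set_basis:
  assumes C: "submodule C R (right_space R n)"
    and iso: "mod_iso R ((right_space R n)\<lparr>carrier := C\<rparr>) (right_space R t)"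
    and dist: "distinct gs"
    and min: "minimal_generating_set R (right_space R n) C (set gs)"
  shows "length gs = t"
    and "lincomb R n gs ` carrier (right_space R (length gs)) = C"
    and "inj_on (lincomb R n gs) (carrier (right_space R (length gs)))"
    and "card C = card (carrier R) ^ t"
proof -
  interpret F: finite_division_ring F
    by (rule finite_division_ring_residue_ring)
  let ?m = "length gs"
  have Cc: "C \<subseteq> carrier (right_space R n)"
    using C unfolding submodule_right_space_iff by blast
  then have gs: "set gs \<subseteq> carrier (right_space R n)"
    using min unfolding minimal_generating_set_def by blast
  show range: "lincomb R n gs ` carrier (right_space R ?m) = C"
    using min mod_span_eq_lincomb[OF gs] unfolding minimal_generating_set_def by blast
  have lC: "lincomb R n gs a \<in> C" if "a \<in> carrier (right_space R ?m)" for a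
    using that range by blast
  obtain f where f: "f \<in> mod_Hom R ((right_space R n)\<lparr>carrier := C\<rparr>) (right_space R t)"
    and bij: "bij_betw f C (carrier (right_space R t))"
    using iso by (auto simp: mod_iso_def)
  have f_closed: "f x \<in> carrier (right_space R t)" if "x \<in> C" for x
    using f that by (auto simp: mod_Hom_def)
  have f_add: "f (x \<oplus>\<^bsub>right_space R n\<^esub> y) = f x \<oplus>\<^bsub>right_space R t\<^esub> f y" if "x \<in> C" "y \<in> C" for x y
    using f that by (simp add: mod_Hom_def del: right_space_simps)
  have f_smult: "f (r \<odot>\<^bsub>right_space R n\<^esub> x) = r \<odot>\<^bsub>right_space R t\<^esub> f x"
    if "r \<in> carrier R" "x \<in> C" for r x
    using f that by (simp add: mod_Hom_def del: right_space_simps)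
  \<comment> \<open>The composite from coefficient vectors through \<open>C\<close> to
    \<open>R^t\<close>. It is a map between full spaces and can therefore be reduced to
    \<open>F\<close>.\<close>
  define \<phi> where "\<phi> a = f (lincomb R n gs a)" for a
  have \<phi>: "\<phi> \<in> mod_Hom R (right_space R ?m) (right_space R t)"
    unfolding mod_Hom_def \<phi>_def
    by (auto simp: lincomb_add[OF gs] lincomb_smult[OF gs] f_add f_smult lC f_closed simp del: right_space_simps)
  have \<phi>_closed: "\<phi> a \<in> carrier (right_space R t)" if "a \<in> carrier (right_space R ?m)" for a
    unfolding \<phi>_def using that by (intro f_closed lC)
  have \<phi>_surj: "\<phi> ` carrier (right_space R ?m) = carrier (right_space R t)"
  proof -
    have "\<phi> ` carrier (right_space R ?m) = f ` (lincomb R n gs ` carrier (right_space R ?m))"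
      unfolding image_image by (intro image_cong refl) (simp only: \<phi>_def)
    then show ?thesis
      unfolding range bij_betw_imp_surj_on[OF bij] .
  qed
  \<comment> \<open>The columns of \<open>\<phi>\<close>: by linearity \<open>\<phi>\<close> is the
    \<open>lincomb\<close> of these vectors.\<close>
  define ps where "ps = map \<phi> (map (std_unit R ?m) [0..<?m])"
  have units: "set (map (std_unit R k) [0..<k]) \<subseteq> carrier (right_space R k)" for k
    using std_unit_closed by auto
  have len_ps: "length ps = ?m"
    by (simp add: ps_def)
  have ps: "set ps \<subseteq> carrier (right_space R t)"
    unfolding ps_def using \<phi>_closed std_unit_closed by auto
  have \<phi>_eq: "\<phi> a = lincomb R t ps a" if "a \<in> carrier (right_space R ?m)" for a
  proof -
    have "\<phi> (lincomb R ?m (map (std_unit R ?m) [0..<?m]) a) = lincomb R t ps a"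
      unfolding ps_def using that by (intro linear_map_lincomb[OF \<phi> units]) simp
    then show ?thesis
      unfolding lincomb_std_units[OF that] .
  qed
  have "lincomb R t ps ` carrier (right_space R (length ps)) = carrier (right_space R t)"
    unfolding len_ps \<phi>_surj[symmetric] using \<phi>_eq by (intro image_cong) simp_all
  then have F_surj: "lincomb F t (map reduce ps) ` carrier (right_space F ?m) = carrier (right_space F t)"
    using lincomb_surj_iff_residue[OF ps] len_ps by simp
  have F_inj: "inj_on (lincomb F t (map reduce ps)) (carrier (right_space F ?m))"
  proof (rule F.inj_on_mod_HomI)
    show "lincomb F t (map reduce ps) \<in> mod_Hom F (right_space F ?m) (right_space F t)"
      using F.lincomb_mod_Hom[OF set_map_reduce[OF ps]] len_ps by simp
    fix b assume "b \<in> carrier (right_space F ?m)"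
      and zero: "lincomb F t (map reduce ps) b = \<zero>\<^bsub>right_space F t\<^esub>"
    then obtain c where c: "c \<in> carrier (right_space R ?m)" "reduce c = b"
      by (elim reduce_surj)
    have red: "reduce (\<phi> c) = \<zero>\<^bsub>right_space F t\<^esub>"
      using reduce_lincomb[OF ps, of c] c zero len_ps \<phi>_eq by simp
    have "\<exists>y\<in>carrier (right_space R ?m). \<phi> y = std_unit R t k" for k
      using \<phi>_surj std_unit_closed[of t k] by (metis imageE)
    then obtain y where y: "\<And>k. y k \<in> carrier (right_space R ?m)" "\<And>k. \<phi> (y k) = std_unit R t k"
      by metis
    define ys where "ys = map y [0..<t]"
    have ys: "set ys \<subseteq> carrier (right_space R ?m)" and len_ys: "length ys = t"
      using y(1) by (auto simp: ys_def)
    \<comment> \<open>The \<open>ys\<close> lift the standard units along \<open>\<phi>\<close>, so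
      \<open>d\<close> is another preimage of \<open>\<phi> c\<close>; its entries are nonunits
      because those of \<open>\<phi> c\<close> are.\<close>
    define d where "d = lincomb R ?m ys (\<phi> c)"
    have \<phi>c: "\<phi> c \<in> carrier (right_space R (length ys))"
      using \<phi>_closed[OF c(1)] len_ys by simp
    have d: "d \<in> carrier (right_space R ?m)"
      unfolding d_def by (rule lincomb_closed[OF ys \<phi>c])
    have "\<phi> d = lincomb R t (map \<phi> ys) (\<phi> c)"
      unfolding d_def by (rule linear_map_lincomb[OF \<phi> ys \<phi>c])
    also have "map \<phi> ys = map (std_unit R t) [0..<t]"
      by (simp add: ys_def y(2))
    also have "lincomb R t (map (std_unit R t) [0..<t]) (\<phi> c) = \<phi> c"
      by (rule lincomb_std_units[OF \<phi>_closed[OF c(1)]])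
    finally have \<phi>d: "\<phi> d = \<phi> c" .
    have "reduce d = lincomb F ?m (map reduce ys) (\<zero>\<^bsub>right_space F t\<^esub>)"
      unfolding d_def reduce_lincomb[OF ys \<phi>c] red ..
    also have "\<dots> = \<zero>\<^bsub>right_space F ?m\<^esub>"
      using F.mod_Hom_zero[OF F.lincomb_mod_Hom[OF set_map_reduce[OF ys]]] len_ys by simp
    finally have dJ: "d $ i \<in> carrier R - Units R" if "i < ?m" for i
      using reduce_eq_zero_iff[OF d] that by blast
    \<comment> \<open>Since \<open>f\<close> is injective, \<open>e\<close> is a relation between
      the generators, so its entries are nonunits, and with them those of
      \<open>c = e + d\<close>.\<close>
    define e where "e = vec ?m (\<lambda>i. c $ i \<ominus> d $ i)"
    have e: "e \<in> carrier (right_space R ?m)"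
      using c(1) d by (simp add: e_def mem_right_space_iff)
    have "\<phi> e = \<zero>\<^bsub>right_space R t\<^esub>"
      unfolding e_def mod_Hom_minus[OF \<phi> c(1) d] \<phi>d
      using minus_eq_zero_vec_iff[OF \<phi>_closed[OF c(1)] \<phi>_closed[OF c(1)]] by blast
    also have "\<dots> = \<phi> (\<zero>\<^bsub>right_space R ?m\<^esub>)"
      by (rule mod_Hom_zero[OF \<phi>, symmetric])
    finally have "f (lincomb R n gs e) = f (lincomb R n gs (\<zero>\<^bsub>right_space R ?m\<^esub>))"
      by (simp only: \<phi>_def)
    then have "lincomb R n gs e = lincomb R n gs (\<zero>\<^bsub>right_space R ?m\<^esub>)"
      using bij_betw_imp_inj_on[OF bij] e
      by (elim inj_onD) (auto intro!: lC simp: mem_right_space_iff)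
    also have "\<dots> = \<zero>\<^bsub>right_space R n\<^esub>"
      by (rule mod_Hom_zero[OF lincomb_mod_Hom[OF gs]])
    finally have eJ: "e $ i \<in> carrier R - Units R" if "i < ?m" for i
      using minimal_generating_coefficients[OF gs dist min e _ that] by blast
    have "c $ i \<in> carrier R - Units R" if i: "i < ?m" for i
    proof -
      have ci: "c $ i \<in> carrier R" and di: "d $ i \<in> carrier R"
        using c(1) d i by (simp_all add: mem_right_space_iff)
      have "e $ i \<oplus> d $ i = c $ i"
        using i ci di by (simp add: e_def a_minus_def a_assoc l_neg)
      then show ?thesis
        using nonunit_add[OF eJ[OF i] dJ[OF i]] by simp
    qed
    then show "b = \<zero>\<^bsub>right_space F ?m\<^esub>"
      using reduce_eq_zero_iff[OF c(1)] c(2) by blast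
  qed
  \<comment> \<open>Over \<open>F\<close> the map is bijective, and counting determines the number
    of generators.\<close>
  have "card (carrier F) ^ ?m = card (carrier F) ^ t"
    using card_image[OF F_inj] unfolding F_surj F.card_right_space by simp
  then show len: "?m = t"
    using F.card_carrier_gt_1 by simp
  show card: "card C = card (carrier R) ^ t"
    using bij_betw_same_card[OF bij] by (simp add: card_right_space)
  \<comment> \<open>A map onto \<open>C\<close> from a finite set that has as many elements as
    \<open>C\<close>.\<close>
  show "inj_on (lincomb R n gs) (carrier (right_space R ?m))"
    by (rule eq_card_imp_inj_on[OF finite_right_space]) (unfold range card card_right_space, simp only: len)
qed

end

section \<open>The pairing and the dual code\<close>

lemma vec_pairing_opposite_ring: "vec_pairing (opposite_ring R) n x v = vec_pairing R n v x"
  by (simp add: vec_pairing_def)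

lemma mem_dual_code_iff:
  "v \<in> dual_code R n C \<longleftrightarrow>
    v \<in> carrier (right_space R n) \<and> (\<forall>c\<in>C. vec_pairing R n v c = \<zero>\<^bsub>R\<^esub>)"
  unfolding dual_code_def right_space_opposite_ring[symmetric] by simp

context ring
begin

lemma vec_pairing_closed:
  "v \<in> carrier (right_space R n) \<Longrightarrow> x \<in> carrier (right_space R n) \<Longrightarrow> vec_pairing R n v x \<in> carrier R"
  unfolding vec_pairing_def by (intro finsum_closed) (auto simp: mem_right_space_iff)

lemma vec_pairing_add_right:
  assumes "v \<in> carrier (right_space R n)"
    and "x \<in> carrier (right_space R n)" "y \<in> carrier (right_space R n)"
  shows "vec_pairing R n v (x \<oplus>\<^bsub>right_space R n\<^esub> y) = vec_pairing R n v x \<oplus> vec_pairing R n v y"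
proof -
  have c: "v $ i \<in> carrier R" "x $ i \<in> carrier R" "y $ i \<in> carrier R" if "i < n" for i
    using assms that by (simp_all add: mem_right_space_iff)
  have "(\<Oplus>i\<in>{..<n}. v $ i \<otimes> (x \<oplus>\<^bsub>right_space R n\<^esub> y) $ i) =
      (\<Oplus>i\<in>{..<n}. v $ i \<otimes> x $ i \<oplus> v $ i \<otimes> y $ i)"
    using c by (intro finsum_cong') (auto simp: r_distr)
  also have "\<dots> = (\<Oplus>i\<in>{..<n}. v $ i \<otimes> x $ i) \<oplus> (\<Oplus>i\<in>{..<n}. v $ i \<otimes> y $ i)"
    using c by (intro finsum_addf) auto
  finally show ?thesis
    by (simp only: vec_pairing_def)
qed

lemma vec_pairing_smult_right:
  assumes "v \<in> carrier (right_space R n)" and "x \<in> carrier (right_space R n)" and "r \<in> carrier R"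
  shows "vec_pairing R n v (r \<odot>\<^bsub>right_space R n\<^esub> x) = vec_pairing R n v x \<otimes> r"
proof -
  have c: "v $ i \<in> carrier R" "x $ i \<in> carrier R" if "i < n" for i
    using assms that by (simp_all add: mem_right_space_iff)
  have "(\<Oplus>i\<in>{..<n}. v $ i \<otimes> x $ i) \<otimes> r = (\<Oplus>i\<in>{..<n}. v $ i \<otimes> x $ i \<otimes> r)"
    using c assms(3) by (intro finsum_ldistr) auto
  also have "\<dots> = (\<Oplus>i\<in>{..<n}. v $ i \<otimes> (r \<odot>\<^bsub>right_space R n\<^esub> x) $ i)"
    using c assms(3) by (intro finsum_cong') (auto simp: m_assoc)
  finally show ?thesis
    by (simp only: vec_pairing_def)
qed

lemma vec_pairing_lincomb:
  assumes "v \<in> carrier (right_space R n)" and "set gs \<subseteq> carrier (right_space R n)"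
    and "a \<in> carrier (right_space R (length gs))"
  shows "vec_pairing R n v (lincomb R n gs a) =
    (\<Oplus>i\<in>{..<length gs}. vec_pairing R n v (gs ! i) \<otimes> a $ i)"
  by (rule linear_functional_lincomb[OF _ _ _ assms(2,3)])
    (simp_all only: vec_pairing_closed vec_pairing_add_right vec_pairing_smult_right assms(1))

lemma vec_pairing_std_unit:
  assumes "v \<in> carrier (right_space R n)" and "j < n"
  shows "vec_pairing R n v (std_unit R n j) = v $ j"
proof -
  have "(\<Oplus>i\<in>{..<n}. v $ i \<otimes> std_unit R n j $ i) = (\<Oplus>i\<in>{..<n}. if j = i then v $ i else \<zero>)"
    using assms by (intro finsum_cong') (auto simp: std_unit_def mem_right_space_iff)
  also have "\<dots> = v $ j"
    using assms by (intro finsum_singleton) (auto simp: mem_right_space_iff)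
  finally show ?thesis
    by (simp only: vec_pairing_def)
qed

text \<open>Pairing with the standard units reads off the coordinates of \<open>v\<close>.\<close>

lemma vec_pairing_nondegenerate:
  assumes v: "v \<in> carrier (right_space R n)"
    and "\<And>x. x \<in> carrier (right_space R n) \<Longrightarrow> vec_pairing R n v x = \<zero>"
  shows "v = \<zero>\<^bsub>right_space R n\<^esub>"
  using v assms(2)[OF std_unit_closed] vec_pairing_std_unit[OF v]
  by (intro eq_vecI) (auto simp: mem_right_space_iff)

lemma zero_in_right_space: "\<zero>\<^bsub>right_space R n\<^esub> \<in> carrier (right_space R n)"
  by (simp add: mem_right_space_iff)

lemma vec_pairing_zero_right:
  assumes "v \<in> carrier (right_space R n)"
  shows "vec_pairing R n v (\<zero>\<^bsub>right_space R n\<^esub>) = \<zero>"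
proof -
  have "\<zero> \<odot>\<^bsub>right_space R n\<^esub> \<zero>\<^bsub>right_space R n\<^esub> = \<zero>\<^bsub>right_space R n\<^esub>"
    by (intro eq_vecI) simp_all
  then show ?thesis
    using vec_pairing_smult_right[OF assms zero_in_right_space zero_closed]
      vec_pairing_closed[OF assms zero_in_right_space] by (simp del: right_space_simps)
qed

text \<open>Left linearity of the pairing in its first argument is right linearity in the second one
  over the opposite ring, where the arguments change places.\<close>

lemma submodule_dual_code:
  assumes C: "C \<subseteq> carrier (right_space R n)"
  shows "submodule (dual_code R n C) (opposite_ring R) (right_space (opposite_ring R) n)"
proof -
  interpret opp: ring "opposite_ring R"
    by (rule ring_opposite_ring)
  have Cc: "c \<in> carrier (right_space (opposite_ring R) n)" if "c \<in> C" for c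
    using that C by auto
  have "v \<oplus>\<^bsub>right_space (opposite_ring R) n\<^esub> w \<in> dual_code R n C"
    if "v \<in> dual_code R n C" "w \<in> dual_code R n C" for v w
  proof -
    have vw: "v \<in> carrier (right_space (opposite_ring R) n)" "w \<in> carrier (right_space (opposite_ring R) n)"
      using that unfolding mem_dual_code_iff by simp_all
    have "v \<oplus>\<^bsub>right_space (opposite_ring R) n\<^esub> w \<in> carrier (right_space R n)"
      using vw by (simp add: mem_right_space_iff)
    moreover have "vec_pairing R n (v \<oplus>\<^bsub>right_space (opposite_ring R) n\<^esub> w) c = \<zero>" if "c \<in> C" for c
      using opp.vec_pairing_add_right[OF Cc[OF that] vw] \<open>v \<in> dual_code R n C\<close> \<open>w \<in> dual_code R n C\<close> that
      unfolding mem_dual_code_iff vec_pairing_opposite_ring by simp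
    ultimately show ?thesis
      unfolding mem_dual_code_iff by blast
  qed
  moreover have "r \<odot>\<^bsub>right_space (opposite_ring R) n\<^esub> v \<in> dual_code R n C"
    if "r \<in> carrier R" "v \<in> dual_code R n C" for r v
  proof -
    have v: "v \<in> carrier (right_space (opposite_ring R) n)" and r: "r \<in> carrier (opposite_ring R)"
      using that unfolding mem_dual_code_iff by simp_all
    have "r \<odot>\<^bsub>right_space (opposite_ring R) n\<^esub> v \<in> carrier (right_space R n)"
      using v r by (simp add: mem_right_space_iff)
    moreover have "vec_pairing R n (r \<odot>\<^bsub>right_space (opposite_ring R) n\<^esub> v) c = \<zero>" if "c \<in> C" for c
      using opp.vec_pairing_smult_right[OF Cc[OF that] v r] \<open>v \<in> dual_code R n C\<close> that r
      unfolding mem_dual_code_iff vec_pairing_opposite_ring by simp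
    ultimately show ?thesis
      unfolding mem_dual_code_iff by blast
  qed
  moreover have "\<zero>\<^bsub>right_space (opposite_ring R) n\<^esub> \<in> dual_code R n C"
    using opp.vec_pairing_zero_right[OF Cc] opp.zero_in_right_space[of n]
    unfolding mem_dual_code_iff vec_pairing_opposite_ring carrier_right_space_opposite_ring opposite_ring_simps
    by blast
  moreover have "dual_code R n C \<subseteq> carrier (right_space R n)"
    unfolding subset_iff mem_dual_code_iff by blast
  ultimately show ?thesis
    unfolding opp.submodule_right_space_iff carrier_right_space_opposite_ring opposite_ring_simps by blast
qed

end

context finite_ring
begin

text \<open>The pairings with the vectors of a basis are coordinates on the dual side, and the dual code is
  cut out by the vanishing of the first ones.\<close>

lemma dual_code_mod_iso:
  assumes gs: "set gs \<subseteq> carrier (right_space R n)" and hs: "set hs \<subseteq> carrier (right_space R n)"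
    and len: "length (gs @ hs) = n"
    and surj: "lincomb R n (gs @ hs) ` carrier (right_space R n) = carrier (right_space R n)"
    and C: "C = lincomb R n gs ` carrier (right_space R (length gs))"
  shows "mod_iso (opposite_ring R) ((right_space (opposite_ring R) n)\<lparr>carrier := dual_code R n C\<rparr>)
    (right_space (opposite_ring R) (length hs))"
proof -
  interpret opp: finite_ring "opposite_ring R"
    by (rule finite_ring_opposite_ring)
  have ghs: "set (gs @ hs) \<subseteq> carrier (right_space R n)"
    using gs hs by simp
  have gi: "(gs @ hs) ! i \<in> carrier (right_space R n)" if "i < n" for i
    using nth_in_right_space(1)[OF ghs] that len by simp
  have gsi: "gs ! i \<in> carrier (right_space R n)" if "i < length gs" for i
    by (rule nth_in_right_space(1)[OF gs that])
  have hsi: "hs ! i \<in> carrier (right_space R n)" if "i < length hs" for i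
    by (rule nth_in_right_space(1)[OF hs that])
  define \<psi> where "\<psi> v = vec n (\<lambda>i. vec_pairing R n v ((gs @ hs) ! i))" for v
  define f where "f v = vec (length hs) (\<lambda>i. vec_pairing R n v (hs ! i))" for v
  have \<psi>_closed: "\<psi> v \<in> carrier (right_space R n)" if "v \<in> carrier (right_space R n)" for v
    unfolding mem_right_space_iff \<psi>_def using vec_pairing_closed[OF that gi] by simp
  \<comment> \<open>The coordinate \<open>v $ j\<close> is the pairing of \<open>v\<close> with a
    standard unit, which is a combination of the basis; hence the pairings with the basis determine
    \<open>v\<close>.\<close>
  have \<psi>_inj: "inj_on \<psi> (carrier (right_space R n))"
  proof (rule inj_onI)
    fix v w assume v: "v \<in> carrier (right_space R n)" and w: "w \<in> carrier (right_space R n)" and eq: "\<psi> v = \<psi> w"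
    have pair: "vec_pairing R n v ((gs @ hs) ! i) = vec_pairing R n w ((gs @ hs) ! i)" if "i < n" for i
      using arg_cong[OF eq, of "\<lambda>u. u $ i"] that by (simp add: \<psi>_def)
    have "v $ j = w $ j" if j: "j < n" for j
    proof -
      obtain a where a: "a \<in> carrier (right_space R n)" "std_unit R n j = lincomb R n (gs @ hs) a"
        using surj std_unit_closed[of n j] by blast
      have ai: "a $ i \<in> carrier R" if "i < n" for i
        using a(1) that by (simp add: mem_right_space_iff)
      have "v $ j = (\<Oplus>i\<in>{..<n}. vec_pairing R n v ((gs @ hs) ! i) \<otimes> a $ i)"
        using vec_pairing_lincomb[OF v ghs, of a] a len vec_pairing_std_unit[OF v j] by simp
      also have "\<dots> = (\<Oplus>i\<in>{..<n}. vec_pairing R n w ((gs @ hs) ! i) \<otimes> a $ i)"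
        using pair gi vec_pairing_closed[OF w] ai by (intro finsum_cong') auto
      also have "\<dots> = w $ j"
        using vec_pairing_lincomb[OF w ghs, of a] a len vec_pairing_std_unit[OF w j] by simp
      finally show ?thesis .
    qed
    then show "v = w"
      using v w by (intro eq_vecI) (auto simp: mem_right_space_iff)
  qed
  have \<psi>_surj: "\<psi> ` carrier (right_space R n) = carrier (right_space R n)"
    by (rule endo_inj_surj[OF finite_right_space _ \<psi>_inj]) (use \<psi>_closed in blast)
  have gs_C: "gs ! i \<in> C" if "i < length gs" for i
    unfolding C using lincomb_std_unit[OF gs that] std_unit_closed
    by (intro image_eqI[of _ _ "std_unit R (length gs) i"]) simp_all
  have dual_iff: "v \<in> dual_code R n C \<longleftrightarrow>
      v \<in> carrier (right_space R n) \<and> (\<forall>i<length gs. vec_pairing R n v (gs ! i) = \<zero>)" for v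
  proof
    assume "v \<in> dual_code R n C"
    then show "v \<in> carrier (right_space R n) \<and> (\<forall>i<length gs. vec_pairing R n v (gs ! i) = \<zero>)"
      using gs_C unfolding mem_dual_code_iff by blast
  next
    assume v: "v \<in> carrier (right_space R n) \<and> (\<forall>i<length gs. vec_pairing R n v (gs ! i) = \<zero>)"
    have "vec_pairing R n v c = \<zero>" if c: "c \<in> C" for c
    proof -
      obtain a where a: "a \<in> carrier (right_space R (length gs))" "c = lincomb R n gs a"
        using c unfolding C by blast
      have "vec_pairing R n v c = (\<Oplus>i\<in>{..<length gs}. vec_pairing R n v (gs ! i) \<otimes> a $ i)"
        unfolding a(2) using v by (intro vec_pairing_lincomb[OF _ gs a(1)]) simp
      also have "\<dots> = (\<Oplus>i\<in>{..<length gs}. \<zero>)"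
        using v a(1) by (intro finsum_cong') (auto simp: mem_right_space_iff)
      finally show ?thesis
        by simp
    qed
    with v show "v \<in> dual_code R n C"
      unfolding mem_dual_code_iff by blast
  qed
  have f_closed: "f v \<in> carrier (right_space R (length hs))" if "v \<in> carrier (right_space R n)" for v
    unfolding mem_right_space_iff f_def using vec_pairing_closed[OF that hsi] by simp
  have "f v \<oplus>\<^bsub>right_space (opposite_ring R) (length hs)\<^esub> f w = f (v \<oplus>\<^bsub>right_space (opposite_ring R) n\<^esub> w)"
    if "v \<in> carrier (right_space R n)" "w \<in> carrier (right_space R n)" for v w
  proof (rule eq_vecI)
    fix i assume "i < dim_vec (f (v \<oplus>\<^bsub>right_space (opposite_ring R) n\<^esub> w))"
    then have i: "i < length hs"
      by (simp add: f_def)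
    then show "(f v \<oplus>\<^bsub>right_space (opposite_ring R) (length hs)\<^esub> f w) $ i =
        f (v \<oplus>\<^bsub>right_space (opposite_ring R) n\<^esub> w) $ i"
      using opp.vec_pairing_add_right[of "hs ! i" n v w] that hsi[OF i]
      by (simp add: f_def vec_pairing_opposite_ring del: right_space_simps(2)) (simp add: f_def)
  qed (simp add: f_def)
  moreover have "r \<odot>\<^bsub>right_space (opposite_ring R) (length hs)\<^esub> f v = f (r \<odot>\<^bsub>right_space (opposite_ring R) n\<^esub> v)"
    if "r \<in> carrier R" "v \<in> carrier (right_space R n)" for r v
  proof (rule eq_vecI)
    fix i assume "i < dim_vec (f (r \<odot>\<^bsub>right_space (opposite_ring R) n\<^esub> v))"
    then have i: "i < length hs"
      by (simp add: f_def)
    then show "(r \<odot>\<^bsub>right_space (opposite_ring R) (length hs)\<^esub> f v) $ i =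
        f (r \<odot>\<^bsub>right_space (opposite_ring R) n\<^esub> v) $ i"
      using opp.vec_pairing_smult_right[of "hs ! i" n v r] that hsi[OF i]
      by (simp add: f_def vec_pairing_opposite_ring del: right_space_simps(3)) (simp add: f_def)
  qed (simp add: f_def)
  ultimately have hom: "f \<in> mod_Hom (opposite_ring R)
      ((right_space (opposite_ring R) n)\<lparr>carrier := dual_code R n C\<rparr>) (right_space (opposite_ring R) (length hs))"
    using f_closed unfolding mod_Hom_def by (simp add: mem_dual_code_iff del: right_space_simps)
  \<comment> \<open>\<open>f\<close> consists of the last coordinates of \<open>\<psi>\<close>, and
    the dual code is where the first \<open>length gs\<close> coordinates vanish. So injectivity
    passes to \<open>f\<close>, and a preimage of \<open>y\<close> under \<open>f\<close> is found
    by padding \<open>y\<close> with zeros in front.\<close>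
  have "bij_betw f (dual_code R n C) (carrier (right_space R (length hs)))"
    unfolding bij_betw_def
  proof
    show "inj_on f (dual_code R n C)"
    proof (rule inj_onI)
      fix v w assume v: "v \<in> dual_code R n C" and w: "w \<in> dual_code R n C" and eq: "f v = f w"
      have "vec_pairing R n v ((gs @ hs) ! i) = vec_pairing R n w ((gs @ hs) ! i)" if i: "i < n" for i
      proof (cases "i < length gs")
        case True
        then show ?thesis
          using v w dual_iff by (simp add: nth_append)
      next
        case False
        then show ?thesis
          using arg_cong[OF eq, of "\<lambda>u. u $ (i - length gs)"] i len by (simp add: nth_append f_def)
      qed
      then have "\<psi> v = \<psi> w"
        by (intro eq_vecI) (simp_all add: \<psi>_def)
      then show "v = w"
        using v w by (elim inj_onD[OF \<psi>_inj]) (simp_all only: mem_dual_code_iff)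
    qed
    show "f ` dual_code R n C = carrier (right_space R (length hs))"
    proof
      show "f ` dual_code R n C \<subseteq> carrier (right_space R (length hs))"
        using f_closed by (intro image_subsetI) (simp only: mem_dual_code_iff)
      show "carrier (right_space R (length hs)) \<subseteq> f ` dual_code R n C"
      proof
        fix y assume y: "y \<in> carrier (right_space R (length hs))"
        define z where "z = vec (length gs) (\<lambda>_. \<zero>) @\<^sub>v y"
        have dy: "dim_vec y = length hs"
          using y by (simp add: mem_right_space_iff)
        have "z \<in> carrier (right_space R (length gs + length hs))"
          unfolding z_def using y dy
          by (subst append_right_space_iff) (simp_all add: mem_right_space_iff)
        then have "z \<in> carrier (right_space R n)"
          using len by simp
        then obtain v where v: "v \<in> carrier (right_space R n)" "z = \<psi> v"
          using \<psi>_surj by blast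
        have pair: "vec_pairing R n v ((gs @ hs) ! i) = z $ i" if "i < n" for i
          using that unfolding v(2) by (simp add: \<psi>_def)
        have "vec_pairing R n v (gs ! i) = \<zero>" if "i < length gs" for i
          using pair[of i] that len by (simp add: nth_append z_def)
        then have "v \<in> dual_code R n C"
          using v(1) dual_iff by blast
        moreover have "f v = y"
        proof (rule eq_vecI)
          fix i assume "i < dim_vec y"
          then have i: "i < length hs"
            by (simp add: dy)
          then show "f v $ i = y $ i"
            using pair[of "length gs + i"] len dy by (simp add: f_def nth_append z_def)
        qed (simp add: f_def dy)
        ultimately show "y \<in> f ` dual_code R n C"
          by blast
      qed
    qed
  qed
  with hom show ?thesis
    unfolding mod_iso_def by (intro bexI[of _ f]) simp_all
qed

end

section \<open>Invertibility of a matrix in terms of the span of its rows\<close>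

context finite_local_ring
begin

lemma invertible_over_iff_residue:
  assumes gs: "set gs \<subseteq> carrier (right_space R n)" and len: "length gs = n"
  shows "invertible_over R (mat_of_rows n gs) \<longleftrightarrow>
    lincomb (opposite_ring F) n (map reduce gs) ` carrier (right_space F n) = carrier (right_space F n)"
proof -
  interpret F: finite_division_ring F
    by (rule finite_division_ring_residue_ring)
  let ?A = "mat_of_rows n gs"
  let ?B = "map_mat (residue_map R) ?A"
  have A: "?A \<in> carrier_mat n n"
    using len by (simp add: mat_of_rows_def)
  have A_nth: "?A $$ (i, j) \<in> carrier R" if "i < n" "j < n" for i j
    using that len nth_in_right_space(3)[OF gs] by (simp add: mat_of_rows_def)
  have elA: "elements_mat ?A \<subseteq> carrier R"
    using A A_nth by (auto simp: elements_mat_def)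
  have elB: "elements_mat ?B \<subseteq> carrier F"
    using A A_nth residue_map_closed by (auto simp: elements_mat_def)
  have rows: "rows ?B = map reduce gs"
    using nth_in_right_space(2)[OF gs] len
    by (intro nth_equalityI eq_vecI) (auto simp: mat_of_rows_def)
  have "invertible_over R ?A \<longleftrightarrow> ring_invertible_mat F ?B"
    using A elA len by (simp add: invertible_over_def)
  also have "\<dots> \<longleftrightarrow> lincomb (opposite_ring F) n (map reduce gs) ` carrier (right_space F n) =
      carrier (right_space F n)"
    using F.ring_invertible_mat_iff[of ?B n] A elB rows by simp
  finally show ?thesis .
qed

text \<open>Scalars are on the left on both sides, so the comparison of spans can be applied over
  the opposite ring, whose residue ring is the opposite of \<open>F\<close>.\<close>

lemma invertible_over_iff_left_span:
  assumes gs: "set gs \<subseteq> carrier (right_space R n)" and len: "length gs = n"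
  shows "invertible_over R (mat_of_rows n gs) \<longleftrightarrow>
    lincomb (opposite_ring R) n gs ` carrier (right_space R n) = carrier (right_space R n)"
proof -
  interpret opp: finite_local_ring "opposite_ring R"
    by (rule finite_local_ring_opposite_ring)
  show ?thesis
    using opp.lincomb_surj_iff_residue[of gs n] gs len invertible_over_iff_residue[OF gs len]
    by (simp add: residue_ring_opposite_ring residue_map_opposite_ring)
qed

text \<open>Here the residue ring has to be commutative: over a noncommutative division ring the rows
  \<open>(1, b)\<close> and \<open>(a, ab)\<close> of a singular matrix can be independent with respect to scalars on the
  right.\<close>

lemma invertible_over_iff_right_span:
  assumes gs: "set gs \<subseteq> carrier (right_space R n)" and len: "length gs = n"
  shows "invertible_over R (mat_of_rows n gs) \<longleftrightarrow>
    lincomb R n gs ` carrier (right_space R n) = carrier (right_space R n)"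
proof -
  interpret F: finite_division_ring F
    by (rule finite_division_ring_residue_ring)
  have rgs: "set (map reduce gs) \<subseteq> carrier (right_space F n)"
    by (rule set_map_reduce[OF gs])
  have "lincomb (opposite_ring F) n (map reduce gs) b = lincomb F n (map reduce gs) b"
    if b: "b \<in> carrier (right_space F n)" for b
  proof (rule eq_vecI)
    fix j assume "j < dim_vec (lincomb F n (map reduce gs) b)"
    then have j: "j < n"
      by simp
    have c: "map reduce gs ! i $ j \<in> carrier F" "b $ i \<in> carrier F" if "i < n" for i
      using nth_in_right_space(3)[OF rgs, of i j] b that j len by (simp_all add: mem_right_space_iff)
    have "(\<Oplus>\<^bsub>F\<^esub>i\<in>{..<n}. b $ i \<otimes>\<^bsub>F\<^esub> map reduce gs ! i $ j) =
        (\<Oplus>\<^bsub>F\<^esub>i\<in>{..<n}. map reduce gs ! i $ j \<otimes>\<^bsub>F\<^esub> b $ i)"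
    proof (rule F.finsum_cong')
      show "(\<lambda>i. map reduce gs ! i $ j \<otimes>\<^bsub>F\<^esub> b $ i) \<in> {..<n} \<rightarrow> carrier F"
        using F.m_closed[OF c] by blast
      show "b $ i \<otimes>\<^bsub>F\<^esub> map reduce gs ! i $ j = map reduce gs ! i $ j \<otimes>\<^bsub>F\<^esub> b $ i"
        if "i \<in> {..<n}" for i
        using F.wedderburn[OF c(2) c(1)] that by blast
    qed simp
    then show "lincomb (opposite_ring F) n (map reduce gs) b $ j = lincomb F n (map reduce gs) b $ j"
      using j len by (simp add: lincomb_nth)
  qed simp
  then show ?thesis
    unfolding invertible_over_iff_residue[OF gs len] using lincomb_surj_iff_residue[OF gs] len
    by (simp cong: image_cong)
qed

end

section \<open>Complementary pairs of free codes\<close>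

text \<open>A submodule refers to the ring only through its carrier; the order of multiplication is
  hidden in the action on \<open>M\<close>.\<close>

lemma submodule_opposite_ring_iff: "submodule N (opposite_ring R) M \<longleftrightarrow> submodule N R M"
  by (simp add: submodule_def submodule_axioms_def)

lemma minimal_generating_set_left_space_iff:
  "minimal_generating_set R (left_space R n) N S \<longleftrightarrow>
    minimal_generating_set (opposite_ring R) (right_space (opposite_ring R) n) N S"
  by (simp only: minimal_generating_set_def mod_span_def submodule_opposite_ring_iff right_space_opposite_ring)

context finite_local_ring
begin

lemma free_code_generators:
  assumes free: "free_code R n C" and G: "generator_matrix R n C G"
  obtains t where "set (rows G) \<subseteq> carrier (right_space R n)" and "length (rows G) = t"
    and "lincomb R n (rows G) ` carrier (right_space R t) = C"
    and "inj_on (lincomb R n (rows G)) (carrier (right_space R t))"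
    and "submodule C R (right_space R n)" and "card C = card (carrier R) ^ t"
proof -
  obtain t where C: "submodule C R (right_space R n)"
    and iso: "mod_iso R ((right_space R n)\<lparr>carrier := C\<rparr>) (right_space R t)"
    using free unfolding free_code_def linear_code_def free_right_module_def by blast
  have dist: "distinct (rows G)" and min: "minimal_generating_set R (right_space R n) C (set (rows G))"
    using G unfolding generator_matrix_def by blast+
  have "set (rows G) \<subseteq> carrier (right_space R n)"
    using min C unfolding minimal_generating_set_def submodule_right_space_iff by blast
  then show thesis
    using minimal_generating_set_basis[OF C iso dist min] C by (intro that[of t]) simp_all
qed

text \<open>The basis of \<open>C\<close> is completed over \<open>F\<close>, where any independent
  family extends, and the new vectors are lifted. The surjectivity criterion shows that the enlarged
  list spans \<open>R^n\<close>, so the dual code is free of the complementary rank and the rows of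
  \<open>H\<close> form a basis of it.\<close>

lemma free_code_dual_generators:
  assumes gs: "set gs \<subseteq> carrier (right_space R n)"
    and inj: "inj_on (lincomb R n gs) (carrier (right_space R (length gs)))"
    and C: "lincomb R n gs ` carrier (right_space R (length gs)) = C"
    and H: "parity_check_matrix R n C H"
  shows "set (rows H) \<subseteq> carrier (right_space R n)" and "length gs + length (rows H) = n"
    and "lincomb (opposite_ring R) n (rows H) ` carrier (right_space R (length (rows H))) = dual_code R n C"
    and "submodule (dual_code R n C) (opposite_ring R) (right_space (opposite_ring R) n)"
    and "card (dual_code R n C) = card (carrier R) ^ length (rows H)"
proof -
  interpret opp: finite_local_ring "opposite_ring R"
    by (rule finite_local_ring_opposite_ring)
  interpret F: finite_division_ring F
    by (rule finite_division_ring_residue_ring)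
  obtain ks where ks: "set ks \<subseteq> carrier (right_space F n)" "length (map reduce gs @ ks) = n"
    "lincomb F n (map reduce gs @ ks) ` carrier (right_space F n) = carrier (right_space F n)"
    using F.extend_to_basis[OF set_map_reduce[OF gs]] inj_on_lincomb_residue[OF gs inj] by auto
  have "\<forall>k\<in>set ks. \<exists>h. h \<in> carrier (right_space R n) \<and> reduce h = k"
    using ks(1) reduce_surj by (metis subsetD)
  from bchoice[OF this] obtain l where l: "\<And>k. k \<in> set ks \<Longrightarrow> l k \<in> carrier (right_space R n) \<and> reduce (l k) = k"
    by blast
  define hs where "hs = map l ks"
  have hs: "set hs \<subseteq> carrier (right_space R n)"
    using l by (auto simp: hs_def)
  have "map reduce hs = map (\<lambda>k. k) ks"
    unfolding hs_def map_map using l by (intro map_cong) simp_all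
  then have red: "map reduce (gs @ hs) = map reduce gs @ ks"
    by simp
  have len: "length (gs @ hs) = n"
    using ks(2) by (simp add: hs_def)
  have ghs: "set (gs @ hs) \<subseteq> carrier (right_space R n)"
    using gs hs by simp
  have surj: "lincomb R n (gs @ hs) ` carrier (right_space R n) = carrier (right_space R n)"
    using lincomb_surj_iff_residue[OF ghs] ks(3) unfolding len red by blast
  have iso: "mod_iso (opposite_ring R) ((right_space (opposite_ring R) n)\<lparr>carrier := dual_code R n C\<rparr>)
      (right_space (opposite_ring R) (length hs))"
    by (rule dual_code_mod_iso[OF gs hs len surj C[symmetric]])
  have "C \<subseteq> carrier (right_space R n)"
    unfolding C[symmetric] using lincomb_closed[OF gs] by blast
  then show sub: "submodule (dual_code R n C) (opposite_ring R) (right_space (opposite_ring R) n)"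
    by (rule submodule_dual_code)
  have dist: "distinct (rows H)"
    and min: "minimal_generating_set (opposite_ring R) (right_space (opposite_ring R) n) (dual_code R n C) (set (rows H))"
    using H unfolding parity_check_matrix_def minimal_generating_set_left_space_iff by blast+
  note basis = opp.minimal_generating_set_basis[OF sub iso dist min]
  show "length gs + length (rows H) = n"
    using basis(1) len by simp
  show "lincomb (opposite_ring R) n (rows H) ` carrier (right_space R (length (rows H))) = dual_code R n C"
    using basis(2) by simp
  show "card (dual_code R n C) = card (carrier R) ^ length (rows H)"
    using basis(1,4) by simp
  show "set (rows H) \<subseteq> carrier (right_space R n)"
    using min unfolding minimal_generating_set_def mem_dual_code_iff subset_iff by blast
qed

text \<open>A vector orthogonal to two summands of the whole space is orthogonal to everything,
  hence zero. Applied over \<open>R\<close> and over the opposite ring, this gives a trivial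
  intersection on the other side, which the cardinalities turn into a full sum.\<close>

lemma sum_eq_iff_dual_sum_eq:
  assumes C: "submodule C R (right_space R n)" and D: "submodule D R (right_space R n)"
    and card: "card C * card D = card (carrier (right_space R n))"
    and dual_card: "card (dual_code R n C) * card (dual_code R n D) = card (carrier (right_space R n))"
  shows "C <+>\<^bsub>right_space R n\<^esub> D = carrier (right_space R n) \<longleftrightarrow>
    dual_code R n C <+>\<^bsub>right_space (opposite_ring R) n\<^esub> dual_code R n D = carrier (right_space R n)"
    (is "?sum \<longleftrightarrow> ?dual")
proof
  interpret opp: finite_local_ring "opposite_ring R"
    by (rule finite_local_ring_opposite_ring)
  have Cc: "C \<subseteq> carrier (right_space R n)" and Dc: "D \<subseteq> carrier (right_space R n)"
    and C0: "\<zero>\<^bsub>right_space R n\<^esub> \<in> C" and D0: "\<zero>\<^bsub>right_space R n\<^esub> \<in> D"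
    using C D unfolding submodule_right_space_iff by blast+
  note dual_iff = opp.set_add_eq_iff_Int_eq[OF submodule_dual_code[OF Cc] submodule_dual_code[OF Dc],
      unfolded carrier_right_space_opposite_ring, OF dual_card]
  have dual_sub: "dual_code R n E \<subseteq> carrier (right_space R n)" for E
    unfolding subset_iff mem_dual_code_iff by blast
  {
    assume ?sum
    have "v = \<zero>\<^bsub>right_space R n\<^esub>" if v: "v \<in> dual_code R n C \<inter> dual_code R n D" for v
    proof (rule vec_pairing_nondegenerate)
      show vc: "v \<in> carrier (right_space R n)"
        using v dual_sub by blast
      fix x assume "x \<in> carrier (right_space R n)"
      then obtain c d where cd: "c \<in> C" "d \<in> D" "x = c \<oplus>\<^bsub>right_space R n\<^esub> d"
        unfolding \<open>?sum\<close>[symmetric] mem_set_add_right_space_iff by blast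
      have "vec_pairing R n v c = \<zero>" "vec_pairing R n v d = \<zero>"
        using v cd unfolding Int_iff mem_dual_code_iff by blast+
      then show "vec_pairing R n v x = \<zero>"
        unfolding cd(3) using vec_pairing_add_right[OF vc, of c d] cd(1,2) Cc Dc
        by (simp add: subsetD del: right_space_simps)
    qed
    moreover have "\<zero>\<^bsub>right_space (opposite_ring R) n\<^esub> \<in> dual_code R n C"
      "\<zero>\<^bsub>right_space (opposite_ring R) n\<^esub> \<in> dual_code R n D"
      using submodule_dual_code[OF Cc] submodule_dual_code[OF Dc]
      unfolding opp.submodule_right_space_iff by blast+
    ultimately have "dual_code R n C \<inter> dual_code R n D = {\<zero>\<^bsub>right_space (opposite_ring R) n\<^esub>}"
      unfolding right_space_simps(1) opposite_ring_simps by blast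
    then show ?dual
      using dual_iff by blast
  next
    assume ?dual
    have "x = \<zero>\<^bsub>right_space R n\<^esub>" if x: "x \<in> C \<inter> D" for x
    proof -
      have xc: "x \<in> carrier (right_space (opposite_ring R) n)"
        using x Cc by auto
      have "x = \<zero>\<^bsub>right_space (opposite_ring R) n\<^esub>"
      proof (rule opp.vec_pairing_nondegenerate[OF xc])
        fix v assume "v \<in> carrier (right_space (opposite_ring R) n)"
        then have "v \<in> dual_code R n C <+>\<^bsub>right_space (opposite_ring R) n\<^esub> dual_code R n D"
          using \<open>?dual\<close> by simp
        then obtain a b where ab: "a \<in> dual_code R n C" "b \<in> dual_code R n D"
          "v = a \<oplus>\<^bsub>right_space (opposite_ring R) n\<^esub> b"
          unfolding opp.mem_set_add_right_space_iff by blast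
        have "vec_pairing R n a x = \<zero>" "vec_pairing R n b x = \<zero>"
          using ab x unfolding Int_iff mem_dual_code_iff by blast+
        moreover have "a \<in> carrier (right_space (opposite_ring R) n)" "b \<in> carrier (right_space (opposite_ring R) n)"
          using ab dual_sub by auto
        ultimately show "vec_pairing (opposite_ring R) n x v = \<zero>\<^bsub>opposite_ring R\<^esub>"
          unfolding ab(3) using opp.vec_pairing_add_right[OF xc, of a b]
          by (simp add: vec_pairing_opposite_ring del: right_space_simps)
      qed
      then show ?thesis
        by simp
    qed
    then have "C \<inter> D = {\<zero>\<^bsub>right_space R n\<^esub>}"
      using C0 D0 by blast
    then show ?sum
      using set_add_eq_iff_Int_eq[OF C D card] by blast
  }
qed

end

theorem theorem3p10:
  fixes R :: "('a, 'r) ring_scheme" and n :: nat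
    and C D :: "'a vec set" and G1 G2 H1 H2 :: "'a mat"
  assumes "finite_frobenius_ring R" and "local_ring R"
    and "free_code R n C" and "free_code R n D"
    and "generator_matrix R n C G1" and "generator_matrix R n D G2"
    and "parity_check_matrix R n C H1" and "parity_check_matrix R n D H2"
    and "card C * card D = card (carrier (right_space R n))"
  shows "(LCP R n C D \<longleftrightarrow> invertible_over R (stack_rows G1 G2)) \<and>
    (LCP R n C D \<longleftrightarrow> invertible_over R (stack_rows H1 H2))"
proof -
  interpret finite_local_ring R
    using assms(1,2) unfolding finite_frobenius_ring_def local_ring_def
    by (intro finite_local_ring.intro finite_ring.intro finite_ring_axioms.intro finite_local_ring_axioms.intro) simp_all
  interpret opp: finite_local_ring "opposite_ring R"
    by (rule finite_local_ring_opposite_ring)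
  obtain t1 where C: "set (rows G1) \<subseteq> carrier (right_space R n)" "length (rows G1) = t1"
    "lincomb R n (rows G1) ` carrier (right_space R t1) = C"
    "inj_on (lincomb R n (rows G1)) (carrier (right_space R t1))"
    "submodule C R (right_space R n)" "card C = card (carrier R) ^ t1"
    using assms(3,5) by (rule free_code_generators)
  obtain t2 where D: "set (rows G2) \<subseteq> carrier (right_space R n)" "length (rows G2) = t2"
    "lincomb R n (rows G2) ` carrier (right_space R t2) = D"
    "inj_on (lincomb R n (rows G2)) (carrier (right_space R t2))"
    "submodule D R (right_space R n)" "card D = card (carrier R) ^ t2"
    using assms(4,6) by (rule free_code_generators)
  note C_dual = free_code_dual_generators[of "rows G1" n C H1, unfolded C(2), OF C(1,4,3) assms(7)]
  note D_dual = free_code_dual_generators[of "rows G2" n D H2, unfolded D(2), OF D(1,4,3) assms(8)]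
  have "card {\<zero>\<^bsub>R\<^esub>, \<one>\<^bsub>R\<^esub>} \<le> card (carrier R)"
    by (intro card_mono finite_carrier) auto
  then have "card (carrier R) > 1"
    using one_neq_zero by simp
  \<comment> \<open>The hypothesis on the cardinalities fixes the sum of the ranks and makes the
    stacked generator matrix square.\<close>
  moreover have "card (carrier R) ^ (t1 + t2) = card (carrier R) ^ n"
    using assms(9) by (simp add: C(6) D(6) card_right_space power_add)
  ultimately have t: "t1 + t2 = n"
    by simp
  \<comment> \<open>By counting, a full sum already implies a trivial intersection.\<close>
  have LCP: "LCP R n C D \<longleftrightarrow> C <+>\<^bsub>right_space R n\<^esub> D = carrier (right_space R n)"
    unfolding LCP_def using set_add_eq_iff_Int_eq[OF C(5) D(5) assms(9)] by blast
  have G_len: "length (rows G1 @ rows G2) = n" and G_sub: "set (rows G1 @ rows G2) \<subseteq> carrier (right_space R n)"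
    using C(1,2) D(1,2) t by simp_all
  have "stack_rows G1 G2 = mat_of_rows n (rows G1 @ rows G2)"
    using assms(5) by (simp add: stack_rows_def generator_matrix_def)
  then have "invertible_over R (stack_rows G1 G2) \<longleftrightarrow>
      lincomb R n (rows G1 @ rows G2) ` carrier (right_space R n) = carrier (right_space R n)"
    using invertible_over_iff_right_span[OF G_sub G_len] by simp
  also have "lincomb R n (rows G1 @ rows G2) ` carrier (right_space R n) = C <+>\<^bsub>right_space R n\<^esub> D"
    using range_lincomb_append[OF C(1) D(1)] unfolding G_len C(2,3) D(2,3) .
  finally have G: "LCP R n C D \<longleftrightarrow> invertible_over R (stack_rows G1 G2)"
    unfolding LCP by blast
  \<comment> \<open>The dual ranks \<open>n - t1\<close> and \<open>n - t2\<close> add up to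
    \<open>n\<close> again.\<close>
  have H_len: "length (rows H1 @ rows H2) = n" and H_sub: "set (rows H1 @ rows H2) \<subseteq> carrier (right_space R n)"
    using C_dual(1,2) D_dual(1,2) t by simp_all
  have "stack_rows H1 H2 = mat_of_rows n (rows H1 @ rows H2)"
    using assms(7) by (simp add: stack_rows_def parity_check_matrix_def)
  then have "invertible_over R (stack_rows H1 H2) \<longleftrightarrow>
      lincomb (opposite_ring R) n (rows H1 @ rows H2) ` carrier (right_space R n) = carrier (right_space R n)"
    using invertible_over_iff_left_span[OF H_sub H_len] by simp
  also have "lincomb (opposite_ring R) n (rows H1 @ rows H2) ` carrier (right_space R n) =
      dual_code R n C <+>\<^bsub>right_space (opposite_ring R) n\<^esub> dual_code R n D"
    using opp.range_lincomb_append[of "rows H1" n "rows H2"] C_dual(1) D_dual(1)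
    unfolding H_len carrier_right_space_opposite_ring C_dual(3) D_dual(3) by blast
  finally have "invertible_over R (stack_rows H1 H2) \<longleftrightarrow>
      dual_code R n C <+>\<^bsub>right_space (opposite_ring R) n\<^esub> dual_code R n D = carrier (right_space R n)" .
  moreover have "card (dual_code R n C) * card (dual_code R n D) = card (carrier (right_space R n))"
    using H_len by (simp add: C_dual(5) D_dual(5) card_right_space flip: power_add)
  ultimately have "LCP R n C D \<longleftrightarrow> invertible_over R (stack_rows H1 H2)"
    using sum_eq_iff_dual_sum_eq[OF C(5) D(5) assms(9)] unfolding LCP by blast
  with G show ?thesis
    by blast
qed

end
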